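(* Let $K$ be a field and let $A$ be a finitely generated amenable $K$-algebra with no zero divisors. (1) $A$ is weakly stable if and only if there is a sequence $\psi_k:A\to M_{n_k}(K)$ of representations such that $(\psi_k)$ is a linear sofic representation. (2) If $A=K\Gamma$ is the group algebra of an amenable group $\Gamma$, then $A$ is weakly stable if and only if $\Gamma$ is residually finite.
   Context: Algebras are associative and unital. Fix a finite generating set $S$ of $A$ with $1\in S$. For $r\in\mathbb{N}$, $S^r$ is the set of all monomials of length at most $r$ in $S$, and $A_{\le r}=\mathrm{span}_K(S^r)$. For $X\in M_n(K)$, $rk(X)=\frac1n\mathrm{rank}(X)$. Amenable algebra: a finitely generated $K$-algebra $A$ is amenable if there is a sequence of finite-dimensional linear subspaces $W_1\subseteq W_2\subseteq\cdots$ with $\bigcup_n W_n=A$ such that for every nonzero finite-dimensional subspace $V\le A$, $\dim_K(VW_n)/\dim_K(W_n)\to 1$ as $n\to\infty$, where $VW$ is the span of all products $vw$, $v\in V$, $w\in W$. $d$-approximation ($d\in\mathbb{N}$, $d\ge1$): a $K$-linear map $\phi:A\to M_n(K)$ is a $d$-approximation of $(A,S)$ if there is a subspace $U\le K^n$ such that: (i) $\phi(xy)u=\phi(x)\phi(y)u$ for all $x,y\in A_{\le d}$ and $u\in U$; (ii) $\dim U\ge(1-\frac1d)n$; (iii) $rk(\phi(a))\ge 1-\frac1d$ for every nonzero $a\in A_{\le d}$. Linear sofic representation: a sequence of $K$-linear maps $\phi_k:A\to M_{n_k}(K)$, $k\in\mathbb{N}$, such that for every $d\in\mathbb{N}$,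 $\phi_k$ is a $d$-approximation of $(A,S)$ for all large enough $k$. A representation $\psi:A\to M_n(K)$ is a $K$-linear multiplicative map, not necessarily unital. Weakly stable: $A$ is weakly stable if for every $\varepsilon>0$ there is $d\in\mathbb{N}$ such that for any $n$ and any $d$-approximation $\phi:A\to M_n(K)$ there is a representation $\psi:A\to M_n(K)$ with $rk(\phi(s)-\psi(s))<\varepsilon$ for all $s\in S$. *)

theory Defs
  imports
    Complex_Main
    "HOL-Library.Poly_Mapping"
    "HOL-Algebra.Coset"
    "Jordan_Normal_Form.DL_Rank"
begin

locale K_algebra = vector_space scale
  for scale :: "'k::field \<Rightarrow> 'a::ring_1 \<Rightarrow> 'a" +
  assumes scale_mult_left: "scale c (x * y) = scale c x * y"
    and scale_mult_right: "scale c (x * y) = x * scale c y"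

definition algebra_iso ::
  "('k::field \<Rightarrow> 'a::ring_1 \<Rightarrow> 'a) \<Rightarrow> ('k \<Rightarrow> 'b::ring_1 \<Rightarrow> 'b) \<Rightarrow> ('a \<Rightarrow> 'b) \<Rightarrow> bool" where
  "algebra_iso scale1 scale2 f \<longleftrightarrow>
     bij f \<and>
     (\<forall>x y. f (x + y) = f x + f y) \<and>
     (\<forall>c x. f (scale1 c x) = scale2 c (f x)) \<and>
     (\<forall>x y. f (x * y) = f x * f y) \<and>
     f 1 = 1"

text \<open>Normalized rank of an \<open>n \<times> n\<close> matrix. Only used for \<open>n \<ge> 1\<close>.\<close>

definition rk :: "nat \<Rightarrow> 'k::field mat \<Rightarrow> real" where
  "rk n X = real (vec_space.rank n X) / real n"

text \<open>The dimension of a linear subspace \<open>U\<close> of \<open>K\<^sup>n\<close>.\<close>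

definition vec_subspace_dim :: "nat \<Rightarrow> 'k::field vec set \<Rightarrow> nat" where
  "vec_subspace_dim n U =
     vectorspace.dim (class_ring :: 'k ring) ((module_vec TYPE('k) n)\<lparr>carrier := U\<rparr>)"

context K_algebra
begin

definition is_subalgebra :: "'a set \<Rightarrow> bool" where
  "is_subalgebra B \<longleftrightarrow> subspace B \<and> 1 \<in> B \<and> (\<forall>x\<in>B. \<forall>y\<in>B. x * y \<in> B)"

definition generates :: "'a set \<Rightarrow> bool" where
  "generates S \<longleftrightarrow> is_subalgebra hull S = UNIV"

definition monomials :: "'a set \<Rightarrow> nat \<Rightarrow> 'a set" where
  "monomials S r = {prod_list xs | xs. set xs \<subseteq> S \<and> length xs \<le> r}"

definition A_le :: "'a set \<Rightarrow> nat \<Rightarrow> 'a set" where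
  "A_le S r = span (monomials S r)"

definition fin_dim_subspace :: "'a set \<Rightarrow> bool" where
  "fin_dim_subspace V \<longleftrightarrow> (\<exists>B. finite B \<and> V = span B)"

definition amenable :: bool where
  "amenable \<longleftrightarrow>
     (\<exists>S. finite S \<and> generates S) \<and>
     (\<exists>W :: nat \<Rightarrow> 'a set.
        (\<forall>i. fin_dim_subspace (W i)) \<and>
        (\<forall>i. W i \<subseteq> W (Suc i)) \<and>
        (\<Union>i. W i) = UNIV \<and>
        (\<forall>V. fin_dim_subspace V \<and> V \<noteq> {0} \<longrightarrow>
           (\<lambda>i. real (dim (span {v * w | v w. v \<in> V \<and> w \<in> W i})) / real (dim (W i)))
             \<longlonglongrightarrow> 1))"

definition linear_to_mat :: "nat \<Rightarrow> ('a \<Rightarrow> 'k mat) \<Rightarrow> bool" where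
  "linear_to_mat n \<phi> \<longleftrightarrow>
     (\<forall>x. \<phi> x \<in> carrier_mat n n) \<and>
     (\<forall>x y. \<phi> (x + y) = \<phi> x + \<phi> y) \<and>
     (\<forall>c x. \<phi> (scale c x) = c \<cdot>\<^sub>m \<phi> x)"

text \<open>Representations need not be unital.\<close>

definition matrix_representation :: "nat \<Rightarrow> ('a \<Rightarrow> 'k mat) \<Rightarrow> bool" where
  "matrix_representation n \<psi> \<longleftrightarrow> linear_to_mat n \<psi> \<and> (\<forall>x y. \<psi> (x * y) = \<psi> x * \<psi> y)"

text \<open>Meant for \<open>d \<ge> 1\<close> and \<open>n \<ge> 1\<close>; both are imposed wherever the notion is used.\<close>

definition d_approximation :: "'a set \<Rightarrow> nat \<Rightarrow> nat \<Rightarrow> ('a \<Rightarrow> 'k mat) \<Rightarrow> bool" where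
  "d_approximation S d n \<phi> \<longleftrightarrow>
     linear_to_mat n \<phi> \<and>
     (\<exists>U. VectorSpace.subspace class_ring U (module_vec TYPE('k) n) \<and>
        (\<forall>x\<in>A_le S d. \<forall>y\<in>A_le S d. \<forall>u\<in>U.
           \<phi> (x * y) *\<^sub>v u = \<phi> x *\<^sub>v (\<phi> y *\<^sub>v u)) \<and>
        real (vec_subspace_dim n U) \<ge> (1 - 1 / real d) * real n) \<and>
     (\<forall>a\<in>A_le S d. a \<noteq> 0 \<longrightarrow> rk n (\<phi> a) \<ge> 1 - 1 / real d)"

definition linear_sofic_representation ::
  "'a set \<Rightarrow> (nat \<Rightarrow> nat) \<Rightarrow> (nat \<Rightarrow> 'a \<Rightarrow> 'k mat) \<Rightarrow> bool" where
  "linear_sofic_representation S n \<phi> \<longleftrightarrow>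
     (\<forall>k. n k \<ge> 1 \<and> linear_to_mat (n k) (\<phi> k)) \<and>
     (\<forall>d\<ge>1. \<forall>\<^sub>F k in sequentially. d_approximation S d (n k) (\<phi> k))"

definition weakly_stable :: "'a set \<Rightarrow> bool" where
  "weakly_stable S \<longleftrightarrow>
     (\<forall>\<epsilon>::real. \<epsilon> > 0 \<longrightarrow>
        (\<exists>d\<ge>1. \<forall>n\<ge>1. \<forall>\<phi>. d_approximation S d n \<phi> \<longrightarrow>
           (\<exists>\<psi>. matrix_representation n \<psi> \<and> (\<forall>s\<in>S. rk n (\<phi> s - \<psi> s) < \<epsilon>))))"

end

text \<open>
  Groups are taken as types of class \<^class>\<open>group_add\<close>, which is not assumed commutative: the
  group law is just written additively. Then \<open>'g \<Rightarrow>\<^sub>0 'k\<close>, with the convolution product of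
  \<open>Poly_Mapping\<close> (so \<open>single g a * single h b = single (g + h) (a * b)\<close>), is the group algebra.
\<close>

definition group_algebra_scale ::
  "'k::field \<Rightarrow> ('g::group_add \<Rightarrow>\<^sub>0 'k) \<Rightarrow> ('g \<Rightarrow>\<^sub>0 'k)" where
  "group_algebra_scale c p = Poly_Mapping.map ((*) c) p"

definition type_group :: "'g::group_add itself \<Rightarrow> 'g monoid" where
  "type_group _ = \<lparr>carrier = UNIV, mult = (+), one = 0\<rparr>"

definition residually_finite :: "('g, 'm) monoid_scheme \<Rightarrow> bool" where
  "residually_finite G \<longleftrightarrow>
     (\<forall>g\<in>carrier G. g \<noteq> \<one>\<^bsub>G\<^esub> \<longrightarrow>
        (\<exists>N. N \<lhd> G \<and> finite (rcosets\<^bsub>G\<^esub> N) \<and> g \<notin> N))"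

text \<open>Amenability of a discrete group, in the sense of Foelner.\<close>

definition amenable_group :: "('g, 'm) monoid_scheme \<Rightarrow> bool" where
  "amenable_group G \<longleftrightarrow>
     (\<forall>F \<epsilon>. finite F \<and> F \<subseteq> carrier G \<and> (\<epsilon>::real) > 0 \<longrightarrow>
        (\<exists>E. finite E \<and> E \<noteq> {} \<and> E \<subseteq> carrier G \<and>
           (\<forall>g\<in>F. real (card (((g <#\<^bsub>G\<^esub> E) - E) \<union> (E - (g <#\<^bsub>G\<^esub> E)))) \<le> \<epsilon> * real (card E))))"

lemma group_type_group: "group (type_group TYPE('g::group_add))"
proof (rule groupI)
  fix x assume "x \<in> carrier (type_group TYPE('g))"
  show "\<exists>y\<in>carrier (type_group TYPE('g)). y \<otimes>\<^bsub>type_group TYPE('g)\<^esub> x = \<one>\<^bsub>type_group TYPE('g)\<^esub>"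
    by (rule bexI[of _ "- x"]) (simp_all add: type_group_def)
qed (simp_all add: type_group_def add.assoc)

lemma lookup_group_algebra_scale:
  "Poly_Mapping.lookup (group_algebra_scale c p) g = c * Poly_Mapping.lookup p g"
  unfolding group_algebra_scale_def by transfer (simp add: when_def)

lemma group_algebra_scale_eq_left:
  "group_algebra_scale c p = Poly_Mapping.single 0 c * p"
  by (rule poly_mapping_eqI) (simp add: lookup_group_algebra_scale times_poly_mapping.rep_eq
        lookup_single prod_fun_def when_mult)

lemma group_algebra_scale_eq_right:
  fixes p :: "'g::group_add \<Rightarrow>\<^sub>0 'k::field"
  shows "group_algebra_scale c p = p * Poly_Mapping.single 0 c"
proof (rule poly_mapping_eqI)
  fix g
  have "(\<Sum>q. ((c when 0 = q) when g = l + q)) = (c when g = l)" for l :: 'g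
  proof -
    have "(\<lambda>q. ((c when 0 = q) when g = l + q)) = (\<lambda>q. ((c when g = l) when q = 0))"
      by (auto simp: when_def fun_eq_iff)
    then show ?thesis by (simp only: Sum_any_when_equal)
  qed
  then have "Poly_Mapping.lookup (p * Poly_Mapping.single 0 c) g = (\<Sum>l. Poly_Mapping.lookup p l * (c when g = l))"
    by (simp add: times_poly_mapping.rep_eq lookup_single prod_fun_def)
  also have "\<dots> = Poly_Mapping.lookup p g * c"
    by (simp add: mult_when)
  finally show "Poly_Mapping.lookup (group_algebra_scale c p) g = Poly_Mapping.lookup (p * Poly_Mapping.single 0 c) g"
    by (simp add: lookup_group_algebra_scale mult.commute)
qed

lemma K_algebra_group_algebra:
  "K_algebra (group_algebra_scale :: 'k::field \<Rightarrow> ('g::group_add \<Rightarrow>\<^sub>0 'k) \<Rightarrow> _)"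
proof
  fix c :: 'k and x y :: "'g \<Rightarrow>\<^sub>0 'k"
  show "group_algebra_scale c (x * y) = group_algebra_scale c x * y"
    by (simp add: group_algebra_scale_eq_left mult.assoc)
  have "Poly_Mapping.single 0 c * x = x * Poly_Mapping.single 0 c"
    by (metis group_algebra_scale_eq_left group_algebra_scale_eq_right)
  then show "group_algebra_scale c (x * y) = x * group_algebra_scale c y"
    by (simp add: group_algebra_scale_eq_left mult.assoc[symmetric])
qed (auto intro!: poly_mapping_eqI simp: lookup_group_algebra_scale lookup_add algebra_simps)

end

theory Submission
  imports Defs "HOL-Library.Function_Algebras" "HOL-Library.Nat_Bijection"
    "Jordan_Normal_Form.Char_Poly"
begin

text \<open>An approximation \<open>\<phi>\<close> of size \<open>n\<close> lets every nonzero element of a ball \<open>A_le S d\<close> act with almost full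
rank. For an amenable algebra this determines \<open>\<phi>\<close> up to conjugation and an error of small rank, because
\<open>K\<^sup>n\<close> can be tiled. Let \<open>W\<close> be a Foelner subspace, so that \<open>s * w\<close> stays in \<open>W\<close> for most \<open>w\<close>. A vector \<open>u\<close>
in general position has a tile \<open>{\<phi> w u | w \<in> W}\<close> that is a copy of \<open>W\<close> and is independent of all earlier
tiles, as long as these leave a space of dimension \<open>dim W\<close> free (\<open>tiles_exist\<close>). The general
position argument is \<open>separating_vector\<close>: a finite-dimensional space of operators in which every
nonzero member has rank at least the dimension of the space has a vector on which it acts
injectively. In the end the tiles fill almost all of \<open>K\<^sup>n\<close>, and on each tile \<open>\<phi> s\<close> is left
multiplication by \<open>s\<close>, wherever this does not leave \<open>W\<close>.

First equivalence, from representations to stability: one representation of almost full rank, repeated so often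
that its size is just below \<open>n\<close>, has the same kind of tiling. A linear injection that carries
its tiles to the tiles of \<open>\<phi>\<close> turns it into a representation on \<open>K\<^sup>n\<close> that agrees with \<open>\<phi> s\<close> on almost
everything (\<open>conjugate_to_match_tiles\<close>, \<open>representations_imp_weakly_stable\<close>). The argument needs \<open>n\<close> to be
large; for large \<open>d\<close> an approximation of small size is itself a representation.

First equivalence, from stability to representations: compressing left multiplication to a Foelner subspace
gives approximations, where the absence of zero divisors yields the rank condition
(\<open>exists_approximation\<close>). Weak stability replaces them by representations that are close on \<open>S\<close>, hence
close on all short products and their combinations, so the rank condition survives
(\<open>weakly_stable_imp_representation\<close>).

The second equivalence asks when the group algebra has representations of almost full rank. If the group is
residually finite, permutation representations on deep finite quotients work: the
kernel \<open>Z\<close> of an element \<open>a\<close> has a set \<open>P\<close> of \<open>dim Z\<close> coordinates that can be prescribed freely, and a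
translate of a Foelner set \<open>E\<close> contains at most as many points of \<open>P\<close> as \<open>E\<close> has boundary points, since a
nonzero function \<open>f\<close> on \<open>E\<close> has \<open>a * f \<noteq> 0\<close>, whereas a function that extends to a kernel element has \<open>a * f\<close>
supported on the boundary. Averaging over all translates shows that \<open>P\<close> is small.
Conversely, a representation of almost full rank does not kill \<open>g - 1\<close>. The matrix entries of
a finitely generated group lie in a finitely generated domain, in which every nonzero element avoids
some prime ideal of finite index (\<open>finite_subset_of_finitely_separated\<close>); reducing the matrices modulo
such a prime gives a finite quotient of the group in which \<open>g\<close> survives. This is Malcev's theorem.\<close>

section \<open>Dimension of finite-dimensional subsets\<close>

text \<open>The spaces \<open>K\<^sup>n\<close> for varying \<open>n\<close> are all treated as subspaces of one space of sequences. The ambient space is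
then infinite-dimensional, so finite dimensionality becomes a property of subsets, and the dimension
formulas below carry it as an assumption.\<close>

locale linear_space = vector_space scale
  for scale :: "'k::field \<Rightarrow> 'b::ab_group_add \<Rightarrow> 'b" (infixr "*s" 75)
begin

definition fin_dimensional :: "'b set \<Rightarrow> bool" where
  "fin_dimensional W \<longleftrightarrow> (\<exists>B. finite B \<and> W \<subseteq> span B)"

lemma fin_dimensional_subset: "fin_dimensional W \<Longrightarrow> V \<subseteq> W \<Longrightarrow> fin_dimensional V"
  unfolding fin_dimensional_def by blast

lemma fin_dimensional_span: "finite B \<Longrightarrow> fin_dimensional (span B)"
  unfolding fin_dimensional_def by blast

lemma independent_card_le:
  assumes "fin_dimensional W" "B \<subseteq> W" "independent B"
  shows "finite B \<and> card B \<le> dim W"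
proof -
  obtain C where C: "finite C" "W \<subseteq> span C" using assms(1) fin_dimensional_def by auto
  obtain D where D: "D \<subseteq> W" "independent D" "W \<subseteq> span D" "card D = dim W"
    using basis_exists[of W] by auto
  have "finite D" using independent_span_bound[OF C(1) D(2)] D(1) C(2) by auto
  then show ?thesis using independent_span_bound[OF _ assms(3), of D] assms(2) D by auto
qed

lemma fin_dimensional_basis:
  assumes "fin_dimensional W"
  obtains B where "finite B" "B \<subseteq> W" "independent B" "W \<subseteq> span B" "card B = dim W"
  using basis_exists[of W] independent_card_le[OF assms] by metis

lemma subspace_basis:
  assumes "fin_dimensional W" "subspace W"
  obtains B where "finite B" "independent B" "span B = W" "card B = dim W"
proof -
  obtain B where "finite B" "B \<subseteq> W" "independent B" "W \<subseteq> span B" "card B = dim W"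
    using fin_dimensional_basis[OF assms(1)] .
  then show ?thesis using that[of B] span_minimal[of B W] assms(2) by blast
qed

lemma fin_dimensional_dim_mono:
  assumes "fin_dimensional W" "V \<subseteq> W" shows "dim V \<le> dim W"
proof -
  obtain B where "B \<subseteq> V" "independent B" "V \<subseteq> span B" "card B = dim V"
    using basis_exists[of V] by auto
  then show ?thesis using independent_card_le[OF assms(1), of B] assms(2) by auto
qed

lemma fin_dimensional_subspace_eq:
  assumes W: "fin_dimensional W" and V: "V \<subseteq> W" "subspace V" and "dim W \<le> dim V"
  shows "V = W"
proof (rule ccontr)
  assume "V \<noteq> W"
  then obtain w where w: "w \<in> W" "w \<notin> V" using V by auto
  obtain B where B: "finite B" "independent B" "span B = V" "card B = dim V"
    using subspace_basis fin_dimensional_subset W V by metis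
  have "independent (insert w B)" using B w by (simp add: independent_insertI)
  moreover have "insert w B \<subseteq> W" using w B V span_superset[of B] by auto
  ultimately have "card (insert w B) \<le> dim W" using independent_card_le[OF W] by blast
  moreover have "w \<notin> B" using w B span_superset[of B] by auto
  ultimately show False using B assms(4) by auto
qed

end

locale linear_space_pair = vs1: linear_space s1 + vs2: linear_space s2
  for s1 :: "'k::field \<Rightarrow> 'b::ab_group_add \<Rightarrow> 'b" (infixr "*a" 75)
    and s2 :: "'k \<Rightarrow> 'c::ab_group_add \<Rightarrow> 'c" (infixr "*b" 75)
begin

sublocale vector_space_pair s1 s2 by unfold_locales

end

context linear_space
begin

text \<open>A projection along a complement. Composing with \<open>p\<close> reduces questions modulo \<open>T\<close> to questions modulo \<open>0\<close>
without forming quotient spaces.\<close>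

lemma subspace_is_kernel:
  assumes "subspace T"
  obtains p where "Vector_Spaces.linear scale scale p" "\<And>v. p v = 0 \<longleftrightarrow> v \<in> T"
proof -
  have vp: "vector_space_pair scale scale"
    using vector_space_axioms by (simp add: vector_space_pair_def)
  obtain B where B: "B \<subseteq> T" "independent B" "T \<subseteq> span B" using basis_exists[of T] by metis
  have sB: "span B = T" using B assms span_minimal by blast
  define C where "C = extend_basis B"
  have C: "B \<subseteq> C" "independent C" "span C = UNIV"
    unfolding C_def using extend_basis_superset independent_extend_basis span_extend_basis B(2) by auto
  obtain p where p: "Vector_Spaces.linear scale scale p" "\<And>x. x \<in> C \<Longrightarrow> p x = (if x \<in> B then 0 else x)"
    using vector_space_pair.linear_independent_extend[OF vp C(2), of "\<lambda>x. if x \<in> B then 0 else x"] by blast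
  have p0: "p 0 = 0" and pa: "p (x + y) = p x + p y" and ps: "p (c *s x) = c *s p x" for x y c
    using p(1) module_hom.zero[of scale scale p] by (simp_all add: Vector_Spaces.linear_iff module_hom_iff_linear)
  have k0: "p x = 0" if "x \<in> span B" for x
    using that
  proof (induction rule: span_induct_alt)
    case base then show ?case using p0 by simp
  next
    case (step c x y)
    then show ?case using p(2) pa ps C(1) by auto
  qed
  have id: "p x = x" if "x \<in> span (C - B)" for x
    using that
  proof (induction rule: span_induct_alt)
    case base then show ?case using p0 by simp
  next
    case (step c x y)
    then show ?case using p(2) pa ps C(1) by auto
  qed
  have "p v = 0 \<longleftrightarrow> v \<in> T" for v
  proof
    assume pv: "p v = 0"
    have "v \<in> span (B \<union> (C - B))" using C by (simp add: Un_absorb1)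
    then obtain x y where xy: "v = x + y" "x \<in> span B" "y \<in> span (C - B)" unfolding span_Un by auto
    then have "p v = y" using k0 id pa by simp
    then show "v \<in> T" using pv xy sB by simp
  qed (use k0 sB in auto)
  then show ?thesis using that p(1) by blast
qed

end

context linear_space_pair
begin

lemma fin_dimensional_image:
  assumes "Vector_Spaces.linear s1 s2 f" "vs1.fin_dimensional W"
  shows "vs2.fin_dimensional (f ` W)"
proof -
  obtain B where "finite B" "W \<subseteq> vs1.span B" using assms(2) vs1.fin_dimensional_def by auto
  then have "f ` W \<subseteq> vs2.span (f ` B)" using linear_span_image[OF assms(1), of B] by auto
  then show ?thesis using \<open>finite B\<close> vs2.fin_dimensional_def by auto
qed

lemma subspace_kernel_in:
  assumes "Vector_Spaces.linear s1 s2 f" "vs1.subspace W" "vs2.subspace T"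
  shows "vs1.subspace {w\<in>W. f w \<in> T}"
  using assms by (auto simp: vs1.subspace_def vs2.subspace_def linear_add linear_scale linear_0)

text \<open>A basis of the kernel is extended to a basis of \<open>W\<close>; the added vectors are mapped to a basis of the image.\<close>

lemma rank_nullity:
  assumes f: "Vector_Spaces.linear s1 s2 f" and W: "vs1.subspace W" "vs1.fin_dimensional W"
  shows "vs2.dim (f ` W) + vs1.dim {w\<in>W. f w = 0} = vs1.dim W"
proof -
  let ?N = "{w\<in>W. f w = 0}"
  have sN: "vs1.subspace ?N" using subspace_kernel_in[OF f W(1), of "{0}"] by simp
  obtain B where B: "finite B" "vs1.independent B" "vs1.span B = ?N" "card B = vs1.dim ?N"
    using vs1.subspace_basis[OF vs1.fin_dimensional_subset[OF W(2)] sN] by blast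
  have BW: "B \<subseteq> W" using B(3) vs1.span_superset[of B] by auto
  obtain C where C: "B \<subseteq> C" "C \<subseteq> W" "vs1.independent C" "W \<subseteq> vs1.span C"
    using vs1.maximal_independent_subset_extend[OF BW B(2)] by auto
  have fC: "finite C" using vs1.independent_card_le[OF W(2) C(2,3)] by auto
  have dW: "card C = vs1.dim W" using vs1.basis_card_eq_dim[OF C(2,4,3)] .
  have inj: "inj_on f (vs1.span (C - B))"
  proof (rule inj_onI)
    fix x y assume xy: "x \<in> vs1.span (C - B)" "y \<in> vs1.span (C - B)" "f x = f y"
    have d: "x - y \<in> vs1.span (C - B)" using xy vs1.span_diff by auto
    have "x - y \<in> W" using d vs1.span_mono[of "C - B" C] vs1.span_minimal[OF C(2) W(1)] by auto
    then have "x - y \<in> vs1.span B" using B(3) xy(3) by (simp add: linear_diff[OF f])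
    then obtain u where u: "x - y = (\<Sum>b\<in>B. u b *a b)" using vs1.span_finite[OF B(1)] by auto
    obtain v where v: "x - y = (\<Sum>b\<in>C - B. v b *a b)" using d vs1.span_finite[of "C-B"] fC by auto
    define w where "w b = (if b \<in> B then u b else - v b)" for b
    have "(\<Sum>b\<in>C. w b *a b) = (\<Sum>b\<in>C - B. w b *a b) + (\<Sum>b\<in>B. w b *a b)"
      using sum.subset_diff[OF C(1) fC] .
    also have "(\<Sum>b\<in>C - B. w b *a b) = - (\<Sum>b\<in>C - B. v b *a b)"
      by (simp add: w_def sum_negf)
    also have "(\<Sum>b\<in>B. w b *a b) = (\<Sum>b\<in>B. u b *a b)"
      by (simp add: w_def)
    finally have "(\<Sum>b\<in>C. w b *a b) = 0" unfolding u[symmetric] v[symmetric] by simp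
    then have "\<forall>b\<in>C. w b = 0" using vs1.independentD[OF C(3) fC order_refl] by blast
    then have "\<forall>b\<in>B. u b = 0" using C(1) w_def by (metis subsetD)
    then show "x = y" using u by simp
  qed
  have fi: "vs2.independent (f ` (C - B))"
    using linear_independent_injective_image[OF f vs1.independent_mono[OF C(3)], of "C - B"] inj by auto
  have "inj_on f (C - B)" using inj inj_on_subset vs1.span_superset by metis
  then have cf: "card (f ` (C - B)) = card C - card B" using card_image card_Diff_subset B(1) C(1) by metis
  have "f ` W \<subseteq> vs2.span (f ` (C - B))"
  proof
    fix y assume "y \<in> f ` W"
    then obtain x where x: "x \<in> W" "y = f x" by auto
    then have "x \<in> vs1.span (B \<union> (C - B))" using C by (auto simp: Un_absorb1)
    then obtain a b where ab: "x = a + b" "a \<in> vs1.span B" "b \<in> vs1.span (C - B)"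
      unfolding vs1.span_Un by auto
    then have "y = f b" using x B(3) by (simp add: linear_add[OF f])
    then show "y \<in> vs2.span (f ` (C - B))" using ab linear_span_image[OF f] by auto
  qed
  moreover have "f ` (C - B) \<subseteq> f ` W" using C by auto
  ultimately have "card (f ` (C - B)) = vs2.dim (f ` W)"
    using vs2.basis_card_eq_dim fi by blast
  then show ?thesis using cf B(4) dW card_mono[OF fC C(1)] by simp
qed

text \<open>Taking preimages does not increase codimension. All estimates on how many vectors satisfy several
conditions at once are instances of this.\<close>

lemma dim_preimage_ge:
  assumes f: "Vector_Spaces.linear s1 s2 f" and W: "vs1.subspace W" "vs1.fin_dimensional W"
    and Z: "vs2.subspace Z" "vs2.fin_dimensional Z" and T: "vs2.subspace T" "T \<subseteq> Z" and "f ` W \<subseteq> Z"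
  shows "vs1.dim W + vs2.dim T \<le> vs1.dim {w\<in>W. f w \<in> T} + vs2.dim Z"
proof -
  interpret p22: linear_space_pair s2 s2 ..
  obtain p where p: "Vector_Spaces.linear s2 s2 p" "\<And>v. p v = 0 \<longleftrightarrow> v \<in> T"
    using vs2.subspace_is_kernel[OF T(1)] by blast
  have "{z\<in>Z. p z = 0} = T" using p T by auto
  then have 1: "vs2.dim (p ` Z) + vs2.dim T = vs2.dim Z" using p22.rank_nullity[OF p(1) Z] by simp
  have 2: "vs2.dim ((p \<circ> f) ` W) + vs1.dim {w\<in>W. f w \<in> T} = vs1.dim W"
    using rank_nullity[OF Vector_Spaces.linear_compose[OF f p(1)] W] p(2) by simp
  have "vs2.dim ((p \<circ> f) ` W) \<le> vs2.dim (p ` Z)"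
    using vs2.fin_dimensional_dim_mono[OF p22.fin_dimensional_image[OF p(1) Z(2)]] assms(8)
    by (metis image_comp image_mono)
  then show ?thesis using 1 2 by simp
qed

end

section \<open>Separating vectors\<close>

context linear_space
begin

text \<open>Linear independence of an indexed family. Unlike independence of the set of its values it excludes
repetitions and can be read off a single linear combination.\<close>

definition indep_family :: "'i set \<Rightarrow> ('i \<Rightarrow> 'b) \<Rightarrow> bool" where
  "indep_family J a \<longleftrightarrow> (\<forall>y. (\<Sum>j\<in>J. y j *s a j) = 0 \<longrightarrow> (\<forall>j\<in>J. y j = 0))"

lemma indep_family_iff:
  assumes J: "finite J"
  shows "indep_family J a \<longleftrightarrow> inj_on a J \<and> independent (a ` J)"
proof
  assume H: "indep_family J a"
  have inj: "inj_on a J"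
  proof (rule inj_onI, rule ccontr)
    fix i j assume ij: "i \<in> J" "j \<in> J" "a i = a j" "i \<noteq> j"
    define y where "y k = (if k = i then 1 else if k = j then -1 else 0 :: 'k)" for k
    have "(\<Sum>k\<in>J. y k *s a k) = (\<Sum>k\<in>{i,j}. y k *s a k)"
      using J ij by (intro sum.mono_neutral_right) (auto simp: y_def)
    also have "\<dots> = 0" using ij by (simp add: y_def)
    finally show False using H ij(1) unfolding indep_family_def y_def by fastforce
  qed
  have "independent (a ` J)"
  proof (rule independent_if_scalars_zero)
    fix f x assume s: "(\<Sum>x\<in>a ` J. f x *s x) = 0" and x: "x \<in> a ` J"
    have "(\<Sum>j\<in>J. f (a j) *s a j) = 0" using s by (simp add: sum.reindex[OF inj])
    then show "f x = 0" using H x unfolding indep_family_def by fastforce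
  qed (use J in simp)
  then show "inj_on a J \<and> independent (a ` J)" using inj by simp
next
  assume H: "inj_on a J \<and> independent (a ` J)"
  show "indep_family J a"
    unfolding indep_family_def
  proof (intro allI impI)
    fix y assume y: "(\<Sum>j\<in>J. y j *s a j) = 0"
    have "(\<Sum>x\<in>a ` J. y (the_inv_into J a x) *s x) = (\<Sum>j\<in>J. y j *s a j)"
      using H by (subst sum.reindex) (auto intro!: sum.cong simp: the_inv_into_f_f)
    then have "\<forall>x\<in>a ` J. y (the_inv_into J a x) = 0"
      using y H J independentD[of "a ` J" "a ` J" "\<lambda>x. y (the_inv_into J a x)"] by simp
    then show "\<forall>j\<in>J. y j = 0" using H by (simp add: the_inv_into_f_f)
  qed
qed

lemma indep_family_coordinates:
  assumes J: "finite J" "indep_family J a"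
  obtains l where "\<And>j. Vector_Spaces.linear scale (*) (l j)"
    "\<And>i j. i \<in> J \<Longrightarrow> j \<in> J \<Longrightarrow> l j (a i) = (if i = j then 1 else 0)"
proof -
  have vp: "vector_space_pair scale ((*) :: 'k \<Rightarrow> 'k \<Rightarrow> 'k)"
    using vector_space_axioms by (simp add: vector_space_pair_def vector_space_def algebra_simps)
  have I: "inj_on a J" "independent (a ` J)" using J indep_family_iff by auto
  have "\<exists>g. Vector_Spaces.linear scale (*) g \<and>
      (\<forall>x\<in>a ` J. g x = (if the_inv_into J a x = j then 1 else 0))" for j
    using vector_space_pair.linear_independent_extend[OF vp I(2)] .
  then obtain l where l: "\<And>j. Vector_Spaces.linear scale (*) (l j)"
    "\<And>j x. x \<in> a ` J \<Longrightarrow> l j x = (if the_inv_into J a x = j then 1 else 0)"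
    by metis
  show ?thesis
    by (rule that[OF l(1)]) (use l(2) I(1) in \<open>auto simp: the_inv_into_f_f\<close>)
qed

text \<open>With coordinate functionals dual to \<open>a\<close>, the perturbed family becomes the matrix \<open>1 + t N\<close>. A linear relation
at \<open>t \<noteq> 0\<close> makes \<open>- 1 / t\<close> an eigenvalue of \<open>N\<close>, and there are only finitely many of these.\<close>

lemma indep_family_perturb:
  fixes a c :: "nat \<Rightarrow> 'b"
  assumes a: "indep_family {..<m} a"
  shows "finite {t. \<not> indep_family {..<m} (\<lambda>i. a i + t *s c i)}"
proof -
  obtain l where l: "\<And>j. Vector_Spaces.linear scale (*) (l j)"
    "\<And>i j. i < m \<Longrightarrow> j < m \<Longrightarrow> l j (a i) = (if i = j then 1 else 0)"
    using indep_family_coordinates[OF _ a] by auto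
  define N where "N = mat m m (\<lambda>(i, j). l i (c j))"
  have N: "N \<in> carrier_mat m m" by (simp add: N_def)
  have lin: "l i (x + y) = l i x + l i y" "l i (k *s x) = k * l i x" for i x y k
    using l(1)[of i] by (auto simp: Vector_Spaces.linear_iff)
  have l0: "l i 0 = 0" for i using lin(2)[of i 0 0] by simp
  have lsum: "l i (\<Sum>j\<in>A. f j) = (\<Sum>j\<in>A. l i (f j))" for i A and f :: "nat \<Rightarrow> 'b"
    by (induction A rule: infinite_finite_induct) (simp_all add: lin l0)
  have ev: "eigenvalue N (- inverse t)"
    if t: "t \<noteq> 0" "\<not> indep_family {..<m} (\<lambda>i. a i + t *s c i)" for t
  proof -
    obtain y j0 where y: "(\<Sum>j<m. y j *s (a j + t *s c j)) = 0" "j0 < m" "y j0 \<noteq> 0"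
      using t(2) unfolding indep_family_def by auto
    define v where "v = vec m y"
    have "(N *\<^sub>v v) $ i = ((- inverse t) \<cdot>\<^sub>v v) $ i" if i: "i < m" for i
    proof -
      have "0 = l i (\<Sum>j<m. y j *s (a j + t *s c j))" using y(1) l0 by simp
      also have "\<dots> = (\<Sum>j<m. y j * l i (a j) + t * (l i (c j) * y j))"
        by (simp add: lsum lin algebra_simps)
      also have "\<dots> = (\<Sum>j<m. y j * l i (a j)) + t * (\<Sum>j<m. l i (c j) * y j)"
        by (simp add: sum.distrib sum_distrib_left)
      also have "(\<Sum>j<m. y j * l i (a j)) = (\<Sum>j<m. if j = i then y j else 0)"
        using i l(2) by (intro sum.cong) auto
      also have "\<dots> = y i" using i by simp
      also have "(\<Sum>j<m. l i (c j) * y j) = (N *\<^sub>v v) $ i"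
        using i by (simp add: N_def v_def scalar_prod_def atLeast0LessThan)
      finally have "y i + t * (N *\<^sub>v v) $ i = 0" by simp
      then have "(N *\<^sub>v v) $ i = - inverse t * y i" using t(1) by (simp add: field_simps add_eq_0_iff)
      then show ?thesis using i by (simp add: v_def)
    qed
    then have "N *\<^sub>v v = (- inverse t) \<cdot>\<^sub>v v" using N by (intro eq_vecI) (auto simp: v_def)
    moreover have "v \<noteq> 0\<^sub>v m" using y(2,3) by (metis index_vec index_zero_vec(1) v_def)
    ultimately show ?thesis using N unfolding eigenvalue_def eigenvector_def
      by (intro exI[of _ v]) (auto simp: v_def)
  qed
  have "char_poly N \<noteq> 0" using degree_monic_char_poly[OF N] by auto
  then have "finite {k. eigenvalue N k}"
    using poly_roots_finite by (simp add: eigenvalue_root_char_poly[OF N])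
  then have "finite ((\<lambda>k. - inverse k) ` {k. eigenvalue N k})" by simp
  moreover have "{t. \<not> indep_family {..<m} (\<lambda>i. a i + t *s c i)}
      \<subseteq> insert 0 ((\<lambda>k. - inverse k) ` {k. eigenvalue N k})"
  proof
    fix t assume t: "t \<in> {t. \<not> indep_family {..<m} (\<lambda>i. a i + t *s c i)}"
    show "t \<in> insert 0 ((\<lambda>k. - inverse k) ` {k. eigenvalue N k})"
    proof (cases "t = 0")
      case False
      then have "eigenvalue N (- inverse t)" "t = - inverse (- inverse t)" using ev t by auto
      then show ?thesis by blast
    qed simp
  qed
  ultimately show ?thesis using finite_subset by blast
qed

lemma card_subspace:
  assumes "finite (UNIV :: 'k set)" "fin_dimensional U" "subspace U"
  shows "finite U \<and> card U = card (UNIV :: 'k set) ^ dim U"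
proof -
  obtain B where B: "finite B" "independent B" "span B = U" "card B = dim U"
    using subspace_basis[OF assms(2,3)] by blast
  let ?F = "\<lambda>f. \<Sum>b\<in>B. f b *s b"
  have "inj_on ?F (B \<rightarrow>\<^sub>E (UNIV :: 'k set))"
  proof (rule inj_onI)
    fix f g assume fg: "f \<in> B \<rightarrow>\<^sub>E (UNIV :: 'k set)" "g \<in> B \<rightarrow>\<^sub>E (UNIV :: 'k set)" "?F f = ?F g"
    then have "(\<Sum>b\<in>B. (f b - g b) *s b) = 0" by (simp add: scale_left_diff_distrib sum_subtractf)
    then have "\<forall>b\<in>B. f b - g b = 0"
      using independentD[OF B(2,1) order_refl, of "\<lambda>b. f b - g b"] by blast
    then show "f = g" using fg by (intro PiE_ext[of f B "\<lambda>_. UNIV"]) auto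
  qed
  moreover have "?F ` (B \<rightarrow>\<^sub>E (UNIV :: 'k set)) = U"
  proof -
    have "U = range ?F" unfolding B(3)[symmetric] span_finite[OF B(1)] ..
    moreover have "?F u \<in> ?F ` (B \<rightarrow>\<^sub>E UNIV)" for u
      by (rule image_eqI[of _ _ "restrict u B"]) (auto intro: sum.cong)
    ultimately show ?thesis by blast
  qed
  moreover have "finite (B \<rightarrow>\<^sub>E (UNIV :: 'k set))" using B assms(1) by (simp add: finite_PiE)
  ultimately show ?thesis
    using card_image[of ?F "B \<rightarrow>\<^sub>E (UNIV :: 'k set)"] B(1,4) by (auto simp: card_PiE)
qed

end

context linear_space_pair
begin

lemma linear_comb:
  assumes "\<And>j. j \<in> J \<Longrightarrow> Vector_Spaces.linear s1 s2 (L j)"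
  shows "Vector_Spaces.linear s1 s2 (\<lambda>u. \<Sum>j\<in>J. x j *b L j u)"
  using assms by (intro linear_compose_sum ballI linear_compose_scale_right) auto

text \<open>Counting: each of the fewer than \<open>q ^ card J\<close> nonzero coefficient vectors \<open>x\<close> excludes at most
\<open>q ^ (dim U - card J)\<close> vectors \<open>u\<close>, so the excluded vectors cannot exhaust \<open>U\<close>.\<close>

lemma separating_vector_finite_field:
  assumes fin: "finite (UNIV :: 'k set)" and J: "finite J"
    and L: "\<And>j. j \<in> J \<Longrightarrow> Vector_Spaces.linear s1 s2 (L j)"
    and U: "vs1.subspace U" "vs1.fin_dimensional U" and T: "vs2.subspace T"
    and H: "\<And>x. \<exists>j\<in>J. x j \<noteq> 0 \<Longrightarrow>
      vs1.dim {u\<in>U. (\<Sum>j\<in>J. x j *b L j u) \<in> T} + card J \<le> vs1.dim U"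
  shows "\<exists>u\<in>U. \<forall>x. (\<Sum>j\<in>J. x j *b L j u) \<in> T \<longrightarrow> (\<forall>j\<in>J. x j = 0)"
proof -
  define q where "q = card (UNIV :: 'k set)"
  define K where "K x = {u\<in>U. (\<Sum>j\<in>J. x j *b L j u) \<in> T}" for x
  define X where "X = (J \<rightarrow>\<^sub>E (UNIV :: 'k set)) - {restrict (\<lambda>_. 0) J}"
  have q: "q \<ge> 1" unfolding q_def using fin by (simp add: Suc_leI finite_UNIV_card_ge_0)
  have fX: "finite (J \<rightarrow>\<^sub>E (UNIV :: 'k set))" using J fin by (simp add: finite_PiE)
  have cX: "card X = q ^ card J - 1" unfolding X_def using J fX by (simp add: card_PiE q_def)
  have ex: "\<exists>j\<in>J. x j \<noteq> 0" if "x \<in> X" for x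
  proof (rule ccontr)
    assume "\<not> (\<exists>j\<in>J. x j \<noteq> 0)"
    then have "x = restrict (\<lambda>_. 0) J"
      using that unfolding X_def by (intro PiE_ext[of x J "\<lambda>_. UNIV"]) auto
    then show False using that X_def by simp
  qed
  have dle: "card (K x) \<le> q ^ (vs1.dim U - card J)" if "x \<in> X" for x
  proof -
    have "vs1.dim (K x) \<le> vs1.dim U - card J" using H[OF ex[OF that]] by (simp add: K_def)
    moreover have "vs1.subspace (K x)"
      unfolding K_def using subspace_kernel_in[OF linear_comb[of J L x, OF L] U(1) T] by simp
    moreover have "vs1.fin_dimensional (K x)" using vs1.fin_dimensional_subset[OF U(2)] K_def by auto
    ultimately show ?thesis using vs1.card_subspace[OF fin] q q_def power_increasing by metis
  qed
  have cU: "finite U" "card U = q ^ vs1.dim U" using vs1.card_subspace[OF fin U(2,1)] q_def by auto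
  have "\<not> U \<subseteq> (\<Union>x\<in>X. K x)"
  proof
    assume sub: "U \<subseteq> (\<Union>x\<in>X. K x)"
    have fX': "finite X" using fX X_def by auto
    have "finite (\<Union>x\<in>X. K x)" using cU(1) by (rule rev_finite_subset) (auto simp: K_def)
    then have "card U \<le> card (\<Union>x\<in>X. K x)" using sub by (simp add: card_mono)
    also have "\<dots> \<le> (\<Sum>x\<in>X. card (K x))" using fX' by (rule card_UN_le)
    also have "\<dots> \<le> (\<Sum>x\<in>X. q ^ (vs1.dim U - card J))" using dle by (intro sum_mono)
    also have "\<dots> = (q ^ card J - 1) * q ^ (vs1.dim U - card J)" using cX by simp
    finally have le: "q ^ vs1.dim U \<le> (q ^ card J - 1) * q ^ (vs1.dim U - card J)" using cU by simp
    show False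
    proof (cases "X = {}")
      case True
      then show ?thesis using sub vs1.subspace_0[OF U(1)] by auto
    next
      case False
      then obtain x where "x \<in> X" by auto
      then have "card J \<le> vs1.dim U" using H[OF ex, of x] by simp
      then have "q ^ vs1.dim U = q ^ card J * q ^ (vs1.dim U - card J)" by (simp flip: power_add)
      moreover have "(q ^ card J - 1) * q ^ (vs1.dim U - card J) < q ^ card J * q ^ (vs1.dim U - card J)"
        using q by (intro mult_strict_right_mono) auto
      ultimately show ?thesis using le by simp
    qed
  qed
  then obtain u where u: "u \<in> U" "\<And>x. x \<in> X \<Longrightarrow> (\<Sum>j\<in>J. x j *b L j u) \<notin> T"
    unfolding K_def by auto
  have "\<forall>j\<in>J. x j = 0" if x: "(\<Sum>j\<in>J. x j *b L j u) \<in> T" for x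
  proof (rule ccontr)
    assume "\<not> (\<forall>j\<in>J. x j = 0)"
    then have "restrict x J \<in> X" unfolding X_def by (auto simp: fun_eq_iff restrict_def)
    moreover have "(\<Sum>j\<in>J. restrict x J j *b L j u) = (\<Sum>j\<in>J. x j *b L j u)" by (rule sum.cong) auto
    ultimately show False using u x by metis
  qed
  then show ?thesis using u by blast
qed

text \<open>Choose \<open>u\<close> such that the vectors \<open>L j u\<close> span a space of the largest possible dimension, and let \<open>x\<close> be a
relation between them. Moving to \<open>u + t v\<close> replaces \<open>0\<close> by \<open>t\<close> times the value of the operator \<open>\<Sum>j. x j L j\<close>
at \<open>v\<close>. If this value were outside the span, then for generic \<open>t\<close> it would enlarge the span. So the operator
maps all of \<open>U\<close> into the span, whose dimension is less than \<open>card J\<close> by the relation; this contradicts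
the lower bound on its rank.\<close>

lemma separating_vector_infinite_field:
  assumes inf: "infinite (UNIV :: 'k set)" and J: "finite J"
    and L: "\<And>j. j \<in> J \<Longrightarrow> Vector_Spaces.linear s1 s2 (L j)"
    and U: "vs1.subspace U" "vs1.fin_dimensional U"
    and H: "\<And>x. \<exists>j\<in>J. x j \<noteq> 0 \<Longrightarrow>
      vs1.dim {u\<in>U. (\<Sum>j\<in>J. x j *b L j u) = 0} + card J \<le> vs1.dim U"
  shows "\<exists>u\<in>U. \<forall>x. (\<Sum>j\<in>J. x j *b L j u) = 0 \<longrightarrow> (\<forall>j\<in>J. x j = 0)"
proof -
  define r where "r u = vs2.dim ((\<lambda>j. L j u) ` J)" for u
  have rle: "r u \<le> card J" for u
    unfolding r_def using vs2.dim_le_card[OF vs2.span_superset, of "(\<lambda>j. L j u) ` J"] J card_image_le[OF J]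
    by (meson finite_imageI le_trans)
  have "0 \<in> U" using vs1.subspace_0[OF U(1)] .
  then obtain u where u: "u \<in> U" "\<And>v. v \<in> U \<Longrightarrow> r v \<le> r u"
    using ex_has_greatest_nat[of "\<lambda>u. u \<in> U" 0 r "Suc (card J)"] rle by (metis le_imp_less_Suc)
  let ?S = "vs2.span ((\<lambda>j. L j u) ` J)"
  have "\<forall>j\<in>J. x j = 0" if x: "(\<Sum>j\<in>J. x j *b L j u) = 0" for x
  proof (rule ccontr)
    assume "\<not> (\<forall>j\<in>J. x j = 0)"
    then obtain j0 where j0: "j0 \<in> J" "x j0 \<noteq> 0" by auto
    let ?Lx = "\<lambda>u. \<Sum>j\<in>J. x j *b L j u"
    have lin: "Vector_Spaces.linear s1 s2 ?Lx" using linear_comb[OF L] .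
    have claim: "?Lx v \<in> ?S" if v: "v \<in> U" for v
    proof (rule ccontr)
      assume nv: "?Lx v \<notin> ?S"
      obtain I where I: "I \<subseteq> (\<lambda>j. L j u) ` J" "vs2.independent I" "card I = r u"
        "(\<lambda>j. L j u) ` J \<subseteq> vs2.span I"
        using vs2.basis_exists[of "(\<lambda>j. L j u) ` J"] unfolding r_def by metis
      obtain J' where J': "J' \<subseteq> J" "inj_on (\<lambda>j. L j u) J'" "I = (\<lambda>j. L j u) ` J'"
        using I(1) by (metis subset_image_inj)
      have fJ': "finite J'" using J' J finite_subset by auto
      have cJ': "card J' = r u" using I(3) J' card_image by metis
      obtain h where h: "bij_betw h {..<r u} J'"
        using fJ' cJ' by (metis ex_bij_betw_nat_finite atLeast0LessThan)
      have hJ: "h i \<in> J" if "i < r u" for i using h J' that by (auto simp: bij_betw_def)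
      define a where "a i = (if i < r u then L (h i) u else ?Lx v)" for i
      define c where "c i = (if i < r u then L (h i) v else 0)" for i
      have imI: "a ` {..<r u} = I"
        using h J'(3) by (force simp: a_def bij_betw_def image_image)
      have ia: "inj_on a {..<r u}"
        using h J'(2) by (auto simp: a_def bij_betw_def inj_on_def)
      have nI: "?Lx v \<notin> vs2.span I" using nv vs2.span_mono[OF I(1)] by auto
      have ar: "a (r u) = ?Lx v" by (simp add: a_def)
      have "?Lx v \<notin> I" using nI vs2.span_base by auto
      then have "inj_on a {..<Suc (r u)}"
        using ia imI ar by (simp add: lessThan_Suc)
      moreover have "vs2.independent (a ` {..<Suc (r u)})"
        using imI ar I(2) nI by (simp add: lessThan_Suc vs2.independent_insertI)
      ultimately have "vs2.indep_family {..<Suc (r u)} a"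
        using vs2.indep_family_iff by auto
      then have "finite {t. \<not> vs2.indep_family {..<Suc (r u)} (\<lambda>i. a i + t *b c i)}"
        using vs2.indep_family_perturb by blast
      then have "finite (insert 0 {t. \<not> vs2.indep_family {..<Suc (r u)} (\<lambda>i. a i + t *b c i)})"
        by simp
      then obtain t where "t \<notin> insert 0 {t. \<not> vs2.indep_family {..<Suc (r u)} (\<lambda>i. a i + t *b c i)}"
        using ex_new_if_finite[OF inf] by blast
      then have t: "t \<noteq> 0" "vs2.indep_family {..<Suc (r u)} (\<lambda>i. a i + t *b c i)" by auto
      let ?v = "u + t *a v"
      let ?W = "(\<lambda>j. L j ?v) ` J"
      have vU: "?v \<in> U" using U(1) u(1) v vs1.subspace_add vs1.subspace_scale by blast
      have "?Lx ?v = t *b ?Lx v" using x by (simp add: linear_add[OF lin] linear_scale[OF lin])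
      then have e1: "?Lx v = inverse t *b ?Lx ?v" using t(1) by simp
      have "?Lx ?v \<in> vs2.span ?W"
        by (intro vs2.span_sum vs2.span_scale vs2.span_base) auto
      then have e2: "?Lx v \<in> vs2.span ?W" unfolding e1 by (rule vs2.span_scale)
      have "a i + t *b c i \<in> vs2.span ?W" if i: "i < Suc (r u)" for i
      proof (cases "i < r u")
        case True
        have "L (h i) ?v \<in> vs2.span ?W" using hJ[OF True] by (intro vs2.span_base) auto
        then show ?thesis using True L[OF hJ[OF True]]
          by (simp add: a_def c_def linear_add linear_scale)
      next
        case False
        then show ?thesis using e2 i by (simp add: a_def c_def)
      qed
      then have sub: "(\<lambda>i. a i + t *b c i) ` {..<Suc (r u)} \<subseteq> vs2.span ?W" by auto
      have "vs2.fin_dimensional (vs2.span ?W)" using vs2.fin_dimensional_span J by blast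
      then have "card ((\<lambda>i. a i + t *b c i) ` {..<Suc (r u)}) \<le> vs2.dim (vs2.span ?W)"
        using vs2.independent_card_le[OF _ sub] t(2) vs2.indep_family_iff by blast
      moreover have "card ((\<lambda>i. a i + t *b c i) ` {..<Suc (r u)}) = Suc (r u)"
        using t(2) vs2.indep_family_iff[of "{..<Suc (r u)}"] by (simp add: card_image)
      ultimately have "Suc (r u) \<le> r ?v" by (simp add: r_def)
      then show False using u(2)[OF vU] by simp
    qed
    have "vs2.fin_dimensional ?S" using vs2.fin_dimensional_span J by blast
    then have "vs2.dim (?Lx ` U) \<le> vs2.dim ?S"
      using claim by (intro vs2.fin_dimensional_dim_mono) auto
    also have "vs2.dim ?S \<le> card ((\<lambda>j. L j u) ` (J - {j0}))"
    proof (rule vs2.dim_le_card)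
      let ?R = "vs2.span ((\<lambda>j. L j u) ` (J - {j0}))"
      have "x j0 *b L j0 u = - (\<Sum>j\<in>J - {j0}. x j *b L j u)"
        using x sum.remove[OF J j0(1), of "\<lambda>j. x j *b L j u"] by (simp add: add_eq_0_iff2)
      then have "L j0 u = inverse (x j0) *b (- (\<Sum>j\<in>J - {j0}. x j *b L j u))"
        using j0(2) by (metis vs2.scale_scale left_inverse vs2.scale_one)
      also have "\<dots> \<in> ?R"
        by (intro vs2.span_scale vs2.span_neg vs2.span_sum vs2.span_base) auto
      finally have "L j u \<in> ?R" if "j \<in> J" for j
        using that vs2.span_base by (cases "j = j0") auto
      then show "?S \<subseteq> ?R" by (intro vs2.span_minimal) auto
    qed (use J in simp)
    also have "\<dots> \<le> card (J - {j0})" using J by (intro card_image_le) simp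
    also have "\<dots> < card J" using J j0(1) by (rule card_Diff1_less)
    finally have "vs2.dim (?Lx ` U) < card J" .
    moreover have "vs2.dim (?Lx ` U) + vs1.dim {w\<in>U. ?Lx w = 0} = vs1.dim U"
      using rank_nullity[OF lin U] .
    moreover have "vs1.dim {w\<in>U. ?Lx w = 0} + card J \<le> vs1.dim U" using H j0 by blast
    ultimately show False by simp
  qed
  then show ?thesis using u(1) by blast
qed

text \<open>Only combinations with value outside \<open>T\<close> are wanted, which allows finding a vector independent of a
subspace that is already occupied.\<close>

lemma separating_vector:
  assumes J: "finite J" and L: "\<And>j. j \<in> J \<Longrightarrow> Vector_Spaces.linear s1 s2 (L j)"
    and U: "vs1.subspace U" "vs1.fin_dimensional U" and T: "vs2.subspace T"
    and H: "\<And>x. \<exists>j\<in>J. x j \<noteq> 0 \<Longrightarrow>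
      vs1.dim {u\<in>U. (\<Sum>j\<in>J. x j *b L j u) \<in> T} + card J \<le> vs1.dim U"
  shows "\<exists>u\<in>U. \<forall>x. (\<Sum>j\<in>J. x j *b L j u) \<in> T \<longrightarrow> (\<forall>j\<in>J. x j = 0)"
proof (cases "finite (UNIV :: 'k set)")
  case True
  then show ?thesis using separating_vector_finite_field[OF _ J L U T H] by blast
next
  case False
  interpret p22: linear_space_pair s2 s2 ..
  obtain p where p: "Vector_Spaces.linear s2 s2 p" "\<And>v. p v = 0 \<longleftrightarrow> v \<in> T"
    using vs2.subspace_is_kernel[OF T] by blast
  have eq: "(\<Sum>j\<in>J. x j *b (p \<circ> L j) u) = 0 \<longleftrightarrow> (\<Sum>j\<in>J. x j *b L j u) \<in> T" for x u
    unfolding p(2)[symmetric]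
    by (simp add: p22.linear_sum[OF p(1)] p22.linear_scale[OF p(1)])
  have "\<exists>u\<in>U. \<forall>x. (\<Sum>j\<in>J. x j *b (p \<circ> L j) u) = 0 \<longrightarrow> (\<forall>j\<in>J. x j = 0)"
    by (rule separating_vector_infinite_field[OF False J _ U])
      (use H L p(1) in \<open>auto simp del: o_apply simp: eq intro: Vector_Spaces.linear_compose\<close>)
  then show ?thesis by (simp del: o_apply add: eq)
qed

end

section \<open>Matrices acting on finitely supported sequences\<close>

definition fscale :: "'k::field \<Rightarrow> (nat \<Rightarrow> 'k) \<Rightarrow> nat \<Rightarrow> 'k" where
  "fscale c f = (\<lambda>i. c * f i)"

interpretation fs: linear_space "fscale :: 'k::field \<Rightarrow> _"
  by unfold_locales (auto simp: fscale_def algebra_simps fun_eq_iff)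

interpretation ff: linear_space_pair "fscale :: 'k::field \<Rightarrow> _" "fscale :: 'k \<Rightarrow> _" ..

abbreviation flinear :: "((nat \<Rightarrow> 'k::field) \<Rightarrow> nat \<Rightarrow> 'k) \<Rightarrow> bool" where
  "flinear \<equiv> Vector_Spaces.linear fscale fscale"

text \<open>This is \<open>K\<^sup>n\<close>, as a subspace of the space of all sequences.\<close>

definition coord_space :: "nat \<Rightarrow> (nat \<Rightarrow> 'k::field) set" where
  "coord_space n = {f. \<forall>i\<ge>n. f i = 0}"

definition unit_fun :: "nat \<Rightarrow> nat \<Rightarrow> 'k::field" where
  "unit_fun j = (\<lambda>i. if i = j then 1 else 0)"

definition mat_act :: "'k::field mat \<Rightarrow> (nat \<Rightarrow> 'k) \<Rightarrow> nat \<Rightarrow> 'k" where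
  "mat_act X f = (\<lambda>i. if i < dim_row X then \<Sum>j<dim_col X. X $$ (i, j) * f j else 0)"

text \<open>Identifies vectors of length \<open>n\<close> with \<open>coord_space n\<close>, extending them by zero.\<close>

definition fun_of_vec :: "'k::field vec \<Rightarrow> nat \<Rightarrow> 'k" where
  "fun_of_vec v = (\<lambda>i. if i < dim_vec v then v $ i else 0)"

lemma fun_of_vec_coord_space: "v \<in> carrier_vec n \<Longrightarrow> fun_of_vec v \<in> coord_space n"
  by (auto simp: fun_of_vec_def coord_space_def)

lemma vec_fun_of_vec: "v \<in> carrier_vec n \<Longrightarrow> vec n (fun_of_vec v) = v"
  by (auto simp: fun_of_vec_def)

lemma fun_of_vec_vec: "f \<in> coord_space n \<Longrightarrow> fun_of_vec (vec n f) = f"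
  by (auto simp: fun_of_vec_def coord_space_def fun_eq_iff)

lemma inj_on_fun_of_vec: "inj_on fun_of_vec (carrier_vec n)"
  by (rule inj_on_inverseI[of _ "vec n"]) (rule vec_fun_of_vec)

lemma fun_of_vec_image_carrier: "fun_of_vec ` carrier_vec n = (coord_space n :: (nat \<Rightarrow> 'k::field) set)"
proof (rule subset_antisym)
  show "(coord_space n :: (nat \<Rightarrow> 'k) set) \<subseteq> fun_of_vec ` carrier_vec n"
  proof (rule subsetI)
    fix f :: "nat \<Rightarrow> 'k" assume "f \<in> coord_space n"
    then show "f \<in> fun_of_vec ` carrier_vec n"
      by (intro image_eqI[of _ _ "vec n f"]) (simp_all add: fun_of_vec_vec)
  qed
qed (auto simp: fun_of_vec_coord_space)

lemma subspace_coord_space: "fs.subspace (coord_space n)"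
  by (auto simp: fs.subspace_def coord_space_def fscale_def)

lemma flinearI:
  "(\<And>f g. h (f + g) = h f + h g) \<Longrightarrow> (\<And>c f. h (fscale c f) = fscale c (h f)) \<Longrightarrow> flinear h"
  by (simp add: Vector_Spaces.linear_iff fs.vector_space_axioms)

lemma linear_mat_act: "flinear (mat_act X)"
  by (rule flinearI) (auto simp: mat_act_def fscale_def fun_eq_iff algebra_simps sum.distrib sum_distrib_left)

lemma sum_fun_apply: "(\<Sum>i\<in>I. F i) x = (\<Sum>i\<in>I. F i x)" for F :: "'i \<Rightarrow> 'a \<Rightarrow> 'b::ab_group_add"
  by (induction I rule: infinite_finite_induct) auto

lemma coord_space_expand: "f \<in> coord_space n \<Longrightarrow> f = (\<Sum>j<n. fscale (f j) (unit_fun j))"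
proof
  fix i assume f: "f \<in> coord_space n"
  have "(\<Sum>j<n. fscale (f j) (unit_fun j)) i = (\<Sum>j<n. if j = i then f j else 0)"
    unfolding sum_fun_apply by (rule sum.cong) (auto simp: fscale_def unit_fun_def)
  also have "\<dots> = f i" using f by (simp add: coord_space_def)
  finally show "f i = (\<Sum>j<n. fscale (f j) (unit_fun j)) i" by simp
qed

lemma unit_fun_coord_space: "j < n \<Longrightarrow> unit_fun j \<in> coord_space n"
  by (auto simp: unit_fun_def coord_space_def)

lemma indep_family_unit_fun: "fs.indep_family {..<n} (unit_fun :: nat \<Rightarrow> nat \<Rightarrow> 'k::field)"
  unfolding fs.indep_family_def
proof (intro allI impI ballI)
  fix y :: "nat \<Rightarrow> 'k" and i assume s: "(\<Sum>j<n. fscale (y j) (unit_fun j)) = 0" and i: "i \<in> {..<n}"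
  have "0 = (\<Sum>j<n. fscale (y j) (unit_fun j)) i" using s by simp
  also have "\<dots> = (\<Sum>j<n. if j = i then y j else 0)"
    unfolding sum_fun_apply by (rule sum.cong) (auto simp: fscale_def unit_fun_def)
  finally show "y i = 0" using i by simp
qed

lemma span_unit_funs: "fs.span (unit_fun ` {..<n}) = (coord_space n :: (nat \<Rightarrow> 'k::field) set)"
proof (rule subset_antisym)
  show "fs.span (unit_fun ` {..<n}) \<subseteq> (coord_space n :: (nat \<Rightarrow> 'k) set)"
    by (intro fs.span_minimal subspace_coord_space) (auto simp: unit_fun_coord_space)
  show "(coord_space n :: (nat \<Rightarrow> 'k) set) \<subseteq> fs.span (unit_fun ` {..<n})"
  proof (rule subsetI)
    fix f :: "nat \<Rightarrow> 'k" assume "f \<in> coord_space n"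
    then show "f \<in> fs.span (unit_fun ` {..<n})"
      by (subst coord_space_expand, assumption) (intro fs.span_sum fs.span_scale fs.span_base imageI)
  qed
qed

lemma fin_dimensional_coord_space: "fs.fin_dimensional (coord_space n)"
  unfolding span_unit_funs[symmetric] by (intro fs.fin_dimensional_span) simp

lemma dim_coord_space: "fs.dim (coord_space n :: (nat \<Rightarrow> 'k::field) set) = n"
proof -
  have "inj_on (unit_fun :: nat \<Rightarrow> nat \<Rightarrow> 'k) {..<n} \<and> fs.independent (unit_fun ` {..<n} :: (nat \<Rightarrow> 'k) set)"
    using indep_family_unit_fun fs.indep_family_iff by blast
  then have "fs.dim (fs.span (unit_fun ` {..<n} :: (nat \<Rightarrow> 'k) set)) = n"
    using fs.dim_span_eq_card_independent card_image[of "unit_fun :: nat \<Rightarrow> nat \<Rightarrow> 'k" "{..<n}"]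
    by (metis card_lessThan)
  then show ?thesis by (simp add: span_unit_funs)
qed

lemma mult_if_delta: "(a :: 'k::field) * (if P then 1 else 0) = (if P then a else 0)"
  by simp

lemma mat_act_coord_space: "X \<in> carrier_mat n m \<Longrightarrow> mat_act X f \<in> coord_space n"
  by (auto simp: mat_act_def coord_space_def)

lemma fun_of_vec_mult_mat_vec:
  "X \<in> carrier_mat n m \<Longrightarrow> v \<in> carrier_vec m \<Longrightarrow> fun_of_vec (X *\<^sub>v v) = mat_act X (fun_of_vec v)"
  by (auto simp: fun_of_vec_def mat_act_def fun_eq_iff scalar_prod_def atLeast0LessThan intro!: sum.cong)

lemma mat_act_add: "X \<in> carrier_mat n n \<Longrightarrow> Y \<in> carrier_mat n n \<Longrightarrow>
    mat_act (X + Y) f = mat_act X f + mat_act Y f"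
  by (auto simp: mat_act_def fun_eq_iff algebra_simps sum.distrib)

lemma mat_act_minus: "X \<in> carrier_mat n n \<Longrightarrow> Y \<in> carrier_mat n n \<Longrightarrow>
    mat_act (X - Y) f = mat_act X f - mat_act Y f"
  by (auto simp: mat_act_def fun_eq_iff algebra_simps sum_subtractf)

lemma mat_act_smult: "mat_act (c \<cdot>\<^sub>m X) f = fscale c (mat_act X f)"
  by (auto simp: mat_act_def fun_eq_iff fscale_def algebra_simps sum_distrib_left)

lemma mat_act_mult: 
  assumes "X \<in> carrier_mat n n" "Y \<in> carrier_mat n n"
  shows "mat_act (X * Y) f = mat_act X (mat_act Y f)"
proof
  fix i
  have "(\<Sum>j<n. (\<Sum>k<n. X $$ (i, k) * Y $$ (k, j)) * f j) = (\<Sum>k<n. X $$ (i, k) * (\<Sum>j<n. Y $$ (k, j) * f j))"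
    by (simp add: sum_distrib_left sum_distrib_right mult.assoc) (rule sum.swap)
  then show "mat_act (X * Y) f i = mat_act X (mat_act Y f) i"
    using assms by (auto simp: mat_act_def scalar_prod_def atLeast0LessThan)
qed

definition mat_of_linear :: "nat \<Rightarrow> ((nat \<Rightarrow> 'k::field) \<Rightarrow> nat \<Rightarrow> 'k) \<Rightarrow> 'k mat" where
  "mat_of_linear n h = mat n n (\<lambda>(i, j). h (unit_fun j) i)"

lemma mat_of_linear_carrier: "mat_of_linear n h \<in> carrier_mat n n"
  by (simp add: mat_of_linear_def)

lemma mat_act_mat_of_linear:
  assumes h: "flinear h" and "h ` coord_space n \<subseteq> coord_space n" and f: "f \<in> coord_space n"
  shows "mat_act (mat_of_linear n h) f = h f"
proof
  fix i
  have "h f = (\<Sum>j<n. fscale (f j) (h (unit_fun j)))"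
    by (subst coord_space_expand[OF f]) (simp add: ff.linear_sum[OF h] ff.linear_scale[OF h])
  then have "h f i = (\<Sum>j<n. h (unit_fun j) i * f j)"
    by (simp add: sum_fun_apply fscale_def mult.commute)
  moreover have "h f i = 0" if "i \<ge> n" using assms that by (auto simp: coord_space_def)
  ultimately show "mat_act (mat_of_linear n h) f i = h f i"
    by (auto simp: mat_act_def mat_of_linear_def)
qed

lemma mat_eq_if_mat_act_eq:
  assumes "X \<in> carrier_mat n n" "Y \<in> carrier_mat n n"
    and "\<And>f. f \<in> coord_space n \<Longrightarrow> mat_act X f = mat_act Y f"
  shows "X = Y"
proof (rule eq_matI)
  fix i j assume ij: "i < dim_row Y" "j < dim_col Y"
  then have "j < n" "i < n" using assms by auto
  have e: "mat_act Z (unit_fun j) i = Z $$ (i, j)" if "Z \<in> carrier_mat n n" for Z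
  proof -
    have "mat_act Z (unit_fun j) i = (\<Sum>k<n. if k = j then Z $$ (i, k) else 0)"
      using that \<open>i < n\<close> by (simp add: mat_act_def unit_fun_def mult_if_delta)
    then show ?thesis using \<open>j < n\<close> by simp
  qed
  show "X $$ (i, j) = Y $$ (i, j)"
    using assms(3)[OF unit_fun_coord_space[OF \<open>j < n\<close>]] e assms(1,2) by metis
qed (use assms in auto)

text \<open>Transfers subspaces of \<open>K\<^sup>n\<close> and their dimension from the setting of carrier sets and modules to
the space of sequences: a basis of the image is pulled back to a basis of \<open>U\<close>.\<close>

lemma subspace_fun_of_vec:
  assumes U: "VectorSpace.subspace (class_ring :: 'k::field ring) U (module_vec TYPE('k) n)"
  shows "U \<subseteq> carrier_vec n" "fs.subspace (fun_of_vec ` U)" "fun_of_vec ` U \<subseteq> coord_space n"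
    and "vec_subspace_dim n U = fs.dim (fun_of_vec ` U)"
proof -
  interpret vec_space "TYPE('k)" n .
  have sm: "submodule class_ring U V" using U by (simp add: VectorSpace.subspace_def)
  show Uc: "U \<subseteq> carrier_vec n" using sm by (auto simp: submodule_def)
  show sub: "fun_of_vec ` U \<subseteq> coord_space n" using Uc fun_of_vec_coord_space by auto
  have add: "fun_of_vec (v + w) = fun_of_vec v + fun_of_vec w"
    if "v \<in> carrier_vec n" "w \<in> carrier_vec n" for v w :: "'k vec"
    using that by (auto simp: fun_of_vec_def fun_eq_iff)
  have sc: "fun_of_vec (c \<cdot>\<^sub>v v) = fscale c (fun_of_vec v)" for c and v :: "'k vec"
    by (auto simp: fun_of_vec_def fun_eq_iff fscale_def)
  have U1: "0\<^sub>v n \<in> U" and U2: "\<And>v w. v \<in> U \<Longrightarrow> w \<in> U \<Longrightarrow> v + w \<in> U"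
    and U3: "\<And>c v. v \<in> U \<Longrightarrow> c \<cdot>\<^sub>v v \<in> U"
    using sm by (auto simp: submodule_def)
  have "fun_of_vec (0\<^sub>v n :: 'k vec) = 0" by (auto simp: fun_of_vec_def fun_eq_iff)
  then show fsub: "fs.subspace (fun_of_vec ` U)"
    unfolding fs.subspace_def
  proof (intro conjI ballI allI)
    fix x y assume "x \<in> fun_of_vec ` U" "y \<in> fun_of_vec ` U"
    then obtain v w where "x = fun_of_vec v" "y = fun_of_vec w" "v \<in> U" "w \<in> U" by auto
    then show "x + y \<in> fun_of_vec ` U"
      using add[of v w] Uc U2[of v w] by (metis image_eqI subsetD)
  next
    fix c x assume "x \<in> fun_of_vec ` U"
    then show "fscale c x \<in> fun_of_vec ` U" using U3 by (auto simp flip: sc)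
  qed (use U1 \<open>fun_of_vec (0\<^sub>v n) = 0\<close> in \<open>metis image_eqI\<close>)
  obtain B0 where B0: "finite B0" "fs.independent B0" "fs.span B0 = fun_of_vec ` U" "card B0 = fs.dim (fun_of_vec ` U)"
    using fs.subspace_basis[OF fs.fin_dimensional_subset[OF fin_dimensional_coord_space sub] fsub] by blast
  define B where "B = vec n ` B0"
  have B0c: "B0 \<subseteq> coord_space n" "B0 \<subseteq> fun_of_vec ` U" using B0(3) fs.span_superset[of B0] sub by auto
  have injB: "inj_on (vec n) B0" 
    by (rule inj_on_inverseI[of _ fun_of_vec]) (use B0c(1) fun_of_vec_vec in blast)
  have BU: "B \<subseteq> U" 
  proof
    fix v assume "v \<in> B"
    then obtain w where "w \<in> U" "v = vec n (fun_of_vec w)" unfolding B_def using B0c(2) by blast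
    then show "v \<in> U" using vec_fun_of_vec[of w n] Uc by auto
  qed
  have Bc: "B \<subseteq> carrier_vec n" using BU Uc by auto
  have fB: "finite B" using B0(1) B_def by simp
  have lc: "fun_of_vec (lincomb a B) = (\<Sum>b\<in>B0. fscale (a (vec n b)) b)" for a
  proof
    fix i
    have "fun_of_vec (lincomb a B) i = (if i < n then (\<Sum>x\<in>B. a x * x $ i) else 0)"
      using lincomb_dim[OF fB Bc, of a] lincomb_index[OF _ Bc, of i a] by (simp add: fun_of_vec_def)
    also have "\<dots> = (\<Sum>b\<in>B0. a (vec n b) * b i)"
      unfolding B_def using B0c by (subst sum.reindex[OF injB]) (auto simp: coord_space_def intro!: sum.neutral)
    finally show "fun_of_vec (lincomb a B) i = (\<Sum>b\<in>B0. fscale (a (vec n b)) b) i"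
      by (simp add: sum_fun_apply fscale_def)
  qed
  have li: "lin_indpt B"
  proof (rule finite_lin_indpt2[OF fB])
    show "B \<subseteq> carrier_vec n" using Bc .
    fix a assume "lincomb a B = 0\<^sub>v n"
    then have "(\<Sum>b\<in>B0. fscale (a (vec n b)) b) = 0"
      unfolding lc[symmetric] by (auto simp: fun_of_vec_def fun_eq_iff)
    then have "\<forall>b\<in>B0. a (vec n b) = 0" using fs.independentD[OF B0(2,1) order_refl, of "\<lambda>b. a (vec n b)"] by blast
    then show "\<forall>v\<in>B. a v = 0" by (auto simp: B_def)
  qed
  have sp: "span B = U"
  proof (rule subset_antisym)
    show "span B \<subseteq> U" using span_is_subset[OF BU sm] .
    show "U \<subseteq> span B"
    proof (rule subsetI)
      fix v assume v: "v \<in> U"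
      then have "fun_of_vec v \<in> fs.span B0" using B0(3) by simp
      then obtain c where "fun_of_vec v = (\<Sum>b\<in>B0. fscale (c b) b)"
        unfolding fs.span_finite[OF B0(1)] by blast
      also have "\<dots> = fun_of_vec (lincomb (\<lambda>x. c (fun_of_vec x)) B)"
        unfolding lc
      proof (rule sum.cong[OF refl])
        fix b assume "b \<in> B0"
        then have "fun_of_vec (vec n b) = b" using B0c(1) fun_of_vec_vec by blast
        then show "fscale (c b) b = fscale (c (fun_of_vec (vec n b))) b" by simp
      qed
      finally have "v = lincomb (\<lambda>x. c (fun_of_vec x)) B"
        using inj_onD[OF inj_on_fun_of_vec, of v _ n] v Uc carrier_vecI[OF lincomb_dim[OF fB Bc]] by blast
      then show "v \<in> span B" using fB Bc by (auto simp: finite_span)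
    qed
  qed
  have vsU: "vectorspace class_ring (vs U)" using subspace_is_vs[OF U] .
  have "vectorspace.basis class_ring (vs U) B"
    using BU li sp span_li_not_depend[OF BU sm]
    unfolding vectorspace.basis_def[OF vsU] by auto
  then have "vectorspace.dim class_ring (vs U) = card B"
    using vectorspace.dim_basis[OF vsU fB] by blast
  also have "card B = card B0" unfolding B_def using card_image[OF injB] .
  finally show "vec_subspace_dim n U = fs.dim (fun_of_vec ` U)"
    unfolding vec_subspace_dim_def B0(4) .
qed

lemma rank_eq_dim_image:
  assumes X: "(X :: 'k::field mat) \<in> carrier_mat n n"
  shows "vec_space.rank n X = fs.dim (mat_act X ` coord_space n)"
proof -
  interpret vec_space "TYPE('k)" n .
  have sub: "VectorSpace.subspace class_ring (span (set (cols X))) V"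
    using span_is_subspace X cols_dim[of X] by auto
  have sp: "span (set (cols X)) = (\<lambda>v. X *\<^sub>v v) ` carrier_vec n"
    using col_space_eq[OF X] X unfolding col_space_def by auto
  have "rank X = vec_subspace_dim n (span (set (cols X)))"
    unfolding rank_def vec_subspace_dim_def ..
  also have "\<dots> = fs.dim (fun_of_vec ` span (set (cols X)))"
    by (rule subspace_fun_of_vec(4)[OF sub])
  also have "fun_of_vec ` span (set (cols X)) = mat_act X ` coord_space n"
    unfolding sp image_image fun_of_vec_image_carrier[symmetric]
    using fun_of_vec_mult_mat_vec[OF X] by auto
  finally show ?thesis .
qed

definition null_space :: "nat \<Rightarrow> 'k::field mat \<Rightarrow> (nat \<Rightarrow> 'k) set" where
  "null_space n X = {f \<in> coord_space n. mat_act X f = 0}"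

text \<open>All later statements about ranks are phrased through the dimension of the null space.\<close>

lemma rank_add_dim_kernel:
  assumes X: "(X :: 'k::field mat) \<in> carrier_mat n n"
  shows "vec_space.rank n X + fs.dim (null_space n X) = n"
  using ff.rank_nullity[OF linear_mat_act subspace_coord_space fin_dimensional_coord_space, of X n]
  unfolding rank_eq_dim_image[OF X] null_space_def dim_coord_space .

section \<open>Tilings and induced representations\<close>

sublocale K_algebra \<subseteq> linear_space scale ..

sublocale K_algebra \<subseteq> af: linear_space_pair scale "fscale :: 'k::field \<Rightarrow> _" ..

context K_algebra
begin

lemma linear_to_matD:
  assumes "linear_to_mat n \<phi>"
  shows "\<phi> x \<in> carrier_mat n n" "\<phi> (x + y) = \<phi> x + \<phi> y" "\<phi> (scale c x) = c \<cdot>\<^sub>m \<phi> x"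
  using assms by (auto simp: linear_to_mat_def)

lemma linear_act:
  assumes "linear_to_mat n \<phi>"
  shows "Vector_Spaces.linear scale fscale (\<lambda>a. mat_act (\<phi> a) f)"
  unfolding Vector_Spaces.linear_iff
  by (intro conjI allI vector_space_axioms fs.vector_space_axioms)
    (simp_all add: linear_to_matD[OF assms] mat_act_add[OF linear_to_matD(1)[OF assms] linear_to_matD(1)[OF assms]] mat_act_smult)

lemma dim_preimage_le:
  assumes U: "fs.subspace U" "U \<subseteq> coord_space n" and T: "fs.subspace T" "fs.fin_dimensional T"
  shows "fs.dim {u\<in>U. mat_act X u \<in> T} \<le> fs.dim T + fs.dim (null_space n X)"
proof -
  let ?P = "{u\<in>U. mat_act X u \<in> T}"
  have fd: "fs.fin_dimensional U" using fs.fin_dimensional_subset[OF fin_dimensional_coord_space U(2)] .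
  have s: "fs.subspace ?P" using ff.subspace_kernel_in[OF linear_mat_act U(1) T(1)] .
  have fP: "fs.fin_dimensional ?P" using fs.fin_dimensional_subset[OF fd] by simp
  have "fs.dim (mat_act X ` ?P) + fs.dim {w\<in>?P. mat_act X w = 0} = fs.dim ?P"
    using ff.rank_nullity[OF linear_mat_act s fP] .
  moreover have "fs.dim (mat_act X ` ?P) \<le> fs.dim T"
    by (rule fs.fin_dimensional_dim_mono[OF T(2)]) auto
  moreover have "fs.fin_dimensional (null_space n X)"
    by (rule fs.fin_dimensional_subset[OF fin_dimensional_coord_space[of n]]) (auto simp: null_space_def)
  then have "fs.dim {w\<in>?P. mat_act X w = 0} \<le> fs.dim (null_space n X)"
    by (rule fs.fin_dimensional_dim_mono) (use U in \<open>auto simp: null_space_def\<close>)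
  ultimately show ?thesis by simp
qed

text \<open>The maps \<open>w \<mapsto> \<phi> w u_i\<close> are injective on \<open>W\<close> and their images are independent. Quantifying over families of
elements of \<open>W\<close> avoids the choice of a basis, so that the property passes to subspaces of \<open>W\<close>.\<close>

definition tiles :: "'a set \<Rightarrow> ('a \<Rightarrow> 'k mat) \<Rightarrow> nat \<Rightarrow> (nat \<Rightarrow> nat \<Rightarrow> 'k) \<Rightarrow> bool" where
  "tiles W \<phi> q u \<longleftrightarrow>
     (\<forall>g. (\<forall>i<q. g i \<in> W) \<longrightarrow> (\<Sum>i<q. mat_act (\<phi> (g i)) (u i)) = 0 \<longrightarrow> (\<forall>i<q. g i = 0))"

lemma tiles_indep_family:
  assumes \<phi>: "linear_to_mat n \<phi>" and t: "tiles W \<phi> q u" and W: "subspace W"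
    and B: "finite B" "independent B" "B \<subseteq> W"
  shows "fs.indep_family ({..<q} \<times> B) (\<lambda>(i, b). mat_act (\<phi> b) (u i))"
  unfolding fs.indep_family_def
proof (intro allI impI ballI)
  fix y :: "nat \<times> 'a \<Rightarrow> 'k" and p
  assume y: "(\<Sum>j\<in>{..<q} \<times> B. fscale (y j) ((\<lambda>(i, b). mat_act (\<phi> b) (u i)) j)) = 0"
    and p: "p \<in> {..<q} \<times> B"
  define g where "g i = (\<Sum>b\<in>B. scale (y (i, b)) b)" for i
  have gW: "g i \<in> W" for i
    unfolding g_def using B(3) W by (intro subspace_sum subspace_scale) auto
  have "mat_act (\<phi> (g i)) (u i) = (\<Sum>b\<in>B. fscale (y (i, b)) (mat_act (\<phi> b) (u i)))" for i
    unfolding g_def by (simp add: af.linear_sum[OF linear_act[OF \<phi>]] af.linear_scale[OF linear_act[OF \<phi>]])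
  then have "(\<Sum>i<q. mat_act (\<phi> (g i)) (u i)) = 0"
    using y by (simp add: sum.cartesian_product case_prod_unfold)
  then have "\<forall>i<q. g i = 0" using t gW unfolding tiles_def by simp
  then have "(\<Sum>b\<in>B. scale (y (fst p, b)) b) = 0" using p by (auto simp: g_def)
  then show "y p = 0"
    using independentD[OF B(2,1) order_refl, of "\<lambda>b. y (fst p, b)" "snd p"] p by auto
qed

text \<open>The tiles are chosen one after the other. The new vector has to separate \<open>W\<close> modulo the span \<open>T\<close> of the
tiles present so far. A nonzero \<open>a \<in> W\<close> maps at most \<open>dim T + c\<close> dimensions of \<open>U\<close> into \<open>T\<close>, so a separating
vector exists as long as another \<open>dim W\<close> dimensions fit.\<close>

lemma tiles_exist:
  assumes \<phi>: "linear_to_mat n \<phi>" and W: "subspace W" "fin_dimensional W"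
    and U: "fs.subspace U" "U \<subseteq> coord_space n"
    and ker: "\<And>a. a \<in> W \<Longrightarrow> a \<noteq> 0 \<Longrightarrow> fs.dim (null_space n (\<phi> a)) \<le> c"
    and q: "q * dim W + c \<le> fs.dim U"
  shows "\<exists>u. (\<forall>i<q. u i \<in> U) \<and> tiles W \<phi> q u"
  using q
proof (induction q)
  case 0
  then show ?case by (simp add: tiles_def)
next
  case (Suc q)
  then obtain u where u: "\<And>i. i < q \<Longrightarrow> u i \<in> U" "tiles W \<phi> q u" by auto
  obtain B where B: "finite B" "independent B" "span B = W" "card B = dim W"
    using subspace_basis[OF W(2,1)] by blast
  let ?I = "(\<lambda>(i, b). mat_act (\<phi> b) (u i)) ` ({..<q} \<times> B)"
  define T where "T = fs.span ?I"
  have fI: "finite ?I" using B(1) by simp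
  have T: "fs.subspace T" "fs.fin_dimensional T"
    unfolding T_def using fI by (auto intro: fs.fin_dimensional_span)
  have "fs.dim T \<le> card ?I" unfolding T_def using fs.dim_le_card[OF order_refl fI] by simp
  also have "\<dots> \<le> q * dim W" using card_image_le[of "{..<q} \<times> B"] B by (simp add: card_cartesian_product)
  finally have dT: "fs.dim T \<le> q * dim W" .
  have lin: "mat_act (\<phi> (\<Sum>b\<in>B. scale (x b) b)) f = (\<Sum>b\<in>B. fscale (x b) (mat_act (\<phi> b) f))" for x f
    by (simp add: af.linear_sum[OF linear_act[OF \<phi>]] af.linear_scale[OF linear_act[OF \<phi>]])
  have "\<exists>v\<in>U. \<forall>x. (\<Sum>b\<in>B. fscale (x b) (mat_act (\<phi> b) v)) \<in> T \<longrightarrow> (\<forall>b\<in>B. x b = 0)"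
  proof (rule ff.separating_vector[OF B(1) linear_mat_act U(1)
        fs.fin_dimensional_subset[OF fin_dimensional_coord_space U(2)] T(1)])
    fix x :: "'a \<Rightarrow> 'k" assume x: "\<exists>b\<in>B. x b \<noteq> 0"
    let ?a = "\<Sum>b\<in>B. scale (x b) b"
    have "?a \<in> span B" by (simp add: span_sum span_scale span_base)
    then have "?a \<in> W" using B(3) by simp
    moreover have "?a \<noteq> 0"
    proof
      assume "?a = 0"
      then have "x b = 0" if "b \<in> B" for b
        by (rule independentD[OF B(2,1) order_refl _ that])
      then show False using x by simp
    qed
    ultimately have "fs.dim (null_space n (\<phi> ?a)) \<le> c" by (rule ker)
    then show "fs.dim {v\<in>U. (\<Sum>b\<in>B. fscale (x b) (mat_act (\<phi> b) v)) \<in> T} + card B \<le> fs.dim U"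
      using dim_preimage_le[OF U T, of "\<phi> ?a"] dT Suc.prems B(4) by (simp add: lin)
  qed
  then obtain v where v: "v \<in> U" "\<forall>x. (\<Sum>b\<in>B. fscale (x b) (mat_act (\<phi> b) v)) \<in> T \<longrightarrow> (\<forall>b\<in>B. x b = 0)"
    by (rule bexE)
  define u' where "u' = u(q := v)"
  have "tiles W \<phi> (Suc q) u'"
    unfolding tiles_def
  proof (rule allI, rule impI, rule impI)
    fix g assume g: "\<forall>i<Suc q. g i \<in> W" and s: "(\<Sum>i<Suc q. mat_act (\<phi> (g i)) (u' i)) = 0"
    have ex: "\<exists>x. a = (\<Sum>b\<in>B. scale (x b) b)" if "a \<in> W" for a
      using that B(3) span_finite[OF B(1)] by auto
    then obtain x where x: "g q = (\<Sum>b\<in>B. scale (x b) b)" using g by auto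
    have "mat_act (\<phi> a) (u i) \<in> T" if "i < q" "a \<in> W" for i a
    proof -
      obtain y where y: "a = (\<Sum>b\<in>B. scale (y b) b)" using ex[OF \<open>a \<in> W\<close>] by auto
      show ?thesis unfolding y lin T_def using \<open>i < q\<close>
        by (intro fs.span_sum fs.span_scale fs.span_base) auto
    qed
    then have "(\<Sum>i<q. mat_act (\<phi> (g i)) (u i)) \<in> T" using g T(1) by (intro fs.subspace_sum) auto
    moreover have s': "(\<Sum>i<q. mat_act (\<phi> (g i)) (u i)) + mat_act (\<phi> (g q)) v = 0"
      using s by (simp add: u'_def)
    then have "mat_act (\<phi> (g q)) v = - (\<Sum>i<q. mat_act (\<phi> (g i)) (u i))" by (simp add: add_eq_0_iff)
    ultimately have "mat_act (\<phi> (g q)) v \<in> T" using fs.subspace_neg[OF T(1)] by simp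
    then have "(\<Sum>b\<in>B. fscale (x b) (mat_act (\<phi> b) v)) \<in> T" unfolding x lin .
    then have "\<forall>b\<in>B. x b = 0" by (rule v(2)[THEN spec, THEN mp])
    then have gq: "g q = 0" unfolding x by (simp add: sum.neutral)
    have "mat_act (\<phi> (g q)) v = 0" using gq af.linear_0[OF linear_act[OF \<phi>]] by metis
    then have "(\<Sum>i<q. mat_act (\<phi> (g i)) (u i)) = 0" using s' by simp
    then have "\<forall>i<q. g i = 0" using u(2) g unfolding tiles_def by simp
    then show "\<forall>i<Suc q. g i = 0" using gq by (simp add: less_Suc_eq)
  qed
  moreover have "\<forall>i<Suc q. u' i \<in> U" using u(1) v(1) by (simp add: u'_def less_Suc_eq)
  ultimately show ?case by blast
qed

lemma matrix_representationD:
  assumes "matrix_representation n \<psi>"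
  shows "linear_to_mat n \<psi>" "\<psi> (x * y) = \<psi> x * \<psi> y"
    "mat_act (\<psi> (x * y)) f = mat_act (\<psi> x) (mat_act (\<psi> y) f)"
proof -
  show l: "linear_to_mat n \<psi>" and m: "\<psi> (x * y) = \<psi> x * \<psi> y"
    using assms by (auto simp: matrix_representation_def)
  show "mat_act (\<psi> (x * y)) f = mat_act (\<psi> x) (mat_act (\<psi> y) f)"
    unfolding m using mat_act_mult linear_to_matD(1)[OF l] by blast
qed

text \<open>Copies of \<open>K\<^sup>m\<close> inside \<open>K\<^sup>n\<close>, given by injections \<open>\<theta> t\<close> with retractions \<open>\<pi> t\<close> that vanish on the other copies,
carry a representation of size \<open>m\<close> to size \<open>n\<close>; the complement of the copies is annihilated. Direct sums and
conjugation by an injection are both of this form.\<close>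

lemma induced_representation:
  fixes \<theta> \<pi> :: "'i \<Rightarrow> (nat \<Rightarrow> 'k) \<Rightarrow> nat \<Rightarrow> 'k"
  assumes \<psi>: "matrix_representation m \<psi>" and I: "finite I"
    and lin: "\<And>t. t \<in> I \<Longrightarrow> flinear (\<theta> t)" "\<And>t. t \<in> I \<Longrightarrow> flinear (\<pi> t)"
    and \<theta>: "\<And>t f. t \<in> I \<Longrightarrow> f \<in> coord_space m \<Longrightarrow> \<theta> t f \<in> coord_space n"
    and \<pi>: "\<And>s t f. s \<in> I \<Longrightarrow> t \<in> I \<Longrightarrow> f \<in> coord_space m \<Longrightarrow> \<pi> s (\<theta> t f) = (if s = t then f else 0)"
  defines "\<rho> \<equiv> \<lambda>a. mat_of_linear n (\<lambda>f. \<Sum>t\<in>I. \<theta> t (mat_act (\<psi> a) (\<pi> t f)))"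
  shows "matrix_representation n \<rho>"
    and "\<And>a f. f \<in> coord_space n \<Longrightarrow> mat_act (\<rho> a) f = (\<Sum>t\<in>I. \<theta> t (mat_act (\<psi> a) (\<pi> t f)))"
proof -
  note l = matrix_representationD(1)[OF \<psi>]
  note \<psi>c = linear_to_matD(1)[OF l]
  note \<psi>co = mat_act_coord_space[OF \<psi>c]
  have flin: "flinear (\<lambda>f. \<Sum>t\<in>I. \<theta> t (mat_act (\<psi> a) (\<pi> t f)))" for a
    by (intro flinearI) (simp_all add: ff.linear_add[OF lin(1)] ff.linear_add[OF lin(2)]
        ff.linear_add[OF linear_mat_act] ff.linear_scale[OF lin(1)] ff.linear_scale[OF lin(2)]
        ff.linear_scale[OF linear_mat_act] sum.distrib fs.scale_sum_right)
  have co: "(\<Sum>t\<in>I. \<theta> t (mat_act (\<psi> a) (\<pi> t f))) \<in> coord_space n" for a f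
    using \<theta> \<psi>co by (intro fs.subspace_sum subspace_coord_space) auto
  show act: "mat_act (\<rho> a) f = (\<Sum>t\<in>I. \<theta> t (mat_act (\<psi> a) (\<pi> t f)))" if "f \<in> coord_space n" for a f
    unfolding \<rho>_def using mat_act_mat_of_linear[OF flin _ that] co by blast
  have \<rho>c: "\<rho> a \<in> carrier_mat n n" for a unfolding \<rho>_def by (rule mat_of_linear_carrier)
  have "\<rho> (x + y) = \<rho> x + \<rho> y" for x y
    by (rule mat_eq_if_mat_act_eq[OF \<rho>c add_carrier_mat[OF \<rho>c]])
      (simp add: act mat_act_add[OF \<rho>c \<rho>c] linear_to_matD(2)[OF l] mat_act_add[OF \<psi>c \<psi>c]
        ff.linear_add[OF lin(1)] sum.distrib)
  moreover have "\<rho> (scale c x) = c \<cdot>\<^sub>m \<rho> x" for c x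
    by (rule mat_eq_if_mat_act_eq[OF \<rho>c smult_carrier_mat[OF \<rho>c]])
      (simp add: act mat_act_smult linear_to_matD(3)[OF l] ff.linear_scale[OF lin(1)] fs.scale_sum_right)
  moreover have "\<rho> (x * y) = \<rho> x * \<rho> y" for x y
  proof (rule mat_eq_if_mat_act_eq[OF \<rho>c mult_carrier_mat[OF \<rho>c \<rho>c]])
    fix f :: "nat \<Rightarrow> 'k" assume f: "f \<in> coord_space n"
    have e: "\<pi> s (mat_act (\<rho> y) f) = mat_act (\<psi> y) (\<pi> s f)" if s: "s \<in> I" for s
    proof -
      have "\<pi> s (mat_act (\<rho> y) f) = (\<Sum>t\<in>I. \<pi> s (\<theta> t (mat_act (\<psi> y) (\<pi> t f))))"
        using act[OF f] ff.linear_sum[OF lin(2)[OF s]] by simp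
      also have "\<dots> = (\<Sum>t\<in>I. if s = t then mat_act (\<psi> y) (\<pi> t f) else 0)"
        using \<pi>[OF s _ \<psi>co] by (intro sum.cong) auto
      finally show ?thesis using s I by simp
    qed
    have "mat_act (\<rho> x * \<rho> y) f = mat_act (\<rho> x) (mat_act (\<rho> y) f)"
      using mat_act_mult[OF \<rho>c \<rho>c] .
    also have "\<dots> = (\<Sum>t\<in>I. \<theta> t (mat_act (\<psi> x) (\<pi> t (mat_act (\<rho> y) f))))"
      by (rule act[OF mat_act_coord_space[OF \<rho>c]])
    also have "\<dots> = (\<Sum>t\<in>I. \<theta> t (mat_act (\<psi> (x * y)) (\<pi> t f)))"
      using e matrix_representationD(3)[OF \<psi>] by (intro sum.cong) auto
    also have "\<dots> = mat_act (\<rho> (x * y)) f" using act[OF f] by simp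
    finally show "mat_act (\<rho> (x * y)) f = mat_act (\<rho> x * \<rho> y) f" by simp
  qed
  ultimately show "matrix_representation n \<rho>"
    unfolding matrix_representation_def linear_to_mat_def using \<rho>c by blast
qed

text \<open>The coordinates are cut into \<open>a\<close> consecutive blocks of length \<open>m\<close>. A vector in the kernel of the sum has all its
blocks in the kernel of \<open>\<psi> x\<close>.\<close>

lemma direct_sum_representation:
  assumes \<psi>: "matrix_representation m \<psi>"
  obtains \<rho> where "matrix_representation (a * m) \<rho>"
    "\<And>x. fs.dim (null_space (a * m) (\<rho> x)) \<le> a * fs.dim (null_space m (\<psi> x))"
proof -
  define \<theta> :: "nat \<Rightarrow> (nat \<Rightarrow> 'k) \<Rightarrow> nat \<Rightarrow> 'k" where
    "\<theta> t f = (\<lambda>i. if t * m \<le> i \<and> i < t * m + m then f (i - t * m) else 0)" for t f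
  define \<pi> :: "nat \<Rightarrow> (nat \<Rightarrow> 'k) \<Rightarrow> nat \<Rightarrow> 'k" where
    "\<pi> t f = (\<lambda>i. if i < m then f (t * m + i) else 0)" for t f
  have blk: "t * m + m \<le> s * m" if "t < s" for s t :: nat
    using mult_le_mono1[of "Suc t" s m] that by simp
  have lin: "flinear (\<theta> t)" "flinear (\<pi> t)" for t
    by (rule flinearI; auto simp: \<theta>_def \<pi>_def fscale_def fun_eq_iff)+
  have \<theta>c: "\<theta> t f \<in> coord_space (a * m)" if "t \<in> {..<a}" for t f
    using blk[of t a] that by (auto simp: \<theta>_def coord_space_def)
  have \<pi>: "\<pi> s (\<theta> t f) = (if s = t then f else 0)" if "f \<in> coord_space m" for s t f
  proof
    fix i
    consider "s = t" | "s < t" | "t < s" by linarith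
    then show "\<pi> s (\<theta> t f) i = (if s = t then f else 0) i"
      using that blk[of s t] blk[of t s] by cases (auto simp: \<pi>_def \<theta>_def coord_space_def)
  qed
  define \<rho> where "\<rho> x = mat_of_linear (a * m) (\<lambda>f. \<Sum>t<a. \<theta> t (mat_act (\<psi> x) (\<pi> t f)))" for x
  have ind: "matrix_representation (a * m) \<rho>"
    "\<And>x f. f \<in> coord_space (a * m) \<Longrightarrow>
      mat_act (\<rho> x) f = (\<Sum>t<a. \<theta> t (mat_act (\<psi> x) (\<pi> t f)))"
    unfolding \<rho>_def[abs_def]
    using lin \<theta>c \<pi> by (auto intro!: induced_representation[OF \<psi> finite_lessThan])
  have expand: "f = (\<Sum>t<a. \<theta> t (\<pi> t f))" if f: "f \<in> coord_space (a * m)" for f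
  proof
    fix i
    show "f i = (\<Sum>t<a. \<theta> t (\<pi> t f)) i"
    proof (cases "i < a * m")
      case True
      then have m: "m > 0" by (cases m) auto
      have d: "i div m < a" using True m by (simp add: div_less_iff_less_mult)
      have eq: "t * m \<le> i \<and> i < t * m + m \<longleftrightarrow> t = i div m" for t
      proof
        assume "t * m \<le> i \<and> i < t * m + m"
        then show "t = i div m" using div_nat_eqI[of m t i] by (simp add: mult.commute add.commute)
      next
        assume "t = i div m"
        then show "t * m \<le> i \<and> i < t * m + m"
          using div_times_less_eq_dividend[of i m] dividend_less_div_times[OF m, of i] by simp
      qed
      have "(\<Sum>t<a. \<theta> t (\<pi> t f)) i = (\<Sum>t<a. if t = i div m then f i else 0)"
        unfolding sum_fun_apply by (rule sum.cong) (use eq eq[of "i div m"] in \<open>auto simp: \<theta>_def \<pi>_def less_diff_conv2\<close>)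
      then show ?thesis using d by simp
    next
      case False
      have "\<theta> t (\<pi> t f) i = 0" if "t < a" for t
        using \<theta>c[of t "\<pi> t f"] that False by (simp add: coord_space_def)
      then show ?thesis using f False by (simp add: sum_fun_apply coord_space_def)
    qed
  qed
  have "fs.dim (null_space (a * m) (\<rho> x)) \<le> a * fs.dim (null_space m (\<psi> x))" for x
  proof -
    have fk: "fs.fin_dimensional (null_space m (\<psi> x))"
      by (rule fs.fin_dimensional_subset[OF fin_dimensional_coord_space[of m]]) (auto simp: null_space_def)
    obtain B where B: "finite B" "B \<subseteq> null_space m (\<psi> x)" "fs.independent B"
      "null_space m (\<psi> x) \<subseteq> fs.span B" "card B = fs.dim (null_space m (\<psi> x))"
      by (rule fs.fin_dimensional_basis[OF fk])
    let ?C = "(\<lambda>(t, b). \<theta> t b) ` ({..<a} \<times> B)"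
    have "null_space (a * m) (\<rho> x) \<subseteq> fs.span ?C"
    proof (rule subsetI)
      fix f assume "f \<in> null_space (a * m) (\<rho> x)"
      then have f: "f \<in> coord_space (a * m)" "mat_act (\<rho> x) f = 0" unfolding null_space_def by simp_all
      have "\<theta> t (\<pi> t f) \<in> fs.span ?C" if t: "t < a" for t
      proof -
        have "0 = \<pi> t (mat_act (\<rho> x) f)" using f(2) ff.linear_0[OF lin(2)] by simp
        also have "\<dots> = (\<Sum>s<a. \<pi> t (\<theta> s (mat_act (\<psi> x) (\<pi> s f))))"
          using ind(2)[OF f(1)] ff.linear_sum[OF lin(2)] by simp
        also have "\<dots> = (\<Sum>s<a. if t = s then mat_act (\<psi> x) (\<pi> s f) else 0)"
          using \<pi>[OF mat_act_coord_space[OF linear_to_matD(1)[OF matrix_representationD(1)[OF \<psi>]]]]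
          by (intro sum.cong) auto
        also have "\<dots> = mat_act (\<psi> x) (\<pi> t f)" using t by simp
        finally have "mat_act (\<psi> x) (\<pi> t f) = 0" by simp
        then have "\<pi> t f \<in> null_space m (\<psi> x)"
          by (simp add: null_space_def \<pi>_def coord_space_def)
        then have "\<pi> t f \<in> fs.span B" using B(4) by (rule subsetD[rotated])
        then have "\<theta> t (\<pi> t f) \<in> fs.span (\<theta> t ` B)" using ff.linear_span_image[OF lin(1)] by simp
        moreover have "\<theta> t ` B \<subseteq> ?C" using t by auto
        ultimately show ?thesis by (rule subsetD[OF fs.span_mono, rotated])
      qed
      then have "(\<Sum>t<a. \<theta> t (\<pi> t f)) \<in> fs.span ?C" by (intro fs.span_sum) auto
      then show "f \<in> fs.span ?C" using expand[OF f(1)] by simp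
    qed
    then have "fs.dim (null_space (a * m) (\<rho> x)) \<le> card ?C"
      by (rule fs.dim_le_card) (use B(1) in simp)
    also have "\<dots> \<le> a * fs.dim (null_space m (\<psi> x))"
      using card_image_le[of "{..<a} \<times> B"] B(1,5) by (simp add: card_cartesian_product)
    finally show ?thesis .
  qed
  then show ?thesis using that ind(1) by blast
qed

end

text \<open>Both families are extended to bases; since \<open>m \<le> n\<close>, the additional basis vectors on the left can be sent
injectively to additional ones on the right.\<close>

lemma extend_to_injection:
  fixes c d :: "'i \<Rightarrow> nat \<Rightarrow> 'k::field"
  assumes I: "finite I" and c: "fs.indep_family I c" "c ` I \<subseteq> coord_space m"
    and d: "fs.indep_family I d" "d ` I \<subseteq> coord_space n" and mn: "m \<le> n"
  obtains \<theta> \<pi> where "flinear \<theta>" "flinear \<pi>" "\<And>i. i \<in> I \<Longrightarrow> \<theta> (c i) = d i"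
    "\<And>f. f \<in> coord_space m \<Longrightarrow> \<theta> f \<in> coord_space n" "\<And>f. f \<in> coord_space m \<Longrightarrow> \<pi> (\<theta> f) = f"
proof -
  have ic: "inj_on c I" "fs.independent (c ` I)" and id: "inj_on d I" "fs.independent (d ` I)"
    using c(1) d(1) by (simp_all add: fs.indep_family_iff[OF I])
  obtain C where C: "c ` I \<subseteq> C" "C \<subseteq> coord_space m" "fs.independent C" "coord_space m \<subseteq> fs.span C"
    by (rule fs.maximal_independent_subset_extend[OF c(2) ic(2)])
  obtain D where D: "d ` I \<subseteq> D" "D \<subseteq> coord_space n" "fs.independent D" "coord_space n \<subseteq> fs.span D"
    by (rule fs.maximal_independent_subset_extend[OF d(2) id(2)])
  have cC: "finite C" "card C = m" 
    using fs.independent_card_le[OF fin_dimensional_coord_space C(2,3)] fs.basis_card_eq_dim[OF C(2,4,3)]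
    by (simp_all add: dim_coord_space)
  have cD: "finite D" "card D = n"
    using fs.independent_card_le[OF fin_dimensional_coord_space D(2,3)] fs.basis_card_eq_dim[OF D(2,4,3)]
    by (simp_all add: dim_coord_space)
  have "card (C - c ` I) \<le> card (D - d ` I)"
    using C(1) D(1) cC cD I mn by (simp add: card_Diff_subset card_image ic(1) id(1))
  then obtain h where h: "h ` (C - c ` I) \<subseteq> D - d ` I" "inj_on h (C - c ` I)"
    using card_le_inj[OF finite_Diff[OF cC(1)] finite_Diff[OF cD(1)]] by metis
  define g where "g x = (if x \<in> c ` I then d (the_inv_into I c x) else h x)" for x
  have gc: "g (c i) = d i" if "i \<in> I" for i using that ic(1) by (simp add: g_def the_inv_into_f_f)
  have gD: "g ` C \<subseteq> D" using h(1) D(1) gc by (auto simp: g_def the_inv_into_f_f[OF ic(1)])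
  have gi: "inj_on g C"
  proof (rule inj_onI)
    fix x y assume xy: "x \<in> C" "y \<in> C" "g x = g y"
    have A: "g z \<in> d ` I \<longleftrightarrow> z \<in> c ` I" if "z \<in> C" for z
      using h(1) gc that by (auto simp: g_def)
    show "x = y"
    proof (cases "x \<in> c ` I")
      case True
      then have "y \<in> c ` I" using A xy by metis
      then show ?thesis using True gc xy(3) id(1) by (auto simp: inj_on_eq_iff)
    next
      case False
      then have "y \<notin> c ` I" using A xy by metis
      then show ?thesis using False xy h(2) by (auto simp: g_def inj_on_eq_iff)
    qed
  qed
  obtain \<theta> where \<theta>: "flinear \<theta>" "\<forall>x\<in>C. \<theta> x = g x" using ff.linear_independent_extend[OF C(3), of g] by blast
  obtain \<pi> where \<pi>: "flinear \<pi>" "\<forall>y\<in>D. \<pi> y = (if y \<in> g ` C then the_inv_into C g y else 0)"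
    using ff.linear_independent_extend[OF D(3), of "\<lambda>y. if y \<in> g ` C then the_inv_into C g y else 0"] by blast
  show ?thesis
  proof (rule that[OF \<theta>(1) \<pi>(1)])
    show "\<theta> (c i) = d i" if "i \<in> I" for i using \<theta>(2) C(1) gc that by auto
    fix f :: "nat \<Rightarrow> 'k" assume "f \<in> coord_space m"
    then have f: "f \<in> fs.span C" using C(4) by auto
    have "\<theta> ` C \<subseteq> coord_space n" using \<theta>(2) gD D(2) by auto
    then have "\<theta> ` fs.span C \<subseteq> coord_space n"
      unfolding ff.linear_span_image[OF \<theta>(1), symmetric]
      by (intro fs.span_minimal subspace_coord_space)
    then show "\<theta> f \<in> coord_space n" using f by auto
    have "(\<pi> \<circ> \<theta>) x = x" if "x \<in> C" for x
      using \<theta>(2) \<pi>(2) gD that gi by (auto simp: the_inv_into_f_f)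
    then have "(\<pi> \<circ> \<theta>) f = id f"
      using ff.linear_eq_on[OF Vector_Spaces.linear_compose[OF \<theta>(1) \<pi>(1)] fs.linear_id f] by simp
    then show "\<pi> (\<theta> f) = f" by simp
  qed
qed

section \<open>Approximations and the word-length filtration\<close>

lemma rk_eq:
  assumes X: "X \<in> carrier_mat n n" and n: "n \<ge> 1"
  shows "rk n X = 1 - real (fs.dim (null_space n X)) / real n"
proof -
  have "real (vec_space.rank n X) + real (fs.dim (null_space n X)) = real n"
    using rank_add_dim_kernel[OF X] by (metis of_nat_add)
  then have "real (vec_space.rank n X) = real n - real (fs.dim (null_space n X))" by simp
  then show ?thesis using n unfolding rk_def by (simp add: diff_divide_distrib)
qed

text \<open>Turns the real inequalities in the definition of an approximation into statements about natural numbers.\<close>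

lemma nat_le_add_div_iff:
  fixes n u d :: nat
  assumes d: "d \<ge> 1"
  shows "n \<le> u + n div d \<longleftrightarrow> (1 - 1 / real d) * real n \<le> real u"
proof (cases "u \<le> n")
  case True
  have "n \<le> u + n div d \<longleftrightarrow> n - u \<le> n div d" using True by auto
  also have "\<dots> \<longleftrightarrow> (n - u) * d \<le> n" using d by (simp add: less_eq_div_iff_mult_less_eq)
  also have "\<dots> \<longleftrightarrow> real ((n - u) * d) \<le> real n" by (simp only: of_nat_le_iff)
  also have "\<dots> \<longleftrightarrow> (1 - 1 / real d) * real n \<le> real u" using d True
    by (simp add: of_nat_diff field_simps)
  finally show ?thesis .
next
  case False
  then have "real n \<le> real u" by simp
  moreover have "(1 - 1 / real d) * real n \<le> real n" using d by (simp add: mult_left_le_one_le)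
  ultimately show ?thesis using False by linarith
qed

lemma subspace_vec_image:
  assumes U: "fs.subspace U" "U \<subseteq> coord_space n"
  shows "VectorSpace.subspace (class_ring :: 'k::field ring) (vec n ` U) (module_vec TYPE('k) n)"
    and "fun_of_vec ` vec n ` U = U"
proof -
  interpret vec_space "TYPE('k)" n .
  show "fun_of_vec ` vec n ` U = U"
    unfolding image_image using U(2) fun_of_vec_vec by (metis (no_types, lifting) image_cong image_ident subsetD)
  have 0: "vec n (0 :: nat \<Rightarrow> 'k) = 0\<^sub>v n" by auto
  have 1: "vec n f + vec n g = vec n (f + g)" for f g :: "nat \<Rightarrow> 'k" by auto
  have 2: "c \<cdot>\<^sub>v vec n f = vec n (fscale c f)" for c and f :: "nat \<Rightarrow> 'k" by (auto simp: fscale_def)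
  have A: "0\<^sub>v n \<in> vec n ` U" using fs.subspace_0[OF U(1)] by (rule rev_image_eqI) (simp add: 0)
  have B: "v + w \<in> vec n ` U" if "v \<in> vec n ` U" "w \<in> vec n ` U" for v w
    using that by (auto simp: 1 intro!: imageI fs.subspace_add[OF U(1)])
  have C: "c \<cdot>\<^sub>v v \<in> vec n ` U" if "v \<in> vec n ` U" for c v
    using that by (auto simp: 2 intro!: imageI fs.subspace_scale[OF U(1)])
  have "submodule class_ring (vec n ` U) V"
    unfolding submodule_def using A B C by (auto simp: vec_module module_vec_simps)
  then show "VectorSpace.subspace class_ring (vec n ` U) V"
    unfolding VectorSpace.subspace_def using vectorspace_axioms by simp
qed

context K_algebra
begin

lemma linear_left_mult: "Vector_Spaces.linear scale scale (\<lambda>x. a * x)"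
  by (simp add: Vector_Spaces.linear_iff vector_space_axioms distrib_left scale_mult_right)

text \<open>Both numerical conditions take the same form: the good subspace has codimension at most \<open>n div d\<close>, and the kernels
of the nonzero elements of the ball have dimension at most \<open>n div d\<close>.\<close>

lemma d_approximation_iff:
  assumes n: "n \<ge> 1" and d: "d \<ge> 1"
  shows "d_approximation S d n \<phi> \<longleftrightarrow> linear_to_mat n \<phi> \<and>
    (\<exists>U. fs.subspace U \<and> U \<subseteq> coord_space n \<and>
      (\<forall>x\<in>A_le S d. \<forall>y\<in>A_le S d. \<forall>u\<in>U. mat_act (\<phi> (x * y)) u = mat_act (\<phi> x) (mat_act (\<phi> y) u)) \<and>
      n \<le> fs.dim U + n div d) \<and>
    (\<forall>a\<in>A_le S d. a \<noteq> 0 \<longrightarrow> fs.dim (null_space n (\<phi> a)) \<le> n div d)"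
proof (cases "linear_to_mat n \<phi>")
  case True
  note c = linear_to_matD(1)[OF True]
  have ker: "rk n (\<phi> a) \<ge> 1 - 1 / real d \<longleftrightarrow> fs.dim (null_space n (\<phi> a)) \<le> n div d" for a
  proof -
    have "rk n (\<phi> a) \<ge> 1 - 1 / real d \<longleftrightarrow> real (fs.dim (null_space n (\<phi> a))) / real n \<le> 1 / real d"
      unfolding rk_eq[OF c n] by linarith
    also have "\<dots> \<longleftrightarrow> real (fs.dim (null_space n (\<phi> a)) * d) \<le> real n"
      using n d by (simp add: field_simps)
    also have "\<dots> \<longleftrightarrow> fs.dim (null_space n (\<phi> a)) * d \<le> n" by (simp only: of_nat_le_iff)
    finally show ?thesis using d by (simp add: less_eq_div_iff_mult_less_eq)
  qed
  have mul: "\<phi> (x * y) *\<^sub>v u = \<phi> x *\<^sub>v (\<phi> y *\<^sub>v u) \<longleftrightarrow>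
      mat_act (\<phi> (x * y)) (fun_of_vec u) = mat_act (\<phi> x) (mat_act (\<phi> y) (fun_of_vec u))"
    if u: "u \<in> carrier_vec n" for x y u
  proof -
    have cy: "\<phi> z *\<^sub>v v \<in> carrier_vec n" if "v \<in> carrier_vec n" for z v
      using c[of z] that by (rule mult_mat_vec_carrier)
    have "\<phi> (x * y) *\<^sub>v u = \<phi> x *\<^sub>v (\<phi> y *\<^sub>v u) \<longleftrightarrow>
        fun_of_vec (\<phi> (x * y) *\<^sub>v u) = fun_of_vec (\<phi> x *\<^sub>v (\<phi> y *\<^sub>v u))"
      using inj_on_eq_iff[OF inj_on_fun_of_vec cy[OF u] cy[OF cy[OF u]]] by simp
    then show ?thesis
      using fun_of_vec_mult_mat_vec[OF c u] fun_of_vec_mult_mat_vec[OF c cy[OF u]] by simp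
  qed
  have "(\<exists>U. VectorSpace.subspace class_ring U (module_vec TYPE('k) n) \<and>
        (\<forall>x\<in>A_le S d. \<forall>y\<in>A_le S d. \<forall>u\<in>U. \<phi> (x * y) *\<^sub>v u = \<phi> x *\<^sub>v (\<phi> y *\<^sub>v u)) \<and>
        real (vec_subspace_dim n U) \<ge> (1 - 1 / real d) * real n) \<longleftrightarrow>
      (\<exists>U. fs.subspace U \<and> U \<subseteq> coord_space n \<and>
      (\<forall>x\<in>A_le S d. \<forall>y\<in>A_le S d. \<forall>u\<in>U. mat_act (\<phi> (x * y)) u = mat_act (\<phi> x) (mat_act (\<phi> y) u)) \<and>
      n \<le> fs.dim U + n div d)" (is "(\<exists>U. ?P U) \<longleftrightarrow> (\<exists>U. ?Q U)")
  proof
    assume "\<exists>U. ?P U"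
    then obtain U where U: "?P U" by (rule exE)
    note s = subspace_fun_of_vec[OF conjunct1[OF U]]
    have "?Q (fun_of_vec ` U)"
      using U s mul by (simp add: nat_le_add_div_iff[OF d] subset_iff)
    then show "\<exists>U. ?Q U" by (rule exI)
  next
    assume "\<exists>U. ?Q U"
    then obtain U where U: "?Q U" by (rule exE)
    note v = subspace_vec_image[OF conjunct1[OF U] conjunct1[OF conjunct2[OF U]]]
    note s = subspace_fun_of_vec[OF v(1)]
    have e: "fun_of_vec (vec n u) = u" if "u \<in> U" for u
      by (rule fun_of_vec_vec) (use U that in auto)
    have "?P (vec n ` U)"
      using U s v mul by (simp add: nat_le_add_div_iff[OF d] e)
    then show "\<exists>U. ?P U" by (rule exI)
  qed
  then show ?thesis unfolding d_approximation_def ker by simp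
qed (simp add: d_approximation_def)

lemma finite_monomials: "finite S \<Longrightarrow> finite (monomials S r)"
proof -
  assume "finite S"
  then have "finite (prod_list ` {xs. set xs \<subseteq> S \<and> length xs \<le> r})"
    by (intro finite_imageI finite_lists_length_le)
  moreover have "monomials S r = prod_list ` {xs. set xs \<subseteq> S \<and> length xs \<le> r}"
    by (auto simp: monomials_def)
  ultimately show ?thesis by simp
qed

lemma subspace_A_le: "subspace (A_le S r)" by (simp add: A_le_def)

lemma fin_dimensional_A_le: "finite S \<Longrightarrow> fin_dimensional (A_le S r)"
  unfolding A_le_def by (intro fin_dimensional_span finite_monomials)

lemma A_le_mono: "r \<le> s \<Longrightarrow> A_le S r \<subseteq> A_le S s"
  unfolding A_le_def by (intro span_mono) (force simp: monomials_def)

lemma generator_in_A_le: "s \<in> S \<Longrightarrow> r \<ge> 1 \<Longrightarrow> s \<in> A_le S r"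
  unfolding A_le_def monomials_def by (intro span_base CollectI exI[of _ "[s]"]) auto

lemma one_in_A_le: "1 \<in> A_le S r"
  unfolding A_le_def monomials_def by (intro span_base CollectI exI[of _ "[]"]) auto

lemma A_le_mult:
  assumes "x \<in> A_le S r" "y \<in> A_le S t"
  shows "x * y \<in> A_le S (r + t)"
proof -
  have mm: "a * b \<in> A_le S (r + t)" if ab: "a \<in> monomials S r" "b \<in> monomials S t" for a b
  proof -
    obtain xs where "a = prod_list xs" "set xs \<subseteq> S" "length xs \<le> r"
      using ab(1) unfolding monomials_def by blast
    moreover obtain ys where "b = prod_list ys" "set ys \<subseteq> S" "length ys \<le> t"
      using ab(2) unfolding monomials_def by blast
    ultimately
    have "a * b \<in> monomials S (r + t)"
      unfolding monomials_def by (intro CollectI exI[of _ "xs @ ys"]) auto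
    then show ?thesis unfolding A_le_def by (rule span_base)
  qed
  have my: "a * y \<in> A_le S (r + t)" if a: "a \<in> monomials S r" for a
    using assms(2) unfolding A_le_def[of S t]
  proof (induction rule: span_induct_alt)
    case base then show ?case using subspace_0[OF subspace_A_le] by simp
  next
    case (step c b z)
    then show ?case using mm[OF a] subspace_add[OF subspace_A_le] subspace_scale[OF subspace_A_le]
      by (simp add: distrib_left flip: scale_mult_right)
  qed
  show ?thesis
    using assms(1) unfolding A_le_def[of S r]
  proof (induction rule: span_induct_alt)
    case base then show ?case using subspace_0[OF subspace_A_le] by simp
  next
    case (step c b z)
    then show ?case using my subspace_add[OF subspace_A_le] subspace_scale[OF subspace_A_le]
      by (simp add: distrib_right flip: scale_mult_left)
  qed
qed

lemma A_le_exhausts: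
  assumes "generates S" shows "\<exists>r. x \<in> A_le S r"
proof -
  let ?A = "\<Union>r. A_le S r"
  have "is_subalgebra ?A"
    unfolding is_subalgebra_def
  proof (intro conjI ballI)
    show "subspace ?A"
    proof (rule subspaceI)
      show "0 \<in> ?A" using subspace_0[OF subspace_A_le] by auto
      show "scale c x \<in> ?A" if "x \<in> ?A" for c x using that by (auto intro: subspace_scale[OF subspace_A_le])
      show "x + y \<in> ?A" if xy: "x \<in> ?A" "y \<in> ?A" for x y
      proof -
        obtain r t where "x \<in> A_le S r" "y \<in> A_le S t" using xy by blast
        then have "x \<in> A_le S (max r t)" "y \<in> A_le S (max r t)"
          using A_le_mono[of r "max r t" S] A_le_mono[of t "max r t" S] by auto
        then show ?thesis by (intro UN_I[OF UNIV_I]) (rule subspace_add[OF subspace_A_le])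
      qed
    qed
    show "1 \<in> ?A" using one_in_A_le by auto
    show "x * y \<in> ?A" if "x \<in> ?A" "y \<in> ?A" for x y
      using that by (auto intro: A_le_mult)
  qed
  moreover have "S \<subseteq> ?A" using generator_in_A_le[of _ S 1] by auto
  ultimately have "is_subalgebra hull S \<subseteq> ?A" by (intro hull_minimal)
  then show ?thesis using assms unfolding generates_def by auto
qed

lemma finite_subset_A_le:
  assumes "generates S" "finite B" shows "\<exists>r. B \<subseteq> A_le S r"
  using assms(2)
proof (induction B rule: finite_induct)
  case (insert x B)
  then obtain r t where "B \<subseteq> A_le S r" "x \<in> A_le S t" using A_le_exhausts[OF assms(1)] by blast
  then have "insert x B \<subseteq> A_le S (max r t)"
    using A_le_mono[of r "max r t" S] A_le_mono[of t "max r t" S] by auto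
  then show ?case by (rule exI)
qed simp

lemma fin_dimensional_subset_A_le:
  assumes "generates S" "fin_dimensional W" shows "\<exists>r. W \<subseteq> A_le S r"
proof -
  obtain B where B: "finite B" "W \<subseteq> span B" using assms(2) unfolding fin_dimensional_def by (elim exE conjE)
  obtain r where "B \<subseteq> A_le S r" using finite_subset_A_le[OF assms(1) B(1)] by (rule exE)
  then have "span B \<subseteq> A_le S r" by (intro span_minimal subspace_A_le)
  then show ?thesis using B(2) by (intro exI) (rule subset_trans)
qed

text \<open>In an infinite-dimensional algebra the balls become arbitrarily large, in a finite-dimensional one they
eventually exhaust it.\<close>

lemma A_le_full_or_large:
  assumes S: "finite S" "generates S"
  shows "\<exists>D. \<forall>d\<ge>D. A_le S d = UNIV \<or> N < dim (A_le S d)"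
proof (cases "fin_dimensional (UNIV :: 'a set)")
  case True
  then obtain r where "UNIV \<subseteq> A_le S r" using fin_dimensional_subset_A_le[OF S(2)] by blast
  then have "A_le S d = UNIV" if "d \<ge> r" for d using A_le_mono[OF that, of S] by blast
  then show ?thesis by blast
next
  case False
  define B where "B = extend_basis {}"
  have B: "independent B" "span B = UNIV"
    unfolding B_def using independent_extend_basis[OF independent_empty] span_extend_basis[OF independent_empty] by simp_all
  have "infinite B" using False B(2) unfolding fin_dimensional_def by auto
  then obtain C where C: "finite C" "card C = Suc N" "C \<subseteq> B" using infinite_arbitrarily_large by metis
  have iC: "independent C" using independent_mono[OF B(1) C(3)] .
  obtain r where r: "C \<subseteq> A_le S r" using finite_subset_A_le[OF S(2) C(1)] by (rule exE)
  have "N < dim (A_le S d)" if "d \<ge> r" for d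
  proof -
    have "C \<subseteq> A_le S d" using r A_le_mono[OF that] by (rule subset_trans)
    then show ?thesis
      using independent_card_le[OF fin_dimensional_A_le[OF S(1)] _ iC, of d] C(2) by simp
  qed
  then show ?thesis by auto
qed

text \<open>For \<open>n < d\<close> the error terms \<open>n div d\<close> vanish, so \<open>\<phi>\<close> is multiplicative on the ball and nonzero elements of the
ball act injectively. If the ball had dimension greater than \<open>n\<close>, then some nonzero element of
it would kill the first unit vector.\<close>

lemma approximation_of_small_size_is_representation:
  assumes S: "finite S" and d: "n \<ge> 1" "n < d" and A: "A_le S d = UNIV \<or> n < dim (A_le S d)"
    and \<phi>: "d_approximation S d n \<phi>"
  shows "matrix_representation n \<phi>"
proof -
  have d1: "d \<ge> 1" using d by simp
  have nd: "n div d = 0" using d by simp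
  have l: "linear_to_mat n \<phi>" using \<phi> by (simp add: d_approximation_def)
  note iff = d_approximation_iff[OF d(1) d1, THEN iffD1, OF \<phi>, unfolded nd]
  obtain U where U: "fs.subspace U" "U \<subseteq> coord_space n"
    "\<forall>x\<in>A_le S d. \<forall>y\<in>A_le S d. \<forall>u\<in>U. mat_act (\<phi> (x * y)) u = mat_act (\<phi> x) (mat_act (\<phi> y) u)"
    "n \<le> fs.dim U" using iff by auto
  have ker: "fs.dim (null_space n (\<phi> a)) = 0" if "a \<in> A_le S d" "a \<noteq> 0" for a using iff that by auto
  have UC: "U = coord_space n"
    by (rule fs.fin_dimensional_subspace_eq[OF fin_dimensional_coord_space U(2,1)]) (simp add: U(4) dim_coord_space)
  have "A_le S d = UNIV"
  proof (rule ccontr)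
    assume "A_le S d \<noteq> UNIV"
    then have big: "n < dim (A_le S d)" using A by simp
    let ?e = "unit_fun 0 :: nat \<Rightarrow> 'k"
    let ?f = "\<lambda>a. mat_act (\<phi> a) ?e"
    have e0: "?e \<in> coord_space n" using d by (simp add: unit_fun_coord_space)
    have "fs.dim (?f ` A_le S d) \<le> n"
      using fs.fin_dimensional_dim_mono[OF fin_dimensional_coord_space[of n], of "?f ` A_le S d"]
        mat_act_coord_space[OF linear_to_matD(1)[OF l]] by (auto simp: dim_coord_space)
    moreover have "fs.dim (?f ` A_le S d) + dim {a\<in>A_le S d. ?f a = 0} = dim (A_le S d)"
      using af.rank_nullity[OF linear_act[OF l] subspace_A_le fin_dimensional_A_le[OF S]] .
    ultimately have "dim {a\<in>A_le S d. ?f a = 0} \<noteq> 0" using big by simp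
    then obtain a where a: "a \<in> A_le S d" "a \<noteq> 0" "?f a = 0"
      using dim_le_card[of "{a\<in>A_le S d. ?f a = 0}" "{}"] by auto
    have "{?e} \<subseteq> null_space n (\<phi> a)" using a(3) e0 by (simp add: null_space_def)
    moreover have "?e \<noteq> 0" by (simp add: unit_fun_def fun_eq_iff)
    moreover have "fs.fin_dimensional (null_space n (\<phi> a))"
      by (rule fs.fin_dimensional_subset[OF fin_dimensional_coord_space[of n]]) (auto simp: null_space_def)
    ultimately have "card {?e} \<le> fs.dim (null_space n (\<phi> a))"
      using fs.independent_card_le[of "null_space n (\<phi> a)" "{?e}"] by simp
    then show False using ker[OF a(1,2)] by simp
  qed
  then have m: "mat_act (\<phi> (x * y)) u = mat_act (\<phi> x) (mat_act (\<phi> y) u)" if "u \<in> coord_space n" for x y u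
    using U(3) UC that by simp
  note c = linear_to_matD(1)[OF l]
  have "\<phi> (x * y) = \<phi> x * \<phi> y" for x y
    by (rule mat_eq_if_mat_act_eq[OF c mult_carrier_mat[OF c c]]) (simp add: m mat_act_mult[OF c c])
  then show ?thesis using l by (simp add: matrix_representation_def)
qed

text \<open>A linear injection \<open>\<theta>\<close> that sends \<open>\<psi> w (v i)\<close> to \<open>\<phi> w (u i)\<close> transports \<open>\<psi>\<close>. On the tiles of \<open>\<phi>\<close> the
transported representation is left multiplication as well, because \<open>\<psi>\<close> is multiplicative.\<close>

lemma conjugate_to_match_tiles:
  assumes \<psi>: "matrix_representation m \<psi>" and \<phi>: "linear_to_mat n \<phi>" and mn: "m \<le> n"
    and W: "subspace W" "fin_dimensional W"
    and u: "tiles W \<phi> q u" and v: "tiles W \<psi> q v"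
  obtains \<rho> where "matrix_representation n \<rho>"
    "\<And>s w i. w \<in> W \<Longrightarrow> s * w \<in> W \<Longrightarrow> i < q \<Longrightarrow>
       mat_act (\<rho> s) (mat_act (\<phi> w) (u i)) = mat_act (\<phi> (s * w)) (u i)"
proof -
  note l = matrix_representationD(1)[OF \<psi>]
  note \<psi>co = mat_act_coord_space[OF linear_to_matD(1)[OF l]]
    and \<phi>co = mat_act_coord_space[OF linear_to_matD(1)[OF \<phi>]]
  obtain B where B: "finite B" "independent B" "span B = W" "card B = dim W"
    by (rule subspace_basis[OF W(2,1)])
  have BW: "B \<subseteq> W" using B(3) span_superset[of B] by simp
  let ?c = "\<lambda>(i, b). mat_act (\<psi> b) (v i)" and ?d = "\<lambda>(i, b). mat_act (\<phi> b) (u i)"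
  have fI: "finite ({..<q} \<times> B)" using B(1) by simp
  obtain \<theta> \<pi> where \<theta>: "flinear \<theta>" and \<pi>: "flinear \<pi>" and
    \<theta>c: "\<And>i. i \<in> {..<q} \<times> B \<Longrightarrow> \<theta> (?c i) = ?d i" and
    \<theta>co: "\<And>f. f \<in> coord_space m \<Longrightarrow> \<theta> f \<in> coord_space n" and
    \<pi>\<theta>: "\<And>f. f \<in> coord_space m \<Longrightarrow> \<pi> (\<theta> f) = f"
    by (rule extend_to_injection[OF fI tiles_indep_family[OF l v W(1) B(1,2) BW] _
          tiles_indep_family[OF \<phi> u W(1) B(1,2) BW] _ mn]) (use \<psi>co \<phi>co in auto)
  have \<theta>W: "\<theta> (mat_act (\<psi> w) (v i)) = mat_act (\<phi> w) (u i)" if "w \<in> W" "i < q" for w i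
    using that(1) unfolding B(3)[symmetric]
  proof (induction rule: span_induct_alt)
    case base
    show ?case unfolding af.linear_0[OF linear_act[OF l]] af.linear_0[OF linear_act[OF \<phi>]] by (rule ff.linear_0[OF \<theta>])
  next
    case (step c x y)
    have "\<theta> (mat_act (\<psi> x) (v i)) = mat_act (\<phi> x) (u i)" using \<theta>c[of "(i, x)"] that(2) step(1) by simp
    then show ?case
      unfolding af.linear_add[OF linear_act[OF l]] af.linear_add[OF linear_act[OF \<phi>]] ff.linear_add[OF \<theta>]
          af.linear_scale[OF linear_act[OF l]] af.linear_scale[OF linear_act[OF \<phi>]] ff.linear_scale[OF \<theta>] step(2)
      by simp
  qed
  define \<rho> where "\<rho> a = mat_of_linear n (\<lambda>f. \<Sum>t\<in>{()}. \<theta> (mat_act (\<psi> a) (\<pi> f)))" for a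
  note ir = induced_representation[OF \<psi>, where I = "{()}" and \<theta> = "\<lambda>_. \<theta>" and \<pi> = "\<lambda>_. \<pi>" and n = n]
  have ind: "matrix_representation n \<rho>" unfolding \<rho>_def[abs_def]
    by (rule ir(1)) (use \<theta> \<pi> \<theta>co \<pi>\<theta> in auto)
  have act: "mat_act (\<rho> x) f = (\<Sum>t\<in>{()}. \<theta> (mat_act (\<psi> x) (\<pi> f)))" if "f \<in> coord_space n" for x f
    unfolding \<rho>_def by (rule ir(2)) (use \<theta> \<pi> \<theta>co \<pi>\<theta> that in auto)
  show ?thesis
  proof (rule that[OF ind])
    fix s w i assume w: "w \<in> W" "s * w \<in> W" "i < q"
    have "mat_act (\<rho> s) (mat_act (\<phi> w) (u i)) = \<theta> (mat_act (\<psi> s) (\<pi> (\<theta> (mat_act (\<psi> w) (v i)))))"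
      using act[OF \<phi>co] \<theta>W[OF w(1,3)] by simp
    also have "\<dots> = \<theta> (mat_act (\<psi> (s * w)) (v i))"
      unfolding \<pi>\<theta>[OF \<psi>co] matrix_representationD(3)[OF \<psi>] ..
    also have "\<dots> = mat_act (\<phi> (s * w)) (u i)" using \<theta>W[OF w(2,3)] .
    finally show "mat_act (\<rho> s) (mat_act (\<phi> w) (u i)) = mat_act (\<phi> (s * w)) (u i)" .
  qed
qed

text \<open>Used for \<open>X = \<phi> s - \<rho> s\<close> and the subspace \<open>W'\<close> of those \<open>w\<close> for which \<open>s * w\<close> remains in \<open>W\<close>.\<close>

lemma tiles_agree_dim:
  assumes \<phi>: "linear_to_mat n \<phi>" and X: "X \<in> carrier_mat n n"
    and t: "tiles W \<phi> q u" and W: "subspace W'" "fin_dimensional W'" "W' \<subseteq> W"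
    and z: "\<And>w i. w \<in> W' \<Longrightarrow> i < q \<Longrightarrow> mat_act X (mat_act (\<phi> w) (u i)) = 0"
  shows "q * dim W' \<le> fs.dim (null_space n X)"
proof -
  obtain B where B: "finite B" "independent B" "span B = W'" "card B = dim W'"
    by (rule subspace_basis[OF W(2,1)])
  have BW: "B \<subseteq> W'" using B(3) span_superset[of B] by simp
  have t': "tiles W' \<phi> q u" using t W(3) unfolding tiles_def by blast
  let ?d = "\<lambda>(i, b). mat_act (\<phi> b) (u i)"
  have fI: "finite ({..<q} \<times> B)" using B(1) by simp
  have i: "inj_on ?d ({..<q} \<times> B)" "fs.independent (?d ` ({..<q} \<times> B))"
    using tiles_indep_family[OF \<phi> t' W(1) B(1,2) BW] fs.indep_family_iff[OF fI, of ?d] by simp_all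
  have "?d ` ({..<q} \<times> B) \<subseteq> null_space n X"
    using z BW mat_act_coord_space[OF linear_to_matD(1)[OF \<phi>]] by (auto simp: null_space_def)
  moreover have "fs.fin_dimensional (null_space n X)"
    by (rule fs.fin_dimensional_subset[OF fin_dimensional_coord_space[of n]]) (auto simp: null_space_def)
  ultimately have "card (?d ` ({..<q} \<times> B)) \<le> fs.dim (null_space n X)"
    by (rule conjunct2[OF fs.independent_card_le[OF _ _ i(2)], rotated])
  then show ?thesis using card_image[OF i(1)] B(4) by (simp add: card_cartesian_product)
qed

end

section \<open>Foelner subspaces\<close>

text \<open>Used to combine conditions, each of which holds on a subspace of small codimension.\<close>

lemma codim_Int:
  assumes "fs.subspace P" "P \<subseteq> coord_space n" "fs.subspace Q" "Q \<subseteq> coord_space n"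
  shows "fs.dim P + fs.dim Q \<le> fs.dim (P \<inter> Q) + n"
proof -
  have "fs.dim P + fs.dim Q \<le> fs.dim {w\<in>P. id w \<in> Q} + fs.dim (coord_space n :: (nat \<Rightarrow> 'a) set)"
    by (rule ff.dim_preimage_ge[OF fs.linear_id assms(1) _ subspace_coord_space fin_dimensional_coord_space assms(3,4)])
      (use assms(2) fs.fin_dimensional_subset[OF fin_dimensional_coord_space assms(2)] in simp_all)
  moreover have "{w\<in>P. id w \<in> Q} = P \<inter> Q" by auto
  ultimately show ?thesis by (simp add: dim_coord_space)
qed

lemma subspace_null_space: "fs.subspace (null_space n X)"
proof -
  have "null_space n X = {w\<in>coord_space n. mat_act X w \<in> {0}}" by (auto simp: null_space_def)
  then show ?thesis
    using ff.subspace_kernel_in[OF linear_mat_act subspace_coord_space fs.subspace_single_0] by simp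
qed

lemma null_space_subset: "null_space n X \<subseteq> coord_space n"
  by (auto simp: null_space_def)

lemma dim_mono_coord_space: "P \<subseteq> Q \<Longrightarrow> Q \<subseteq> coord_space n \<Longrightarrow> fs.dim P \<le> fs.dim Q"
  by (rule fs.fin_dimensional_dim_mono[OF fs.fin_dimensional_subset[OF fin_dimensional_coord_space]])

context K_algebra
begin

lemma product_in_span_products:
  assumes "v \<in> span F" "w \<in> span B"
  shows "v * w \<in> span ((\<lambda>(f, b). f * b) ` (F \<times> B))" (is "_ \<in> span ?P")
proof -
  have 1: "f * w \<in> span ?P" if f: "f \<in> F" for f
    using assms(2)
  proof (induction rule: span_induct_alt)
    case base show ?case by (simp add: span_zero)
  next
    case (step c b z)
    have "f * b \<in> span ?P" using f step(1) by (intro span_base) auto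
    then show ?case using step(2) by (simp add: distrib_left span_add span_scale flip: scale_mult_right)
  qed
  show ?thesis
    using assms(1)
  proof (induction rule: span_induct_alt)
    case base show ?case by (simp add: span_zero)
  next
    case (step c b z)
    then show ?case using 1 by (simp add: distrib_right span_add span_scale flip: scale_mult_left)
  qed
qed

text \<open>A late member of the sequence in the definition of amenability, for the multipliers in the span of \<open>F\<close>. That the
quotient of dimensions exceeds \<open>1/2\<close> makes \<open>W\<close> nonzero, as division by \<open>0\<close> gives \<open>0\<close>.\<close>

lemma foelner_subspace:
  assumes am: "amenable" and F: "finite F" "1 \<in> F" and \<delta>: "(\<delta>::real) > 0"
  obtains W Y where "subspace W" "fin_dimensional W" "0 < dim W" "subspace Y" "fin_dimensional Y" "W \<subseteq> Y"
    "\<forall>s\<in>F. \<forall>w\<in>W. s * w \<in> Y" "real (dim Y) \<le> (1 + \<delta>) * real (dim W)"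
proof -
  obtain W where W: "\<forall>i. fin_dim_subspace (W i)"
    "\<forall>V. fin_dim_subspace V \<and> V \<noteq> {0} \<longrightarrow>
       (\<lambda>i. real (dim (span {v * w | v w. v \<in> V \<and> w \<in> W i})) / real (dim (W i))) \<longlonglongrightarrow> 1"
    using am unfolding amenable_def by blast
  let ?V = "span F"
  let ?Y = "\<lambda>i. span {v * w | v w. v \<in> ?V \<and> w \<in> W i}"
  have "1 \<in> ?V" using F(2) by (rule span_base)
  then have "fin_dim_subspace ?V \<and> ?V \<noteq> {0}" unfolding fin_dim_subspace_def using F(1) by auto
  then have lim: "(\<lambda>i. real (dim (?Y i)) / real (dim (W i))) \<longlonglongrightarrow> 1" using W(2) by blast
  have "eventually (\<lambda>i. real (dim (?Y i)) / real (dim (W i)) < 1 + \<delta>) sequentially"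
    using order_tendstoD(2)[OF lim] \<delta> by simp
  moreover have "eventually (\<lambda>i. 1/2 < real (dim (?Y i)) / real (dim (W i))) sequentially"
    by (rule order_tendstoD(1)[OF lim]) simp
  ultimately have "eventually (\<lambda>i. real (dim (?Y i)) / real (dim (W i)) < 1 + \<delta> \<and>
      1/2 < real (dim (?Y i)) / real (dim (W i))) sequentially" by (rule eventually_conj)
  then obtain i where i: "real (dim (?Y i)) / real (dim (W i)) < 1 + \<delta>"
    "1/2 < real (dim (?Y i)) / real (dim (W i))"
    using eventually_happens'[OF sequentially_bot] by blast
  obtain B where B: "finite B" "W i = span B" using W(1) unfolding fin_dim_subspace_def by blast
  have "{v * w | v w. v \<in> ?V \<and> w \<in> W i} \<subseteq> span ((\<lambda>(f, b). f * b) ` (F \<times> B))"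
    using product_in_span_products unfolding B(2) by auto
  then have sub: "?Y i \<subseteq> span ((\<lambda>(f, b). f * b) ` (F \<times> B))" by (intro span_minimal subspace_span)
  have fdY: "fin_dimensional (?Y i)"
    by (rule fin_dimensional_subset[OF fin_dimensional_span sub]) (use F(1) B(1) in simp)
  have mem: "s * w \<in> ?Y i" if "s \<in> F" "w \<in> W i" for s w
    using that span_base[of s F] by (intro span_base) blast
  have WY: "W i \<subseteq> ?Y i" using mem[OF F(2)] by auto
  have pos: "0 < dim (W i)" using i(2) by (cases "dim (W i) = 0") auto
  show ?thesis
    by (rule that[of "W i" "?Y i"])
      (use B fdY mem WY pos i(1) in \<open>auto simp: fin_dimensional_span divide_less_eq\<close>)
qed

text \<open>Each \<open>s \<in> F\<close> costs at most \<open>dim Y - dim W\<close> dimensions, because \<open>s\<close> maps \<open>W\<close> into \<open>Y\<close>.\<close>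

lemma dim_shift_into:
  assumes W: "subspace W" "fin_dimensional W" and Y: "subspace Y" "fin_dimensional Y" "W \<subseteq> Y"
    and F: "finite F" "\<And>s w. s \<in> F \<Longrightarrow> w \<in> W \<Longrightarrow> s * w \<in> Y"
  shows "dim W \<le> dim {w\<in>W. \<forall>s\<in>F. s * w \<in> W} + card F * (dim Y - dim W) \<and>
    subspace {w\<in>W. \<forall>s\<in>F. s * w \<in> W}"
  using F
proof (induction F rule: finite_induct)
  case empty
  then show ?case using W(1) by simp
next
  case (insert s F)
  let ?X = "{w\<in>W. \<forall>s\<in>F. s * w \<in> W}"
  have aa: "linear_space_pair scale scale" by unfold_locales
  have IH: "dim W \<le> dim ?X + card F * (dim Y - dim W)" "subspace ?X" using insert by auto
  have fX: "fin_dimensional ?X" using fin_dimensional_subset[OF W(2)] by simp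
  have "dim ?X + dim W \<le> dim {w\<in>?X. s * w \<in> W} + dim Y"
    by (rule linear_space_pair.dim_preimage_ge[OF aa linear_left_mult IH(2) fX Y(1,2) W(1) Y(3)])
      (use insert.prems in auto)
  moreover have "{w\<in>?X. s * w \<in> W} = {w\<in>W. \<forall>s\<in>insert s F. s * w \<in> W}" by auto
  moreover have "dim W \<le> dim Y" using fin_dimensional_dim_mono[OF Y(2,3)] .
  ultimately have "dim W \<le> dim {w\<in>W. \<forall>s\<in>insert s F. s * w \<in> W} + card (insert s F) * (dim Y - dim W)"
    using IH(1) insert.hyps by simp
  moreover have "subspace {w\<in>?X. s * w \<in> W}"
    by (rule linear_space_pair.subspace_kernel_in[OF aa linear_left_mult IH(2) W(1)])
  ultimately show ?case using \<open>{w\<in>?X. s * w \<in> W} = _\<close> by simp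
qed

lemma d_approximation_mono:
  assumes \<phi>: "d_approximation S d' n \<phi>" and "1 \<le> d" "d \<le> d'" "n \<ge> 1"
  shows "d_approximation S d n \<phi>"
proof -
  have d': "d' \<ge> 1" using assms by simp
  have sub: "A_le S d \<subseteq> A_le S d'" using assms(3) by (rule A_le_mono)
  have le: "n div d' \<le> n div d" using assms by (simp add: div_le_mono2)
  show ?thesis
    using \<phi> unfolding d_approximation_iff[OF assms(4) d'] d_approximation_iff[OF assms(4,2)]
    using sub le by (auto simp: subset_iff)
qed

lemma representation_is_approximation:
  assumes "matrix_representation n \<psi>" "n \<ge> 1" "d \<ge> 1"
    and "\<And>a. a \<in> A_le S d \<Longrightarrow> a \<noteq> 0 \<Longrightarrow> fs.dim (null_space n (\<psi> a)) \<le> n div d"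
  shows "d_approximation S d n \<psi>"
  unfolding d_approximation_iff[OF assms(2,3)]
  using assms(4) matrix_representationD[OF assms(1)]
  by (auto intro!: exI[of _ "coord_space n"] simp: subspace_coord_space dim_coord_space)

text \<open>Left multiplication is compressed to a Foelner subspace \<open>W\<close> by means of linear coordinates \<open>c\<close> on \<open>W\<close>, extended to
the whole algebra. On the subspace \<open>W0\<close> of those \<open>w\<close> that stay in \<open>W\<close> under multiplication by the ball of
radius \<open>2 * d\<close> the compression changes nothing, so it is multiplicative there. A nonzero \<open>a\<close> acts
injectively on \<open>W0\<close> because the algebra has no zero divisors.\<close>

lemma exists_approximation:
  assumes am: "amenable" and S: "finite S" and d: "d \<ge> 1"
    and nzd: "\<And>x y :: 'a. x * y = 0 \<Longrightarrow> x = 0 \<or> y = 0"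
  shows "\<exists>n\<ge>1. \<exists>\<phi>. d_approximation S d n \<phi>"
proof -
  define F where "F = monomials S (2 * d)"
  have F: "finite F" "1 \<in> F"
    unfolding F_def using finite_monomials[OF S] by (auto simp: monomials_def intro!: exI[of _ "[]"])
  have cF: "card F \<ge> 1" using F by (simp add: Suc_le_eq card_gt_0_iff) blast
  \<comment> \<open>Each of the \<open>card F\<close> multipliers may cost \<open>\<delta> * n\<close> dimensions, at most \<open>n / d\<close> in total.\<close>
  define \<delta> where "\<delta> = 1 / (real d * real (card F))"
  have \<delta>0: "\<delta> > 0" using d cF by (simp add: \<delta>_def)
  obtain W Y where WY: "subspace W" "fin_dimensional W" "0 < dim W" "subspace Y" "fin_dimensional Y"
    "W \<subseteq> Y" "\<forall>s\<in>F. \<forall>w\<in>W. s * w \<in> Y" "real (dim Y) \<le> (1 + \<delta>) * real (dim W)"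
    by (rule foelner_subspace[OF am F \<delta>0])
  define n where "n = dim W"
  have n1: "n \<ge> 1" using WY(3) n_def by simp
  define W0 where "W0 = {w\<in>W. \<forall>s\<in>F. s * w \<in> W}"
  have W0: "n \<le> dim W0 + card F * (dim Y - n)" "subspace W0" "W0 \<subseteq> W"
    using dim_shift_into[OF WY(1,2,4,5,6) F(1)] WY(7) unfolding W0_def n_def by auto
  have "dim W \<le> dim Y" using fin_dimensional_dim_mono[OF WY(5,6)] .
  then have "real (dim Y - n) \<le> \<delta> * real n" using WY(8) by (simp add: n_def of_nat_diff algebra_simps)
  then have "real (card F) * real (dim Y - n) \<le> real (card F) * (\<delta> * real n)" by (intro mult_left_mono) auto
  also have "\<dots> = real n / real d" using cF by (simp add: \<delta>_def)
  finally have "real (card F * (dim Y - n)) * real d \<le> real n" using d by (simp add: field_simps)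
  then have "card F * (dim Y - n) * d \<le> n" by (metis of_nat_le_iff of_nat_mult)
  then have "card F * (dim Y - n) \<le> n div d" using d by (simp add: less_eq_div_iff_mult_less_eq)
  then have dW0: "n \<le> dim W0 + n div d" using W0(1) by simp
  have shift: "a * w \<in> W" if "a \<in> A_le S (2 * d)" "w \<in> W0" for a w
    using that(1) unfolding A_le_def F_def[symmetric]
  proof (induction rule: span_induct_alt)
    case base then show ?case using subspace_0[OF WY(1)] by simp
  next
    case (step c b z)
    then have "b * w \<in> W" using that(2) by (simp add: W0_def)
    then show ?case using step(2) subspace_add[OF WY(1)] subspace_scale[OF WY(1)]
      by (simp add: distrib_right flip: scale_mult_left)
  qed
  obtain B where B: "finite B" "independent B" "span B = W" "card B = dim W"
    by (rule subspace_basis[OF WY(2,1)])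
  obtain h where h: "bij_betw h {..<n} B"
    using ex_bij_betw_nat_finite[OF B(1)] B(4) n_def by (auto simp: atLeast0LessThan)
  have hB: "h i \<in> B" if "i < n" for i using h that by (auto simp: bij_betw_def)
  obtain c where c: "Vector_Spaces.linear scale fscale c" "\<forall>x\<in>B. c x = unit_fun (the_inv_into {..<n} h x)"
    "range c = fs.span ((\<lambda>x. unit_fun (the_inv_into {..<n} h x)) ` B)"
    using af.linear_independent_extend_subspace[OF B(2), of "\<lambda>x. unit_fun (the_inv_into {..<n} h x)"]
    by (elim exE conjE)
  have e0: "the_inv_into {..<n} h ` B = {..<n}"
    using h the_inv_into_onto[of h "{..<n}"] by (simp add: bij_betw_def)
  have e1: "(\<lambda>x. unit_fun (the_inv_into {..<n} h x) :: nat \<Rightarrow> 'k) ` B = unit_fun ` {..<n}"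
    using arg_cong[OF e0, of "image (unit_fun :: nat \<Rightarrow> nat \<Rightarrow> 'k)"] by (simp only: image_image)
  have "range c = coord_space n" unfolding c(3) e1 by (rule span_unit_funs)
  then have cco: "c x \<in> coord_space n" for x using rangeI[of c x] by simp
  have ch: "c (h i) = unit_fun i" if "i < n" for i
    using c(2) hB[OF that] h that by (auto simp: bij_betw_def the_inv_into_f_f)
  define emb where "emb f = (\<Sum>i<n. scale (f i) (h i))" for f :: "nat \<Rightarrow> 'k"
  have cemb: "c (emb f) = f" if "f \<in> coord_space n" for f
  proof -
    have "c (emb f) = (\<Sum>i<n. fscale (f i) (unit_fun i))"
      unfolding emb_def af.linear_sum[OF c(1)] by (rule sum.cong) (simp_all add: af.linear_scale[OF c(1)] ch)
    then show ?thesis using coord_space_expand[OF that] by simp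
  qed
  have cinj: "x = 0" if x: "x \<in> W" "c x = 0" for x
  proof -
    obtain u where "x = (\<Sum>b\<in>B. scale (u b) b)" 
      using x(1) unfolding B(3)[symmetric] span_finite[OF B(1)] by (rule rangeE)
    also have "\<dots> = emb (\<lambda>i. if i < n then u (h i) else 0)"
      unfolding emb_def by (subst sum.reindex_bij_betw[OF h, symmetric]) simp
    finally obtain f where f: "x = emb f" "f \<in> coord_space n"
      by (auto simp: coord_space_def)
    then have "f = 0" using cemb that(2) by simp
    then show "x = 0" using f(1) by (simp add: emb_def)
  qed
  have embW: "emb f \<in> W" for f
    unfolding emb_def using hB B(3) span_base[of _ B] by (intro subspace_sum subspace_scale WY(1)) auto
  have embc: "emb (c w) = w" if "w \<in> W" for w
  proof -
    have "c (emb (c w) - w) = 0" using cemb[OF cco] by (simp add: af.linear_diff[OF c(1)])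
    then show ?thesis using cinj[OF subspace_diff[OF WY(1) embW that]] by simp
  qed
  have emb_add: "emb (f + g) = emb f + emb g" for f g
    by (simp add: emb_def scale_left_distrib sum.distrib)
  have emb_scale: "emb (fscale k f) = scale k (emb f)" for k f
    by (simp add: emb_def fscale_def scale_sum_right)
  define \<phi> where "\<phi> a = mat_of_linear n (\<lambda>f. c (a * emb f))" for a
  have \<phi>c: "\<phi> a \<in> carrier_mat n n" for a by (simp add: \<phi>_def mat_of_linear_carrier)
  have act: "mat_act (\<phi> a) f = c (a * emb f)" if "f \<in> coord_space n" for a f
    unfolding \<phi>_def
    by (rule mat_act_mat_of_linear[OF _ _ that])
      (auto intro!: flinearI cco simp: emb_add emb_scale distrib_left af.linear_add[OF c(1)]
        af.linear_scale[OF c(1)] simp flip: scale_mult_right)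
  have "\<phi> (x + y) = \<phi> x + \<phi> y" for x y
    by (rule mat_eq_if_mat_act_eq[OF \<phi>c add_carrier_mat[OF \<phi>c]])
      (simp add: act mat_act_add[OF \<phi>c \<phi>c] distrib_right af.linear_add[OF c(1)])
  moreover have "\<phi> (scale k x) = k \<cdot>\<^sub>m \<phi> x" for k x
    by (rule mat_eq_if_mat_act_eq[OF \<phi>c smult_carrier_mat[OF \<phi>c]])
      (simp add: act mat_act_smult af.linear_scale[OF c(1)] flip: scale_mult_left)
  ultimately have lin: "linear_to_mat n \<phi>" unfolding linear_to_mat_def using \<phi>c by blast
  have actc: "mat_act (\<phi> a) (c w) = c (a * w)" if "w \<in> W" for a w
    using act[OF cco] embc[OF that] by simp
  define U where "U = c ` W0"
  have U: "fs.subspace U" "U \<subseteq> coord_space n"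
    unfolding U_def using af.linear_subspace_image[OF c(1) W0(2)] cco by auto
  have "fs.dim U + dim {w\<in>W0. c w = 0} = dim W0"
    unfolding U_def by (rule af.rank_nullity[OF c(1) W0(2) fin_dimensional_subset[OF WY(2) W0(3)]])
  moreover have "{w\<in>W0. c w = 0} \<subseteq> span {}" using cinj W0(3) by auto
  then have "dim {w\<in>W0. c w = 0} = 0" using dim_le_card[of _ "{}"] by simp
  ultimately have dU: "n \<le> fs.dim U + n div d" using dW0 by simp
  have sub: "A_le S d \<subseteq> A_le S (2 * d)" by (rule A_le_mono) simp
  have "mat_act (\<phi> (x * y)) u = mat_act (\<phi> x) (mat_act (\<phi> y) u)"
    if xy: "x \<in> A_le S d" "y \<in> A_le S d" "u \<in> U" for x y u
  proof -
    obtain w where w: "w \<in> W0" "u = c w" using xy(3) U_def by auto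
    have wW: "w \<in> W" using w(1) W0(3) by auto
    have "y * w \<in> W" using shift[OF _ w(1)] xy(2) sub by auto
    then show ?thesis unfolding w(2) actc[OF wW] by (simp add: actc mult.assoc)
  qed
  moreover have "fs.dim (null_space n (\<phi> a)) \<le> n div d" if a: "a \<in> A_le S d" "a \<noteq> 0" for a
  proof -
    have "null_space n (\<phi> a) \<inter> U \<subseteq> fs.span {}"
    proof
      fix f assume f: "f \<in> null_space n (\<phi> a) \<inter> U"
      then obtain w where w: "w \<in> W0" "f = c w" using U_def by auto
      have wW: "w \<in> W" using w(1) W0(3) by auto
      have "c (a * w) = 0" using f actc[OF wW] w(2) by (simp add: null_space_def)
      moreover have "a * w \<in> W" using shift[OF _ w(1)] a(1) sub by auto
      ultimately have "a * w = 0" by (rule cinj[rotated])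
      then have "w = 0" using nzd[of a w] a(2) by simp
      then show "f \<in> fs.span {}" using w(2) af.linear_0[OF c(1)] by simp
    qed
    then have "fs.dim (null_space n (\<phi> a) \<inter> U) = 0" using fs.dim_le_card[of _ "{}"] by simp
    then have "fs.dim (null_space n (\<phi> a)) + fs.dim U \<le> n"
      using codim_Int[OF subspace_null_space null_space_subset U, of "\<phi> a"] by simp
    then show ?thesis using dU by simp
  qed
  ultimately have "d_approximation S d n \<phi>"
    unfolding d_approximation_iff[OF n1 d] using lin U dU by (intro conjI exI[of _ U]) simp_all
  then show ?thesis using n1 by (intro exI[of _ n] conjI) auto
qed

end

section \<open>Weak stability and representations of almost full rank\<close>

context K_algebra
begin

text \<open>Induction on the length of the word: if \<open>\<phi>\<close> and \<open>\<psi>\<close> agree at \<open>f\<close> for the shorter word \<open>m\<close>, if \<open>\<phi>\<close> is multiplicative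
at \<open>f\<close>, and if they agree for \<open>s\<close> at \<open>\<psi> m f\<close>, then they agree at \<open>f\<close> for \<open>s * m\<close>. The last two conditions cost
at most \<open>k\<close> dimensions each.\<close>

lemma codim_monomial_agreement:
  assumes \<phi>: "d_approximation S d n \<phi>" and \<psi>: "matrix_representation n \<psi>" and n: "n \<ge> 1" and d: "d \<ge> 1"
    and S: "1 \<in> S" and k: "n div d \<le> k"
    and D: "\<And>s. s \<in> S \<Longrightarrow> n \<le> fs.dim (null_space n (\<phi> s - \<psi> s)) + k"
    and xs: "set xs \<subseteq> S" "length xs \<le> d"
  shows "n \<le> fs.dim (null_space n (\<phi> (prod_list xs) - \<psi> (prod_list xs))) + (2 * length xs + 1) * k"
  using xs
proof (induction xs)
  case Nil
  then show ?case using D[OF S] by simp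
next
  case (Cons s xs)
  let ?m = "prod_list xs" and ?G = "\<lambda>a. null_space n (\<phi> a - \<psi> a)"
  have l: "linear_to_mat n \<phi>" using \<phi> by (simp add: d_approximation_def)
  note c = linear_to_matD(1)[OF l] and c' = linear_to_matD(1)[OF matrix_representationD(1)[OF \<psi>]]
  have Gm: "f \<in> ?G a \<longleftrightarrow> f \<in> coord_space n \<and> mat_act (\<phi> a) f = mat_act (\<psi> a) f" for a f
    by (auto simp: null_space_def mat_act_minus[OF c c'])
  obtain U where U: "fs.subspace U" "U \<subseteq> coord_space n"
    "\<forall>x\<in>A_le S d. \<forall>y\<in>A_le S d. \<forall>u\<in>U. mat_act (\<phi> (x * y)) u = mat_act (\<phi> x) (mat_act (\<phi> y) u)"
    "n \<le> fs.dim U + n div d"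
    using \<phi> unfolding d_approximation_iff[OF n d] by (elim conjE exE)
  have sA: "s \<in> A_le S d" using Cons.prems(1) d by (intro generator_in_A_le) auto
  have mA: "?m \<in> A_le S d" unfolding A_le_def monomials_def
    using Cons.prems by (intro span_base CollectI exI[of _ xs]) auto
  define Q where "Q = {f\<in>coord_space n. mat_act (\<psi> ?m) f \<in> ?G s}"
  have Q: "fs.subspace Q" "Q \<subseteq> coord_space n"
    unfolding Q_def using ff.subspace_kernel_in[OF linear_mat_act subspace_coord_space subspace_null_space] by auto
  have "fs.dim (coord_space n :: (nat \<Rightarrow> 'k) set) + fs.dim (?G s) \<le> fs.dim Q + fs.dim (coord_space n :: (nat \<Rightarrow> 'k) set)"
    unfolding Q_def
    by (rule ff.dim_preimage_ge[OF linear_mat_act subspace_coord_space fin_dimensional_coord_space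
          subspace_coord_space fin_dimensional_coord_space subspace_null_space null_space_subset])
      (use mat_act_coord_space[OF c'] in auto)
  then have dQ: "n \<le> fs.dim Q + k" using D[of s] Cons.prems(1) by simp
  have IH: "n \<le> fs.dim (?G ?m) + (2 * length xs + 1) * k" using Cons by simp
  have UQ: "fs.subspace (U \<inter> Q)" "U \<inter> Q \<subseteq> coord_space n" using U Q fs.subspace_inter by auto
  have "fs.dim U + fs.dim Q \<le> fs.dim (U \<inter> Q) + n" by (rule codim_Int[OF U(1,2) Q])
  moreover have "fs.dim (U \<inter> Q) + fs.dim (?G ?m) \<le> fs.dim (U \<inter> Q \<inter> ?G ?m) + n"
    by (rule codim_Int[OF UQ subspace_null_space null_space_subset])
  moreover have "fs.dim (U \<inter> Q \<inter> ?G ?m) \<le> fs.dim (?G (s * ?m))"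
  proof (rule dim_mono_coord_space[OF _ null_space_subset])
    show "U \<inter> Q \<inter> ?G ?m \<subseteq> ?G (s * ?m)"
    proof
      fix f assume f: "f \<in> U \<inter> Q \<inter> ?G ?m"
      then have "mat_act (\<phi> (s * ?m)) f = mat_act (\<phi> s) (mat_act (\<phi> ?m) f)" using U(3) sA mA by auto
      also have "\<dots> = mat_act (\<psi> s) (mat_act (\<psi> ?m) f)" using f unfolding Q_def by (simp add: Gm)
      also have "\<dots> = mat_act (\<psi> (s * ?m)) f" using matrix_representationD(3)[OF \<psi>] by simp
      finally show "f \<in> ?G (s * ?m)" using f U(2) by (auto simp: Gm)
    qed
  qed
  ultimately have "n \<le> fs.dim (?G (s * ?m)) + (2 * length xs + 1) * k + 2 * k"
    using U(4) k dQ IH by linarith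
  then show ?case by (simp add: algebra_simps)
qed

lemma codim_agreement:
  assumes \<phi>: "d_approximation S d n \<phi>" and \<psi>: "matrix_representation n \<psi>" and n: "n \<ge> 1" and d: "d \<ge> 1"
    and S: "1 \<in> S" "finite S" and k: "n div d \<le> k" and r: "r \<le> d"
    and D: "\<And>s. s \<in> S \<Longrightarrow> n \<le> fs.dim (null_space n (\<phi> s - \<psi> s)) + k"
    and a: "a \<in> A_le S r"
  shows "n \<le> fs.dim (null_space n (\<phi> a - \<psi> a)) + card (monomials S r) * ((2 * r + 1) * k)"
proof -
  let ?G = "\<lambda>a. null_space n (\<phi> a - \<psi> a)"
  have l: "linear_to_mat n \<phi>" using \<phi> by (simp add: d_approximation_def)
  note l' = matrix_representationD(1)[OF \<psi>]
  note c = linear_to_matD(1)[OF l] and c' = linear_to_matD(1)[OF l']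
  have Gm: "f \<in> ?G a \<longleftrightarrow> f \<in> coord_space n \<and> mat_act (\<phi> a) f = mat_act (\<psi> a) f" for a f
    by (auto simp: null_space_def mat_act_minus[OF c c'])
  have one: "n \<le> fs.dim (?G m) + (2 * r + 1) * k" if m: "m \<in> monomials S r" for m
  proof -
    obtain xs where xs: "m = prod_list xs" "set xs \<subseteq> S" "length xs \<le> r" using m unfolding monomials_def by blast
    have "n \<le> fs.dim (?G m) + (2 * length xs + 1) * k"
      unfolding xs(1) using codim_monomial_agreement[OF \<phi> \<psi> n d S(1) k D xs(2)] xs(3) r by simp
    also have "\<dots> \<le> fs.dim (?G m) + (2 * r + 1) * k" using xs(3) by (intro add_left_mono mult_le_mono1) simp
    finally show ?thesis .
  qed
  define P where "P M = {f\<in>coord_space n. \<forall>m\<in>M. f \<in> ?G m}" for M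
  have "fs.subspace (P M) \<and> n \<le> fs.dim (P M) + card M * ((2 * r + 1) * k)"
    if "finite M" "M \<subseteq> monomials S r" for M
    using that
  proof (induction M rule: finite_induct)
    case empty
    then show ?case by (simp add: P_def subspace_coord_space dim_coord_space)
  next
    case (insert m M)
    have e: "P (insert m M) = P M \<inter> ?G m" unfolding P_def by auto
    have "P M \<subseteq> coord_space n" by (auto simp: P_def)
    then have "fs.dim (P M) + fs.dim (?G m) \<le> fs.dim (P (insert m M)) + n"
      unfolding e using insert by (intro codim_Int subspace_null_space null_space_subset) auto
    moreover have "n \<le> fs.dim (?G m) + (2 * r + 1) * k" using one insert.prems by simp
    ultimately show ?case using insert by (simp add: e fs.subspace_inter subspace_null_space)
  qed
  then have "n \<le> fs.dim (P (monomials S r)) + card (monomials S r) * ((2 * r + 1) * k)"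
    using finite_monomials[OF S(2)] by simp
  also have "fs.dim (P (monomials S r)) \<le> fs.dim (?G a)"
  proof (rule dim_mono_coord_space[OF _ null_space_subset])
    show "P (monomials S r) \<subseteq> ?G a"
    proof
      fix f assume f: "f \<in> P (monomials S r)"
      have "mat_act (\<phi> a) f = mat_act (\<psi> a) f"
        using a unfolding A_le_def
      proof (induction rule: span_induct_alt)
        case base
        show ?case unfolding af.linear_0[OF linear_act[OF l]] af.linear_0[OF linear_act[OF l']] ..
      next
        case (step c x y)
        have "mat_act (\<phi> x) f = mat_act (\<psi> x) f" using f step(1) by (auto simp: P_def Gm)
        then show ?case
          unfolding af.linear_add[OF linear_act[OF l]] af.linear_add[OF linear_act[OF l']]
            af.linear_scale[OF linear_act[OF l]] af.linear_scale[OF linear_act[OF l']] step(2) by simp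
      qed
      then show "f \<in> ?G a" using f by (simp add: Gm P_def)
    qed
  qed
  finally show ?thesis by simp
qed

lemma rk_less_imp_codim:
  assumes X: "X \<in> carrier_mat n n" and n: "n \<ge> 1" and d: "d \<ge> 1" and rk: "rk n X < 1 / real d"
  shows "n \<le> fs.dim (null_space n X) + n div d"
proof -
  have "(1 - 1 / real d) * real n \<le> (real (fs.dim (null_space n X)) / real n) * real n"
    using rk unfolding rk_eq[OF X n] by (intro mult_right_mono) simp_all
  then show ?thesis using n unfolding nat_le_add_div_iff[OF d] by simp
qed

text \<open>A representation that is close to a good approximation on \<open>S\<close> is an approximation itself, as the kernel of
\<open>\<psi> a\<close> exceeds that of \<open>\<phi> a\<close> by at most the codimension of the space where both agree.\<close>

lemma weakly_stable_imp_representation: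
  assumes ws: "weakly_stable S" and am: "amenable" and S: "1 \<in> S" "finite S" and d: "d \<ge> 1"
    and nzd: "\<And>x y :: 'a. x * y = 0 \<Longrightarrow> x = 0 \<or> y = 0"
  shows "\<exists>n\<ge>1. \<exists>\<psi>. matrix_representation n \<psi> \<and> d_approximation S d n \<psi>"
proof -
  \<comment> \<open>Each of the monomials loses at most \<open>2 * d + 1\<close> times the error \<open>n div d'\<close>, and the kernel of \<open>\<phi> a\<close> contributes
    one more such error; \<open>q\<close> errors of size \<open>n div (d * q)\<close> add up to at most \<open>n div d\<close>.\<close>
  define q where "q = card (monomials S d) * (2 * d + 1) + 1"
  define d' where "d' = d * q"
  have q1: "q \<ge> 1" by (simp add: q_def)
  have d': "d' \<ge> 1" "d \<le> d'" using d q1 by (simp_all add: d'_def Suc_le_eq)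
  have "1 / real d' > 0" using d' by simp
  then obtain d0 where d0: "d0 \<ge> 1" "\<forall>n\<ge>1. \<forall>\<phi>. d_approximation S d0 n \<phi> \<longrightarrow>
      (\<exists>\<psi>. matrix_representation n \<psi> \<and> (\<forall>s\<in>S. rk n (\<phi> s - \<psi> s) < 1 / real d'))"
    using ws unfolding weakly_stable_def by blast
  define D where "D = max d' d0"
  have D: "D \<ge> 1" "d' \<le> D" "d0 \<le> D" using d' by (auto simp: D_def)
  obtain n \<phi> where n: "n \<ge> 1" and \<phi>D: "d_approximation S D n \<phi>"
    using exists_approximation[OF am S(2) D(1) nzd] by blast
  have \<phi>: "d_approximation S d' n \<phi>" using d_approximation_mono[OF \<phi>D d'(1) D(2) n] .
  obtain \<psi> where \<psi>: "matrix_representation n \<psi>" "\<forall>s\<in>S. rk n (\<phi> s - \<psi> s) < 1 / real d'"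
    using d0(2) n d_approximation_mono[OF \<phi>D d0(1) D(3) n] by blast
  have l: "linear_to_mat n \<phi>" using \<phi> by (simp add: d_approximation_def)
  note c = linear_to_matD(1)[OF l] and c' = linear_to_matD(1)[OF matrix_representationD(1)[OF \<psi>(1)]]
  let ?G = "\<lambda>a. null_space n (\<phi> a - \<psi> a)"
  have ag: "n \<le> fs.dim (?G s) + n div d'" if "s \<in> S" for s
    using rk_less_imp_codim[OF minus_carrier_mat[OF c'] n d'(1)] \<psi>(2) that by blast
  have "fs.dim (null_space n (\<psi> a)) \<le> n div d" if a: "a \<in> A_le S d" "a \<noteq> 0" for a
  proof -
    have "n \<le> fs.dim (?G a) + card (monomials S d) * ((2 * d + 1) * (n div d'))"
      by (rule codim_agreement[OF \<phi> \<psi>(1) n d'(1) S order_refl d'(2) ag a(1)])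
    moreover have "fs.dim (null_space n (\<psi> a)) + fs.dim (?G a)
        \<le> fs.dim (null_space n (\<psi> a) \<inter> ?G a) + n"
      by (intro codim_Int subspace_null_space null_space_subset)
    moreover have "fs.dim (null_space n (\<psi> a) \<inter> ?G a) \<le> fs.dim (null_space n (\<phi> a))"
      by (rule dim_mono_coord_space[OF _ null_space_subset])
        (auto simp: null_space_def mat_act_minus[OF c c'])
    moreover have "a \<in> A_le S d'" using a(1) A_le_mono[OF d'(2)] by auto
    then have "fs.dim (null_space n (\<phi> a)) \<le> n div d'"
      using \<phi> a(2) unfolding d_approximation_iff[OF n d'(1)] by simp
    ultimately have "fs.dim (null_space n (\<psi> a)) \<le> q * (n div d')"
      by (simp add: q_def algebra_simps)
    also have "\<dots> = q * ((n div d) div q)" by (simp add: d'_def div_mult2_eq)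
    also have "\<dots> \<le> n div d" by simp
    finally show ?thesis .
  qed
  then have "d_approximation S d n \<psi>" by (rule representation_is_approximation[OF \<psi>(1) n d])
  then show ?thesis using n \<psi>(1) by blast
qed

text \<open>The given approximation \<open>\<phi>\<close> and a multiple \<open>\<Psi>\<close> of one fixed representation are both tiled by \<open>Q\<close> copies of the
same Foelner subspace \<open>W\<close>, with \<open>Q\<close> almost \<open>n / dim W\<close>. After matching the tiles the two agree on all vectors
\<open>\<phi> w (u i)\<close> for which \<open>s * w\<close> stays in \<open>W\<close>. The choices depend on each other in the order \<open>\<delta>\<close>, \<open>W\<close>, \<open>d'\<close>, \<open>\<psi>\<close>, \<open>d\<close>.\<close>

lemma representations_imp_weakly_stable:
  assumes am: "amenable" and S: "1 \<in> S" "finite S" "generates S"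
    and reps: "\<And>d. d \<ge> 1 \<Longrightarrow> \<exists>n\<ge>1. \<exists>\<psi>. matrix_representation n \<psi> \<and> d_approximation S d n \<psi>"
  shows "weakly_stable S"
  unfolding weakly_stable_def
proof (intro allI impI)
  fix \<epsilon> :: real assume \<epsilon>: "\<epsilon> > 0"
  \<comment> \<open>The final error is \<open>3 * \<delta> * n + m + k\<close>, where both \<open>3 * \<delta> * n\<close> and \<open>m + k\<close> stay below half of \<open>\<epsilon> * n\<close>.\<close>
  define \<delta> where "\<delta> = min (\<epsilon> / 6) (1 / 4)"
  have \<delta>: "\<delta> > 0" "\<delta> \<le> 1 / 4" "6 * \<delta> \<le> \<epsilon>" using \<epsilon> by (auto simp: \<delta>_def)
  obtain W Y where WY: "subspace W" "fin_dimensional W" "0 < dim W" "subspace Y" "fin_dimensional Y"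
    "W \<subseteq> Y" "\<forall>s\<in>S. \<forall>w\<in>W. s * w \<in> Y" "real (dim Y) \<le> (1 + \<delta>) * real (dim W)"
    by (rule foelner_subspace[OF am S(2,1) \<delta>(1)])
  define k where "k = dim W"
  have k: "k \<ge> 1" using WY(3) by (simp add: k_def)
  define W' where "W' s = {w\<in>W. \<forall>t\<in>{s}. t * w \<in> W}" for s
  have W': "subspace (W' s)" "(1 - \<delta>) * real k \<le> real (dim (W' s))" if "s \<in> S" for s
  proof -
    have *: "k \<le> dim (W' s) + card {s} * (dim Y - k) \<and> subspace (W' s)"
      unfolding k_def W'_def by (rule dim_shift_into[OF WY(1,2,4,5,6)]) (use WY(7) that in auto)
    then show "subspace (W' s)" by simp
    have "k \<le> dim Y" unfolding k_def using fin_dimensional_dim_mono[OF WY(5,6)] .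
    moreover have "k \<le> dim (W' s) + (dim Y - k)" using * by simp
    ultimately have "2 * k \<le> dim (W' s) + dim Y" by linarith
    then have "2 * real k \<le> real (dim (W' s)) + real (dim Y)" by (metis of_nat_add of_nat_le_iff of_nat_mult of_nat_numeral)
    then show "(1 - \<delta>) * real k \<le> real (dim (W' s))" using WY(8) by (simp add: k_def algebra_simps)
  qed
  obtain r where r: "W \<subseteq> A_le S r" using fin_dimensional_subset_A_le[OF S(3) WY(2)] by (rule exE)
  obtain d1 :: nat where d1: "1 / \<delta> \<le> real d1" using real_arch_simple by blast
  define d' where "d' = max r (max 4 d1)"
  have d': "d' \<ge> 4" "r \<le> d'" "d' \<ge> 1" by (auto simp: d'_def)
  have "1 / \<delta> \<le> real d'" using d1 by (simp add: d'_def)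
  then have d'\<delta>: "1 / real d' \<le> \<delta>" using \<delta>(1) d' by (simp add: field_simps)
  obtain m \<psi> where m: "m \<ge> 1" and \<psi>: "matrix_representation m \<psi>" "d_approximation S d' m \<psi>"
    using reps[OF d'(3)] by blast
  obtain N0 :: nat where N0: "2 * (real m + real k) / \<epsilon> \<le> real N0" using real_arch_simple by blast
  define N where "N = max N0 (2 * m)"
  obtain D where D: "\<forall>d\<ge>D. A_le S d = UNIV \<or> N < dim (A_le S d)"
    using A_le_full_or_large[OF S(2,3), of N] by (rule exE)
  define d where "d = max D (max d' (N + 1))"
  have d: "d \<ge> 1" "d' \<le> d" "d > N" "d \<ge> D" using d' by (auto simp: d_def)
  have "\<exists>\<rho>. matrix_representation n \<rho> \<and> (\<forall>s\<in>S. rk n (\<phi> s - \<rho> s) < \<epsilon>)"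
    if n: "n \<ge> 1" and \<phi>: "d_approximation S d n \<phi>" for n \<phi>
  proof -
    have l: "linear_to_mat n \<phi>" using \<phi> by (simp add: d_approximation_def)
    note c = linear_to_matD(1)[OF l]
    show ?thesis
    proof (cases "n \<le> N")
      case True
      have "A_le S d = UNIV \<or> n < dim (A_le S d)" using D d(4) True by (meson le_less_trans)
      then have "matrix_representation n \<phi>"
        using approximation_of_small_size_is_representation[OF S(2) n _ _ \<phi>] True d(3) by simp
      moreover have "rk n (\<phi> s - \<phi> s) < \<epsilon>" for s
      proof -
        have "null_space n (\<phi> s - \<phi> s) = coord_space n"
          by (auto simp: null_space_def mat_act_minus[OF c c])
        then show ?thesis using n \<epsilon> unfolding rk_eq[OF minus_carrier_mat[OF c] n] by (simp add: dim_coord_space)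
      qed
      ultimately show ?thesis by blast
    next
      case False
      then have nN: "n > N0" "n > 2 * m" by (auto simp: N_def)
      \<comment> \<open>The largest multiple of the fixed representation that fits into \<open>K\<^sup>n\<close>; fewer than \<open>m\<close> dimensions are left over.\<close>
      define a where "a = n div m"
      define M where "M = a * m"
      have "n = M + n mod m" unfolding M_def a_def by simp
      moreover have "n mod m < m" using m by simp
      ultimately have M: "M \<le> n" "n < M + m" by linarith+
      define e where "e = n div d'"
      have e4: "4 * e \<le> n" using d'(1) div_le_mono2[of 4 d' n] by (simp add: e_def) 
      have eM: "2 * e \<le> M" using e4 M nN by linarith
      obtain \<Psi> where \<Psi>: "matrix_representation M \<Psi>"
        "\<forall>x. fs.dim (null_space M (\<Psi> x)) \<le> a * fs.dim (null_space m (\<psi> x))"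
        using direct_sum_representation[OF \<psi>(1), of a] unfolding M_def by blast
      \<comment> \<open>One \<open>e\<close> pays for the kernels of the elements of \<open>W\<close>, the other for the codimension of the good
        subspace of \<open>\<phi>\<close>.\<close>
      define Q where "Q = (M - 2 * e) div k"
      have Qk: "Q * k \<le> M - 2 * e" by (simp add: Q_def)
      have "\<exists>v. (\<forall>i<Q. v i \<in> coord_space M) \<and> tiles W \<Psi> Q v"
      proof (rule tiles_exist[OF matrix_representationD(1)[OF \<Psi>(1)] WY(1,2) subspace_coord_space order_refl])
        fix x assume x: "x \<in> W" "x \<noteq> 0"
        then have "x \<in> A_le S d'" using r A_le_mono[OF d'(2)] by blast
        then have "fs.dim (null_space m (\<psi> x)) \<le> m div d'"
          using \<psi>(2) x(2) unfolding d_approximation_iff[OF m d'(3)] by simp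
        then have "a * fs.dim (null_space m (\<psi> x)) \<le> a * (m div d')" by (rule mult_le_mono2)
        also have "\<dots> \<le> (a * m) div d'" 
        proof -
          have "a * (m div d') * d' \<le> a * m" by (simp add: mult.assoc)
          then show ?thesis using d'(3) by (simp add: less_eq_div_iff_mult_less_eq)
        qed
        also have "\<dots> \<le> e" unfolding e_def using M(1) by (simp add: M_def div_le_mono)
        finally show "fs.dim (null_space M (\<Psi> x)) \<le> e" using \<Psi>(2) by (meson le_trans)
      next
        show "Q * dim W + e \<le> fs.dim (coord_space M :: (nat \<Rightarrow> 'k) set)"
          using Qk eM by (simp add: dim_coord_space k_def)
      qed
      then obtain v where v: "tiles W \<Psi> Q v" by blast
      obtain U where U: "fs.subspace U" "U \<subseteq> coord_space n"
        "\<forall>x\<in>A_le S d. \<forall>y\<in>A_le S d. \<forall>u\<in>U. mat_act (\<phi> (x * y)) u = mat_act (\<phi> x) (mat_act (\<phi> y) u)"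
        "n \<le> fs.dim U + n div d"
        using \<phi> unfolding d_approximation_iff[OF n d(1)] by (elim conjE exE)
      have ed: "n div d \<le> e" unfolding e_def using d(2) d'(3) by (intro div_le_mono2) auto
      have WA: "W \<subseteq> A_le S d" using r A_le_mono[of r d S] d'(2) d(2) by (meson le_trans subset_trans)
      have "\<exists>u. (\<forall>i<Q. u i \<in> U) \<and> tiles W \<phi> Q u"
      proof (rule tiles_exist[OF l WY(1,2) U(1,2)])
        fix x assume x: "x \<in> W" "x \<noteq> 0"
        then have "fs.dim (null_space n (\<phi> x)) \<le> n div d"
          using \<phi> WA unfolding d_approximation_iff[OF n d(1)] by blast
        then show "fs.dim (null_space n (\<phi> x)) \<le> e" using ed by simp
      next
        show "Q * dim W + e \<le> fs.dim U" using Qk eM U(4) ed M(1) by (simp add: k_def)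
      qed
      then obtain u where u: "\<forall>i<Q. u i \<in> U" "tiles W \<phi> Q u" by blast
      obtain \<rho> where \<rho>: "matrix_representation n \<rho>"
        and match: "\<And>s w i. w \<in> W \<Longrightarrow> s * w \<in> W \<Longrightarrow> i < Q \<Longrightarrow>
           mat_act (\<rho> s) (mat_act (\<phi> w) (u i)) = mat_act (\<phi> (s * w)) (u i)"
        using conjugate_to_match_tiles[OF \<Psi>(1) l M(1) WY(1,2) u(2) v] by metis
      note c' = linear_to_matD(1)[OF matrix_representationD(1)[OF \<rho>]]
      have "rk n (\<phi> s - \<rho> s) < \<epsilon>" if s: "s \<in> S" for s
      proof -
        have X: "\<phi> s - \<rho> s \<in> carrier_mat n n" using minus_carrier_mat[OF c'] .
        have sA: "s \<in> A_le S d" using generator_in_A_le[OF s d(1)] .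
        have "Q * dim (W' s) \<le> fs.dim (null_space n (\<phi> s - \<rho> s))"
        proof (rule tiles_agree_dim[OF l X u(2) W'(1)[OF s]])
          show "fin_dimensional (W' s)" using fin_dimensional_subset[OF WY(2)] by (simp add: W'_def)
          show "W' s \<subseteq> W" by (auto simp: W'_def)
          fix w i assume w: "w \<in> W' s" "i < Q"
          then have "w \<in> W" "s * w \<in> W" by (auto simp: W'_def)
          moreover have "mat_act (\<phi> (s * w)) (u i) = mat_act (\<phi> s) (mat_act (\<phi> w) (u i))"
            using U(3) sA WA u(1) w(2) \<open>w \<in> W\<close> by blast
          ultimately show "mat_act (\<phi> s - \<rho> s) (mat_act (\<phi> w) (u i)) = 0"
            using match[OF _ _ w(2)] by (simp add: mat_act_minus[OF c c'])
        qed
        then have ker: "real Q * real (dim (W' s)) \<le> real (fs.dim (null_space n (\<phi> s - \<rho> s)))"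
          by (metis of_nat_le_iff of_nat_mult)
        have "M - 2 * e < Q * k + k" 
          unfolding Q_def using dividend_less_div_times[of k "M - 2 * e"] k by simp
        then have "M < Q * k + k + 2 * e" by simp
        then have QM: "real M \<le> real Q * real k + real k + 2 * real e"
          by (metis less_imp_le of_nat_add of_nat_le_iff of_nat_mult of_nat_numeral)
        have "real e \<le> real n / real d'" unfolding e_def by (rule of_nat_div_le_of_nat)
        also have "\<dots> \<le> \<delta> * real n" using mult_right_mono[OF d'\<delta>, of "real n"] by simp
        finally have e: "real e \<le> \<delta> * real n" .
        have Qn: "real Q * real k \<le> real n" using Qk M(1) by (metis diff_le_self le_trans of_nat_le_iff of_nat_mult)
        have "real n \<le> real M + real m" using M(2) by linarith
        then have "real n - real m - real k - 2 * \<delta> * real n \<le> real Q * real k" using QM e by linarith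
        moreover have "\<delta> * (real Q * real k) \<le> \<delta> * real n" using Qn \<delta>(1) by (intro mult_left_mono) auto
        ultimately have "real n - real m - real k - 3 * \<delta> * real n \<le> (1 - \<delta>) * (real Q * real k)"
          by (simp add: algebra_simps)
        also have "\<dots> = real Q * ((1 - \<delta>) * real k)" by simp
        also have "\<dots> \<le> real Q * real (dim (W' s))" using W'(2)[OF s] by (intro mult_left_mono) auto
        finally have 1: "real n - real m - real k - 3 * \<delta> * real n \<le> real (fs.dim (null_space n (\<phi> s - \<rho> s)))"
          using ker by linarith
        have "2 * (real m + real k) / \<epsilon> < real n" using N0 nN(1) by linarith
        then have "2 * (real m + real k) < \<epsilon> * real n" using \<epsilon> by (simp add: field_simps)
        moreover have "6 * \<delta> * real n \<le> \<epsilon> * real n" using \<delta>(3) by (intro mult_right_mono) auto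
        ultimately have "(1 - \<epsilon>) * real n < real (fs.dim (null_space n (\<phi> s - \<rho> s)))"
          using 1 by (simp add: algebra_simps)
        then show ?thesis unfolding rk_eq[OF X n] using n by (simp add: field_simps)
      qed
      then show ?thesis using \<rho> by blast
    qed
  qed
  then show "\<exists>d\<ge>1. \<forall>n\<ge>1. \<forall>\<phi>. d_approximation S d n \<phi> \<longrightarrow>
      (\<exists>\<psi>. matrix_representation n \<psi> \<and> (\<forall>s\<in>S. rk n (\<phi> s - \<psi> s) < \<epsilon>))"
    using d(1) by blast
qed

text \<open>Being a \<open>d\<close>-approximation gets stronger as \<open>d\<close> grows, so one representation for each \<open>d\<close> makes up a sequence.\<close>

lemma sofic_representation_iff:
  "(\<exists>(n :: nat \<Rightarrow> nat) (\<psi> :: nat \<Rightarrow> 'a \<Rightarrow> 'k mat).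
      (\<forall>k. matrix_representation (n k) (\<psi> k)) \<and> linear_sofic_representation S n \<psi>) \<longleftrightarrow>
   (\<forall>d\<ge>1. \<exists>n\<ge>1. \<exists>\<psi>. matrix_representation n \<psi> \<and> d_approximation S d n \<psi>)"
proof
  assume "\<exists>(n :: nat \<Rightarrow> nat) (\<psi> :: nat \<Rightarrow> 'a \<Rightarrow> 'k mat).
      (\<forall>k. matrix_representation (n k) (\<psi> k)) \<and> linear_sofic_representation S n \<psi>"
  then obtain n :: "nat \<Rightarrow> nat" and \<psi> :: "nat \<Rightarrow> 'a \<Rightarrow> 'k mat" where
    *: "\<forall>k. matrix_representation (n k) (\<psi> k)" "linear_sofic_representation S n \<psi>" by blast
  show "\<forall>d\<ge>1. \<exists>n\<ge>1. \<exists>\<psi>. matrix_representation n \<psi> \<and> d_approximation S d n \<psi>"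
  proof (intro allI impI)
    fix d :: nat assume "1 \<le> d"
    then have "eventually (\<lambda>k. d_approximation S d (n k) (\<psi> k)) sequentially"
      using *(2) unfolding linear_sofic_representation_def by blast
    then obtain k where "d_approximation S d (n k) (\<psi> k)"
      using eventually_happens'[OF sequentially_bot] by blast
    then show "\<exists>n\<ge>1. \<exists>\<psi>. matrix_representation n \<psi> \<and> d_approximation S d n \<psi>"
      using * unfolding linear_sofic_representation_def by blast
  qed
next
  assume *: "\<forall>d\<ge>1. \<exists>n\<ge>1. \<exists>\<psi>. matrix_representation n \<psi> \<and> d_approximation S d n \<psi>"
  have "\<forall>k. \<exists>n \<psi>. n \<ge> 1 \<and> matrix_representation n \<psi> \<and> d_approximation S (Suc k) n \<psi>"
    using * by (metis Suc_eq_plus1 le_add2)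
  then obtain n \<psi> where n: "\<forall>k. n k \<ge> 1 \<and> matrix_representation (n k) (\<psi> k) \<and> d_approximation S (Suc k) (n k) (\<psi> k)"
    by metis
  have "eventually (\<lambda>k. d_approximation S d (n k) (\<psi> k)) sequentially" if "d \<ge> 1" for d
    unfolding eventually_sequentially
  proof (intro exI[of _ d] allI impI)
    fix k assume "d \<le> k"
    then show "d_approximation S d (n k) (\<psi> k)"
      using d_approximation_mono[of S "Suc k" "n k" "\<psi> k" d] n that by simp
  qed
  then have "linear_sofic_representation S n \<psi>"
    unfolding linear_sofic_representation_def using n by (simp add: matrix_representation_def)
  then show "\<exists>(n :: nat \<Rightarrow> nat) (\<psi> :: nat \<Rightarrow> 'a \<Rightarrow> 'k mat).
      (\<forall>k. matrix_representation (n k) (\<psi> k)) \<and> linear_sofic_representation S n \<psi>"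
    using n by blast
qed

end

section \<open>Group algebras and finite congruences\<close>

lemma poly_mapping_additive_induct:
  fixes p :: "'g \<Rightarrow>\<^sub>0 'k::comm_monoid_add"
  assumes "P 0" "\<And>g c. P (Poly_Mapping.single g c)" "\<And>p q. P p \<Longrightarrow> P q \<Longrightarrow> P (p + q)"
  shows "P p"
proof -
  have "P (\<Sum>g\<in>A. Poly_Mapping.single g (Poly_Mapping.lookup p g))" if "finite A" for A
    using that by (induction A rule: finite_induct) (auto simp: assms)
  then have "P (\<Sum>g\<in>Poly_Mapping.keys p. Poly_Mapping.single g (Poly_Mapping.lookup p g))" by simp
  moreover have "(\<Sum>g\<in>Poly_Mapping.keys p. Poly_Mapping.single g (Poly_Mapping.lookup p g)) = p"
  proof (rule poly_mapping_eqI)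
    fix x
    have "Poly_Mapping.lookup (\<Sum>g\<in>Poly_Mapping.keys p. Poly_Mapping.single g (Poly_Mapping.lookup p g)) x = (\<Sum>g\<in>Poly_Mapping.keys p. if g = x then Poly_Mapping.lookup p x else 0)"
      unfolding lookup_sum by (rule sum.cong) (auto simp: lookup_single when_def)
    also have "\<dots> = Poly_Mapping.lookup p x" by (simp add: in_keys_iff)
    finally show "Poly_Mapping.lookup (\<Sum>g\<in>Poly_Mapping.keys p. Poly_Mapping.single g (Poly_Mapping.lookup p g)) x = Poly_Mapping.lookup p x" .
  qed
  ultimately show ?thesis by simp
qed

text \<open>The action of the group algebra on all functions on the group, extending the regular representation from
finitely supported functions.\<close>

definition convolve :: "('g::group_add \<Rightarrow>\<^sub>0 'k::field) \<Rightarrow> ('g \<Rightarrow> 'k) \<Rightarrow> 'g \<Rightarrow> 'k" where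
  "convolve a F g = (\<Sum>h\<in>Poly_Mapping.keys a. Poly_Mapping.lookup a h * F (- h + g))"

lemma convolve_superset:
  assumes "finite A" "Poly_Mapping.keys a \<subseteq> A"
  shows "convolve a F g = (\<Sum>h\<in>A. Poly_Mapping.lookup a h * F (- h + g))"
  unfolding convolve_def using assms by (intro sum.mono_neutral_left) (auto simp: in_keys_iff)

lemma convolve_zero: "convolve 0 F g = 0"
  by (simp add: convolve_def)

lemma convolve_add: "convolve (a + b) F g = convolve a F g + convolve b F g"
  using convolve_superset[of "Poly_Mapping.keys a \<union> Poly_Mapping.keys b" a F g] convolve_superset[of "Poly_Mapping.keys a \<union> Poly_Mapping.keys b" b F g]
    convolve_superset[of "Poly_Mapping.keys a \<union> Poly_Mapping.keys b" "a + b" F g] keys_add[of a b]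
  by (simp add: lookup_add distrib_right sum.distrib)

lemma convolve_single: "convolve (Poly_Mapping.single h c) F g = c * F (- h + g)"
  using convolve_superset[of "{h}" "Poly_Mapping.single h c" F g] by simp

lemma convolve_scale: "convolve (group_algebra_scale c a) F g = c * convolve a F g"
  using convolve_superset[of "Poly_Mapping.keys a" "group_algebra_scale c a" F g]
  by (simp add: convolve_def lookup_group_algebra_scale in_keys_iff subset_iff sum_distrib_left mult.assoc)

lemma convolve_add_right: "convolve a (\<lambda>g. F g + G g) x = convolve a F x + convolve a G x"
  by (simp add: convolve_def distrib_left sum.distrib)

lemma convolve_scale_right: "convolve a (\<lambda>g. c * F g) x = c * convolve a F x"
  by (simp add: convolve_def sum_distrib_left mult.left_commute)

lemma lookup_mult_eq_convolve: "Poly_Mapping.lookup (a * b) g = convolve a (Poly_Mapping.lookup b) g"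
proof (induction a arbitrary: g rule: poly_mapping_additive_induct)
  case (2 h c)
  show ?case
  proof (induction b rule: poly_mapping_additive_induct)
    case (2 h' c')
    have "h + h' = g \<longleftrightarrow> h' = - h + g" by (metis add.assoc add.left_inverse add_0 add.right_inverse)
    then show ?case by (simp add: convolve_single mult_single lookup_single when_def)
  qed (simp_all add: convolve_single distrib_left lookup_add)
qed (simp_all add: convolve_zero convolve_add distrib_right lookup_add)

lemma convolve_mult: "convolve (a * b) F g = convolve a (convolve b F) g"
proof (induction a arbitrary: g rule: poly_mapping_additive_induct)
  case (2 h c)
  show ?case
  proof (induction b arbitrary: g rule: poly_mapping_additive_induct)
    case (2 h' c')
    have "- (h + h') + g = - h' + (- h + g)" by (simp only: minus_add add.assoc)
    then show ?case by (simp only: convolve_single mult_single mult.assoc)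
  qed (simp_all add: convolve_single distrib_left convolve_zero convolve_add)
qed (simp_all add: convolve_zero convolve_add distrib_right)

text \<open>A finite quotient of the group, given by a numbering of its elements: \<open>p g\<close> is the number of the class of \<open>g\<close>.\<close>

definition finite_congruence :: "('g::group_add \<Rightarrow> nat) \<Rightarrow> bool" where
  "finite_congruence p \<longleftrightarrow> finite (range p) \<and>
     (\<forall>x g h. p g = p h \<longrightarrow> p (x + g) = p (x + h) \<and> p (g + x) = p (h + x))"

lemma finite_congruenceD:
  assumes "finite_congruence p"
  shows "finite (range p)" "p g = p h \<Longrightarrow> p (x + g) = p (x + h)" "p g = p h \<Longrightarrow> p (g + x) = p (h + x)"
  using assms unfolding finite_congruence_def by blast+

lemma normal_finite_congruence:
  assumes N: "N \<lhd> type_group TYPE('g::group_add)" and fin: "finite (rcosets\<^bsub>type_group TYPE('g::group_add)\<^esub> N)"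
  obtains p :: "'g::group_add \<Rightarrow> nat" where "finite_congruence p" "\<And>x. x \<notin> N \<Longrightarrow> p x \<noteq> p 0"
proof -
  let ?G = "type_group TYPE('g::group_add)"
  interpret normal N ?G by (rule N)
  have car: "x \<in> carrier ?G" for x by (simp add: type_group_def)
  obtain h n where h: "h ` (rcosets\<^bsub>?G\<^esub> N) = {i::nat. i < n}" "inj_on h (rcosets\<^bsub>?G\<^esub> N)"
    using finite_imp_inj_to_nat_seg[OF fin] by blast
  define c where "c g = N #>\<^bsub>?G\<^esub> g" for g
  have cR: "c g \<in> rcosets\<^bsub>?G\<^esub> N" for g unfolding c_def RCOSETS_def using car by blast
  have sum: "c (x + y) = c x <#>\<^bsub>?G\<^esub> c y" for x y
    using rcos_sum[OF car car, of x y] by (simp add: c_def type_group_def)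
  define p where "p g = h (c g)" for g
  have p: "p g = p k \<longleftrightarrow> c g = c k" for g k
    using inj_on_eq_iff[OF h(2) cR cR] by (simp add: p_def)
  have "finite_congruence p"
    unfolding finite_congruence_def p
  proof (intro conjI allI impI)
    show "finite (range p)"
      by (rule finite_subset[of _ "h ` (rcosets\<^bsub>?G\<^esub> N)"]) (use cR fin p_def in auto)
  qed (simp_all add: sum)
  moreover have "p x \<noteq> p 0" if "x \<notin> N" for x
  proof
    assume "p x = p 0"
    then have "c x = c 0" by (simp add: p)
    moreover have "x \<in> c x" unfolding c_def by (rule rcos_self[OF car]) (rule subgroup_axioms)
    moreover have "c 0 = N" using coset_mult_one[OF subset] by (simp add: c_def type_group_def)
    ultimately show False using that by simp
  qed
  ultimately show ?thesis by (rule that)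
qed

text \<open>Finitely many nontrivial elements are separated simultaneously by pairing up the quotients that separate
one element each; afterwards the classes are renumbered without gaps.\<close>

lemma residually_finite_separates:
  assumes rf: "residually_finite (type_group TYPE('g::group_add))" and X: "finite X" "0 \<notin> X"
  obtains p :: "'g::group_add \<Rightarrow> nat" and m where "range p = {..<m}" "finite_congruence p" "\<And>x. x \<in> X \<Longrightarrow> p x \<noteq> p 0"
proof -
  have "\<exists>p :: 'g \<Rightarrow> nat. finite_congruence p \<and> (\<forall>x\<in>X. p x \<noteq> p 0)"
    using X
  proof (induction X rule: finite_induct)
    case empty
    then show ?case by (intro exI[of _ "\<lambda>_. 0"]) (simp add: finite_congruence_def)
  next
    case (insert x X)
    then obtain p where p: "finite_congruence p" "\<forall>x\<in>X. p x \<noteq> p 0" by auto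
    have "x \<noteq> 0" using insert.prems by auto
    then obtain N where N: "N \<lhd> type_group TYPE('g::group_add)" "finite (rcosets\<^bsub>type_group TYPE('g::group_add)\<^esub> N)" "x \<notin> N"
      using rf unfolding residually_finite_def by (auto simp: type_group_def)
    obtain q :: "'g \<Rightarrow> nat" where q: "finite_congruence q" "q x \<noteq> q 0"
      using normal_finite_congruence[OF N(1,2)] N(3) by metis
    define r where "r g = prod_encode (p g, q g)" for g
    have "range r \<subseteq> prod_encode ` (range p \<times> range q)" by (auto simp: r_def)
    then have "finite (range r)"
      using p(1) q(1) by (meson finite_SigmaI finite_congruence_def finite_imageI finite_subset)
    moreover have rc: "r (x + g) = r (x + h) \<and> r (g + x) = r (h + x)" if "r g = r h" for x g h
    proof -
      have gh: "p g = p h" "q g = q h" using that by (simp_all add: r_def)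
      show ?thesis
        unfolding r_def finite_congruenceD(2)[OF p(1) gh(1)] finite_congruenceD(3)[OF p(1) gh(1)]
          finite_congruenceD(2)[OF q(1) gh(2)] finite_congruenceD(3)[OF q(1) gh(2)] by (intro conjI refl)
    qed
    ultimately have "finite_congruence r" unfolding finite_congruence_def
      by (intro conjI allI impI) (assumption | erule rc[THEN conjunct1] | erule rc[THEN conjunct2])+
    moreover have "\<forall>y\<in>insert x X. r y \<noteq> r 0" using p(2) q(2) by (auto simp: r_def)
    ultimately show ?case by blast
  qed
  then obtain p :: "'g \<Rightarrow> nat" where p: "finite_congruence p" "\<forall>x\<in>X. p x \<noteq> p 0" by blast
  then obtain h m where h: "h ` range p = {i::nat. i < m}" "inj_on h (range p)"
    using finite_imp_inj_to_nat_seg[of "range p"] unfolding finite_congruence_def by blast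
  define q where "q g = h (p g)" for g
  have qp: "q g = q k \<longleftrightarrow> p g = p k" for g k unfolding q_def using inj_on_eq_iff[OF h(2)] by simp
  have "range q = {..<m}" using h(1) by (auto simp: q_def)
  moreover have "finite_congruence q"
    unfolding finite_congruence_def qp calculation
    using finite_congruenceD(2,3)[OF p(1)] finite_lessThan by blast
  moreover have "q x \<noteq> q 0" if "x \<in> X" for x using p(2) that by (simp add: qp)
  ultimately show ?thesis by (rule that)
qed

text \<open>A minimal set \<open>P\<close> of coordinates that determines the elements of \<open>Z\<close>. Minimality provides for each \<open>p \<in> P\<close> a
nonzero element of \<open>Z\<close> that vanishes on the other coordinates in \<open>P\<close>; these elements span \<open>Z\<close>.\<close>

lemma dual_pivots:
  assumes Z: "fs.subspace Z" "Z \<subseteq> coord_space m"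
  obtains P z where "P \<subseteq> {..<m}" "fs.dim Z \<le> card P" "\<And>p. p \<in> P \<Longrightarrow> z p \<in> Z"
    "\<And>p p'. p \<in> P \<Longrightarrow> p' \<in> P \<Longrightarrow> z p p' = (if p' = p then 1 else 0)"
proof -
  define Q where "Q P \<longleftrightarrow> P \<subseteq> {..<m} \<and> (\<forall>f\<in>Z. (\<forall>i\<in>P. f i = 0) \<longrightarrow> f = 0)" for P
  have "f = 0" if "f \<in> Z" "\<forall>i\<in>{..<m}. f i = 0" for f
  proof
    fix i show "f i = 0 i" using that Z(2) by (cases "i < m") (auto simp: coord_space_def)
  qed
  then have "Q {..<m}" by (simp add: Q_def)
  then obtain P where P: "Q P" "\<And>P'. Q P' \<Longrightarrow> card P \<le> card P'"
    using ex_has_least_nat[of Q "{..<m}" card] by blast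
  have fP: "finite P" using P(1) finite_subset unfolding Q_def by blast
  have "\<exists>f\<in>Z. \<forall>i\<in>P. f i = (if i = p then 1 else 0)" if p: "p \<in> P" for p
  proof -
    have "\<not> Q (P - {p})" using P(2)[of "P - {p}"] p fP card_Diff1_less[OF fP p] by auto
    then obtain f where f: "f \<in> Z" "\<forall>i\<in>P - {p}. f i = 0" "f \<noteq> 0"
      using P(1) unfolding Q_def by blast
    have "f p \<noteq> 0" using P(1) f unfolding Q_def by blast
    moreover have "fscale (inverse (f p)) f \<in> Z" using f(1) fs.subspace_scale[OF Z(1)] by simp
    ultimately show ?thesis using f(2) by (intro bexI[of _ "fscale (inverse (f p)) f"]) (auto simp: fscale_def)
  qed
  then obtain z where z: "\<And>p. p \<in> P \<Longrightarrow> z p \<in> Z" "\<And>p p'. p \<in> P \<Longrightarrow> p' \<in> P \<Longrightarrow> z p p' = (if p' = p then 1 else 0)"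
    by metis
  have "Z \<subseteq> fs.span (z ` P)"
  proof
    fix f assume f: "f \<in> Z"
    let ?s = "\<Sum>p\<in>P. fscale (f p) (z p)"
    have sZ: "?s \<in> Z" using z(1) by (intro fs.subspace_sum fs.subspace_scale Z(1)) auto
    have "(f - ?s) i = 0" if i: "i \<in> P" for i
    proof -
      have "?s i = (\<Sum>p\<in>P. if p = i then f i else 0)"
        unfolding sum_fun_apply using z(2) i by (intro sum.cong) (auto simp: fscale_def)
      then show ?thesis using fP i by simp
    qed
    moreover have "f - ?s \<in> Z" using f sZ fs.subspace_diff[OF Z(1)] by simp
    ultimately have "f - ?s = 0" using P(1) unfolding Q_def by blast
    then have "f = ?s" by simp
    moreover have "?s \<in> fs.span (z ` P)" by (intro fs.span_sum fs.span_scale fs.span_base imageI)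
    ultimately show "f \<in> fs.span (z ` P)" by simp
  qed
  then have "fs.dim Z \<le> card (z ` P)" by (rule fs.dim_le_card) (use fP in simp)
  also have "\<dots> \<le> card P" using fP by (rule card_image_le)
  finally have dimZ: "fs.dim Z \<le> card P" .
  have "P \<subseteq> {..<m}" using P(1) by (simp add: Q_def)
  then show ?thesis using dimZ z by (rule that)
qed

text \<open>A homogeneous system with more unknowns than equations has a nontrivial solution.\<close>

lemma underdetermined_system:
  fixes M :: "'e \<Rightarrow> 'b \<Rightarrow> 'k::field"
  assumes fin: "finite X" "finite B" and less: "card B < card X"
  obtains c where "\<exists>e\<in>X. c e \<noteq> 0" "\<And>b. b \<in> B \<Longrightarrow> (\<Sum>e\<in>X. c e * M e b) = 0"
proof -
  obtain h where h: "bij_betw h {..<card B} B"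
    using ex_bij_betw_nat_finite[OF fin(2)] by (auto simp: atLeast0LessThan)
  define v where "v e = (\<lambda>i. if i < card B then M e (h i) else 0)" for e
  have vco: "v ` X \<subseteq> coord_space (card B)" by (auto simp: v_def coord_space_def)
  have "\<not> fs.indep_family X v"
  proof
    assume "fs.indep_family X v"
    then have i: "inj_on v X" "fs.independent (v ` X)" by (simp_all add: fs.indep_family_iff[OF fin(1)])
    then have "card X \<le> card B"
      using fs.independent_card_le[OF fin_dimensional_coord_space vco i(2)] by (simp add: card_image dim_coord_space)
    then show False using less by simp
  qed
  then obtain c where c: "(\<Sum>e\<in>X. fscale (c e) (v e)) = 0" "\<exists>e\<in>X. c e \<noteq> 0"
    unfolding fs.indep_family_def by blast
  show ?thesis
  proof (rule that[OF c(2)])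
    fix b assume "b \<in> B"
    then obtain i where i: "i < card B" "b = h i" using h by (auto simp: bij_betw_def)
    have "0 = (\<Sum>e\<in>X. fscale (c e) (v e)) i" using c(1) by simp
    then show "(\<Sum>e\<in>X. c e * M e b) = 0" using i by (simp add: sum_fun_apply fscale_def v_def)
  qed
qed

lemma card_filter_eq_sum: "finite E \<Longrightarrow> card {e\<in>E. Q e} = (\<Sum>e\<in>E. if Q e then 1 else 0)"
  by (simp add: sum.inter_filter[symmetric])

text \<open>Double counting: translation by \<open>e\<close> permutes the classes, so each \<open>e \<in> E\<close> meets \<open>P\<close> for exactly \<open>card P\<close> translates.\<close>

lemma sum_card_inter_translates:
  assumes p: "range p = {..<m}" "finite_congruence p" and y: "\<And>i. i < m \<Longrightarrow> p (y i) = i"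
    and E: "finite E" and P: "P \<subseteq> {..<m}"
  shows "(\<Sum>i<m. card {e\<in>E. p (e + y i) \<in> P}) = card E * card P"
proof -
  have one: "card {i\<in>{..<m}. p (e + y i) \<in> P} = card P" for e
  proof -
    let ?t = "\<lambda>i. p (e + y i)"
    have inj: "inj_on ?t {..<m}"
    proof (rule inj_onI)
      fix i j assume ij: "i \<in> {..<m}" "j \<in> {..<m}" "?t i = ?t j"
      have "p (- e + (e + y i)) = p (- e + (e + y j))" using finite_congruenceD(2)[OF p(2) ij(3)] .
      then show "i = j" using y ij by (simp flip: add.assoc)
    qed
    have "?t ` {..<m} \<subseteq> {..<m}" using p(1) by auto
    then have surj: "?t ` {..<m} = {..<m}" using inj by (simp add: endo_inj_surj)
    have "?t ` {i\<in>{..<m}. ?t i \<in> P} = P"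
    proof (rule subset_antisym)
      show "P \<subseteq> ?t ` {i\<in>{..<m}. ?t i \<in> P}"
      proof
        fix x assume x: "x \<in> P"
        then have "x \<in> ?t ` {..<m}" using surj P by auto
        then show "x \<in> ?t ` {i\<in>{..<m}. ?t i \<in> P}" using x by auto
      qed
    qed auto
    moreover have "inj_on ?t {i\<in>{..<m}. ?t i \<in> P}" using inj by (rule inj_on_subset) auto
    ultimately show ?thesis using card_image[of ?t "{i\<in>{..<m}. ?t i \<in> P}"] by (simp only:)
  qed
  have "(\<Sum>i<m. card {e\<in>E. p (e + y i) \<in> P}) = (\<Sum>i<m. \<Sum>e\<in>E. if p (e + y i) \<in> P then 1 else 0)"
    using E by (simp add: card_filter_eq_sum)
  also have "\<dots> = (\<Sum>e\<in>E. \<Sum>i<m. if p (e + y i) \<in> P then 1 else 0)" by (rule sum.swap)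
  also have "\<dots> = (\<Sum>e\<in>E. card {i\<in>{..<m}. p (e + y i) \<in> P})"
    unfolding card_filter_eq_sum[OF finite_lessThan] by (rule refl)
  also have "\<dots> = card E * card P" using one by simp
  finally show ?thesis .
qed

text \<open>A family of values on the pivots in the translate \<open>E + y\<close> extends to an element \<open>f\<close> of \<open>Z\<close>; let \<open>u f\<close> be its
restriction to the translate, viewed as a finitely supported function on \<open>E\<close>. Away from the boundary of \<open>E\<close> the
product \<open>a * u f\<close> vanishes, since it either coincides with the value of \<open>a\<close> on \<open>f\<close> or involves no point of \<open>E\<close>. If
there were more pivots than boundary points, then some nonzero choice of values would make \<open>a * u f\<close> vanish
on the boundary too, which contradicts the absence of zero divisors.\<close>

lemma card_pivots_in_translate_le:
  fixes a :: "'g::group_add \<Rightarrow>\<^sub>0 'k::field" and p :: "'g \<Rightarrow> nat"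
  assumes nzd: "\<And>x y :: 'g \<Rightarrow>\<^sub>0 'k. x * y = 0 \<Longrightarrow> x = 0 \<or> y = 0"
    and a: "a \<noteq> 0" "Poly_Mapping.keys a \<subseteq> F" and F: "finite F" and E: "finite E"
    and p: "finite_congruence p"
    and inj: "\<And>e e'. e \<in> E \<Longrightarrow> e' \<in> E \<Longrightarrow> e \<noteq> e' \<Longrightarrow> p (e - e') \<noteq> p 0"
    and Z: "fs.subspace Z" "\<And>f g. f \<in> Z \<Longrightarrow> convolve a (f \<circ> p) g = 0"
    and z: "\<And>i. i \<in> P \<Longrightarrow> z i \<in> Z" "\<And>i j. i \<in> P \<Longrightarrow> j \<in> P \<Longrightarrow> z i j = (if j = i then 1 else 0)"
  shows "card {e\<in>E. p (e + y) \<in> P} \<le> card (\<Union>h\<in>F. ((+) h ` E - E) \<union> (E - (+) h ` E))"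
proof (rule ccontr)
  let ?B = "\<Union>h\<in>F. ((+) h ` E - E) \<union> (E - (+) h ` E)"
  define X where "X = {e\<in>E. p (e + y) \<in> P}"
  assume "\<not> card {e\<in>E. p (e + y) \<in> P} \<le> card ?B"
  then have less: "card ?B < card X" by (simp add: X_def)
  have fX: "finite X" and fB: "finite ?B" using E F by (simp_all add: X_def)
  define u where "u f = (\<Sum>e\<in>E. Poly_Mapping.single e (f (p (e + y))))" for f :: "nat \<Rightarrow> 'k"
  have lu: "Poly_Mapping.lookup (u f) g = (if g \<in> E then f (p (g + y)) else 0)" for f g
  proof -
    have "Poly_Mapping.lookup (u f) g = (\<Sum>e\<in>E. if e = g then f (p (g + y)) else 0)"
      unfolding u_def lookup_sum by (rule sum.cong) (auto simp: lookup_single when_def)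
    then show ?thesis using E by simp
  qed
  obtain c where c: "\<exists>e\<in>X. c e \<noteq> 0"
    "\<And>b. b \<in> ?B \<Longrightarrow> (\<Sum>e\<in>X. c e * Poly_Mapping.lookup (a * u (z (p (e + y)))) b) = 0"
    using underdetermined_system[OF fX fB less, of "\<lambda>e b. Poly_Mapping.lookup (a * u (z (p (e + y)))) b"] by blast
  define f where "f = (\<Sum>e\<in>X. fscale (c e) (z (p (e + y))))"
  have fZ: "f \<in> Z" unfolding f_def using z(1) by (intro fs.subspace_sum fs.subspace_scale Z(1)) (auto simp: X_def)
  have fe: "f i = (\<Sum>e\<in>X. c e * z (p (e + y)) i)" for i by (simp add: f_def sum_fun_apply fscale_def)
  have "Poly_Mapping.lookup (a * u f) g = 0" for g
  proof (cases "g \<in> ?B")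
    case True
    have "Poly_Mapping.lookup (u f) x = (\<Sum>e\<in>X. c e * Poly_Mapping.lookup (u (z (p (e + y)))) x)" for x
      by (simp add: lu fe)
    then have "Poly_Mapping.lookup (a * u f) g =
        (\<Sum>h\<in>Poly_Mapping.keys a. \<Sum>e\<in>X. c e * (Poly_Mapping.lookup a h * Poly_Mapping.lookup (u (z (p (e + y)))) (- h + g)))"
      by (simp add: lookup_mult_eq_convolve convolve_def sum_distrib_left mult.left_commute)
    also have "\<dots> = (\<Sum>e\<in>X. c e * Poly_Mapping.lookup (a * u (z (p (e + y)))) g)"
      by (subst sum.swap) (simp add: lookup_mult_eq_convolve convolve_def sum_distrib_left)
    finally show ?thesis using c(2)[OF True] by simp
  next
    case False
    have mem: "x \<in> (+) h ` E \<longleftrightarrow> - h + x \<in> E" for h x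
      by (auto intro: rev_image_eqI[of "- h + x"])
    have F': "h \<in> F" if "h \<in> Poly_Mapping.keys a" for h using a(2) that by auto
    have inE: "- h + g \<in> E \<longleftrightarrow> g \<in> E" if "h \<in> Poly_Mapping.keys a" for h
      using False F'[OF that] unfolding mem[symmetric] by blast
    show ?thesis
    proof (cases "g \<in> E")
      case True
      have "Poly_Mapping.lookup (a * u f) g = (\<Sum>h\<in>Poly_Mapping.keys a. Poly_Mapping.lookup a h * f (p (- h + (g + y))))"
        unfolding lookup_mult_eq_convolve convolve_def
        by (rule sum.cong) (simp_all add: lu inE True add.assoc)
      also have "\<dots> = convolve a (f \<circ> p) (g + y)" by (simp add: convolve_def)
      finally show ?thesis using Z(2)[OF fZ] by simp
    next
      case False
      then show ?thesis
        unfolding lookup_mult_eq_convolve convolve_def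
        by (intro sum.neutral ballI) (simp add: lu inE)
    qed
  qed
  then have "a * u f = 0" by (intro poly_mapping_eqI) simp
  then have uf: "u f = 0" using nzd a(1) by blast
  have "c e = 0" if e: "e \<in> X" for e
  proof -
    have eE: "e \<in> E" "p (e + y) \<in> P" using e by (simp_all add: X_def)
    have d: "z (p (e' + y)) (p (e + y)) = (if e' = e then 1 else 0)" if e': "e' \<in> X" for e'
    proof (cases "e' = e")
      case False
      have e'E: "e' \<in> E" "p (e' + y) \<in> P" using e' by (simp_all add: X_def)
      have "p (e + y) \<noteq> p (e' + y)"
      proof
        assume "p (e + y) = p (e' + y)"
        then have "p (e + y + (- y - e')) = p (e' + y + (- y - e'))" by (rule finite_congruenceD(3)[OF p])
        then have "p (e - e') = p 0" by (simp add: add.assoc diff_conv_add_uminus del: add_uminus_conv_diff)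
        then show False using inj[OF eE(1) e'E(1)] False by simp
      qed
      then show ?thesis using z(2)[OF e'E(2) eE(2)] False by simp
    qed (simp add: z(2)[OF eE(2) eE(2)])
    have "0 = Poly_Mapping.lookup (u f) e" using uf by simp
    also have "\<dots> = (\<Sum>e'\<in>X. c e' * z (p (e' + y)) (p (e + y)))" by (simp add: lu eE(1) fe)
    also have "\<dots> = (\<Sum>e'\<in>X. if e' = e then c e' else 0)" using d by (intro sum.cong) auto
    also have "\<dots> = c e" using fX e by simp
    finally show ?thesis by simp
  qed
  then show False using c(1) by blast
qed

section \<open>Finite quotients of residually finite amenable groups\<close>

text \<open>The permutation representation on the classes, where \<open>y i\<close> is a representative of the class \<open>i\<close>.\<close>

lemma quotient_representation:
  fixes p :: "'g::group_add \<Rightarrow> nat"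
  assumes p: "range p = {..<m}" "finite_congruence p"
  obtains \<rho> :: "('g \<Rightarrow>\<^sub>0 'k::field) \<Rightarrow> 'k mat" where
    "K_algebra.matrix_representation group_algebra_scale m \<rho>"
    "\<And>a f g. f \<in> coord_space m \<Longrightarrow> mat_act (\<rho> a) f (p g) = convolve a (f \<circ> p) g"
proof -
  interpret ga: K_algebra "group_algebra_scale :: 'k \<Rightarrow> ('g \<Rightarrow>\<^sub>0 'k) \<Rightarrow> _" by (rule K_algebra_group_algebra)
  define y where "y i = (SOME g. p g = i)" for i
  have py: "p (y i) = i" if "i < m" for i
  proof -
    have "i \<in> range p" using p(1) that by simp
    then have "\<exists>g. p g = i" by auto
    then show ?thesis unfolding y_def by (rule someI_ex)
  qed
  have pm: "p g < m" for g using p(1) by auto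
  define A where "A a f = (\<lambda>i. if i < m then convolve a (f \<circ> p) (y i) else 0)" for a :: "'g \<Rightarrow>\<^sub>0 'k" and f
  have Ap: "A a f (p g) = convolve a (f \<circ> p) g" for a f g
  proof -
    have "p (y (p g)) = p g" using py[OF pm] .
    then have "p (- h + y (p g)) = p (- h + g)" for h by (rule finite_congruenceD(2)[OF p(2)])
    then show ?thesis by (simp add: A_def pm convolve_def)
  qed
  have Aco: "A a f \<in> coord_space m" for a f by (simp add: A_def coord_space_def)
  have Ac: "A a f \<circ> p = convolve a (f \<circ> p)" for a f by (rule ext) (simp add: Ap)
  have lin: "flinear (A a)" for a
  proof (rule flinearI)
    show "A a (f + g) = A a f + A a g" for f g
      using convolve_add_right[of a "f \<circ> p" "g \<circ> p"] by (auto simp: A_def fun_eq_iff comp_def)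
    show "A a (fscale c f) = fscale c (A a f)" for c f
      using convolve_scale_right[of a c "f \<circ> p"] by (auto simp: A_def fun_eq_iff comp_def fscale_def)
  qed
  define \<rho> where "\<rho> a = mat_of_linear m (A a)" for a
  have \<rho>c: "\<rho> a \<in> carrier_mat m m" for a by (simp add: \<rho>_def mat_of_linear_carrier)
  have act: "mat_act (\<rho> a) f = A a f" if "f \<in> coord_space m" for a f
    unfolding \<rho>_def using mat_act_mat_of_linear[OF lin _ that] Aco by blast
  have "\<rho> (a + b) = \<rho> a + \<rho> b" for a b
    by (rule mat_eq_if_mat_act_eq[OF \<rho>c add_carrier_mat[OF \<rho>c]])
      (simp add: act mat_act_add[OF \<rho>c \<rho>c] A_def convolve_add fun_eq_iff)
  moreover have "\<rho> (group_algebra_scale c a) = c \<cdot>\<^sub>m \<rho> a" for c a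
    by (rule mat_eq_if_mat_act_eq[OF \<rho>c smult_carrier_mat[OF \<rho>c]])
      (simp add: act mat_act_smult A_def convolve_scale fun_eq_iff fscale_def)
  moreover have "\<rho> (a * b) = \<rho> a * \<rho> b" for a b
  proof (rule mat_eq_if_mat_act_eq[OF \<rho>c mult_carrier_mat[OF \<rho>c \<rho>c]])
    fix f :: "nat \<Rightarrow> 'k" assume f: "f \<in> coord_space m"
    have "A (a * b) f = A a (A b f)"
      unfolding A_def[of "a * b"] A_def[of a] Ac convolve_mult[abs_def] by simp
    then show "mat_act (\<rho> (a * b)) f = mat_act (\<rho> a * \<rho> b) f"
      unfolding mat_act_mult[OF \<rho>c \<rho>c] using act[OF f] act[OF Aco] by simp
  qed
  ultimately have "ga.matrix_representation m \<rho>"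
    unfolding ga.matrix_representation_def ga.linear_to_mat_def using \<rho>c by blast
  then show ?thesis by (rule that) (simp add: act Ap)
qed

text \<open>The boundary of \<open>E\<close> relative to \<open>F\<close>, rather than its translates one at a time, is small compared with \<open>E\<close>.\<close>

lemma foelner_set:
  assumes am: "amenable_group (type_group TYPE('g::group_add))" and F: "finite (F :: 'g::group_add set)" and d: "d \<ge> 1"
  obtains E :: "'g::group_add set" where "finite E" "E \<noteq> {}"
    "d * card (\<Union>h\<in>F. ((+) h ` E - E) \<union> (E - (+) h ` E)) \<le> card E"
proof -
  define \<epsilon> where "\<epsilon> = 1 / (real d * (real (card F) + 1))"
  have \<epsilon>: "\<epsilon> > 0" using d by (simp add: \<epsilon>_def)
  have lc: "h <#\<^bsub>type_group TYPE('g::group_add)\<^esub> E = (+) h ` E" for h :: 'g and E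
    by (auto simp: l_coset_def type_group_def)
  have "\<exists>E. finite E \<and> E \<noteq> {} \<and> E \<subseteq> carrier (type_group TYPE('g::group_add)) \<and>
      (\<forall>h\<in>F. real (card (((+) h ` E - E) \<union> (E - (+) h ` E))) \<le> \<epsilon> * real (card E))"
    by (rule am[unfolded amenable_group_def lc, rule_format]) (use F \<epsilon> in \<open>simp add: type_group_def\<close>)
  then obtain E :: "'g set" where E: "finite E" "E \<noteq> {}"
    "\<forall>h\<in>F. real (card (((+) h ` E - E) \<union> (E - (+) h ` E))) \<le> \<epsilon> * real (card E)"
    by (elim exE conjE)
  have "real (card (\<Union>h\<in>F. ((+) h ` E - E) \<union> (E - (+) h ` E)))
      \<le> real (\<Sum>h\<in>F. card (((+) h ` E - E) \<union> (E - (+) h ` E)))"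
    using card_UN_le[OF F] by (simp only: of_nat_le_iff)
  also have "\<dots> \<le> (\<Sum>h\<in>F. \<epsilon> * real (card E))" unfolding of_nat_sum using E(3) by (intro sum_mono) blast
  also have "\<dots> = real (card F) * \<epsilon> * real (card E)" by simp
  finally have "real d * real (card (\<Union>h\<in>F. ((+) h ` E - E) \<union> (E - (+) h ` E)))
      \<le> real d * (real (card F) * \<epsilon> * real (card E))" by (intro mult_left_mono) auto
  also have "\<dots> = (real d * real (card F) * \<epsilon>) * real (card E)" by simp
  also have "\<dots> \<le> 1 * real (card E)"
    using d by (intro mult_right_mono) (simp_all add: \<epsilon>_def divide_simps)
  finally have "d * card (\<Union>h\<in>F. ((+) h ` E - E) \<union> (E - (+) h ` E)) \<le> card E"
    by (simp flip: of_nat_mult)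
  then show ?thesis by (rule that[OF E(1,2)])
qed

text \<open>The Foelner set \<open>E\<close> is fixed first; then the finite quotient is chosen so that \<open>E\<close> embeds into it.\<close>

lemma residually_finite_group_algebra_representation:
  assumes rf: "residually_finite (type_group TYPE('g::group_add))"
    and am: "amenable_group (type_group TYPE('g::group_add))"
    and nzd: "\<And>x y :: 'g::group_add \<Rightarrow>\<^sub>0 'k::field. x * y = 0 \<Longrightarrow> x = 0 \<or> y = 0"
    and F: "finite (F :: 'g::group_add set)" and d: "d \<ge> 1"
  obtains m and \<rho> :: "('g::group_add \<Rightarrow>\<^sub>0 'k::field) \<Rightarrow> 'k mat" where "m \<ge> 1"
    "K_algebra.matrix_representation group_algebra_scale m \<rho>"
    "\<And>a. a \<noteq> 0 \<Longrightarrow> Poly_Mapping.keys a \<subseteq> F \<Longrightarrow> fs.dim (null_space m (\<rho> a)) \<le> m div d"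
proof -
  obtain E :: "'g set" where E: "finite E" "E \<noteq> {}"
    "d * card (\<Union>h\<in>F. ((+) h ` E - E) \<union> (E - (+) h ` E)) \<le> card E"
    by (rule foelner_set[OF am F d])
  let ?B = "\<Union>h\<in>F. ((+) h ` E - E) \<union> (E - (+) h ` E)"
  define X where "X = (\<lambda>(e, e'). e - e') ` {(e, e') \<in> E \<times> E. e \<noteq> e'}"
  have "{(e, e') \<in> E \<times> E. e \<noteq> e'} \<subseteq> E \<times> E" by auto
  then have "finite X" unfolding X_def using E(1) by (meson finite_SigmaI finite_imageI finite_subset)
  moreover have "0 \<notin> X" by (auto simp: X_def)
  ultimately obtain p :: "'g \<Rightarrow> nat" and m where p: "range p = {..<m}" "finite_congruence p"
    and sep: "\<And>x. x \<in> X \<Longrightarrow> p x \<noteq> p 0"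
    using residually_finite_separates[OF rf] by metis
  have inj: "p (e - e') \<noteq> p 0" if "e \<in> E" "e' \<in> E" "e \<noteq> e'" for e e'
    by (rule sep) (use that in \<open>force simp: X_def\<close>)
  have m: "m \<ge> 1" using p(1) by (cases m) auto
  obtain \<rho> :: "('g \<Rightarrow>\<^sub>0 'k) \<Rightarrow> 'k mat" where \<rho>: "K_algebra.matrix_representation group_algebra_scale m \<rho>"
    and act: "\<And>a f g. f \<in> coord_space m \<Longrightarrow> mat_act (\<rho> a) f (p g) = convolve a (f \<circ> p) g"
    using quotient_representation[OF p] by blast
  have "fs.dim (null_space m (\<rho> a)) \<le> m div d" if a: "a \<noteq> 0" "Poly_Mapping.keys a \<subseteq> F" for a
  proof -
    let ?Z = "null_space m (\<rho> a)"
    obtain P z where P: "P \<subseteq> {..<m}" "fs.dim ?Z \<le> card P" and z: "\<And>i. i \<in> P \<Longrightarrow> z i \<in> ?Z"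
      "\<And>i j. i \<in> P \<Longrightarrow> j \<in> P \<Longrightarrow> z i j = (if j = i then 1 else 0)"
      using dual_pivots[OF subspace_null_space null_space_subset, of m "\<rho> a"] by metis
    have Z: "convolve a (f \<circ> p) g = 0" if "f \<in> ?Z" for f g
    proof -
      have "f \<in> coord_space m" "mat_act (\<rho> a) f = 0" using that by (simp_all add: null_space_def)
      then show ?thesis using act[of f a g] by simp
    qed
    define y where "y i = (SOME g. p g = i)" for i
    have y: "p (y i) = i" if "i < m" for i
    proof -
      have "i \<in> range p" using p(1) that by simp
      then have "\<exists>g. p g = i" by auto
      then show ?thesis unfolding y_def by (rule someI_ex)
    qed
    have "card E * card P = (\<Sum>i<m. card {e\<in>E. p (e + y i) \<in> P})"
      by (rule sum_card_inter_translates[OF p y E(1) P(1), symmetric])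
    also have "\<dots> \<le> (\<Sum>i<m. card ?B)"
      by (intro sum_mono card_pivots_in_translate_le[OF nzd a F E(1) p(2) inj subspace_null_space Z z])
    finally have "d * (card E * card P) \<le> d * (m * card ?B)" by simp
    also have "\<dots> = m * (d * card ?B)" by simp
    also have "\<dots> \<le> m * card E" using E(3) by (intro mult_le_mono2)
    finally have "card E * (card P * d) \<le> card E * m" by (simp add: mult.commute mult.left_commute)
    then have "card P * d \<le> m" using E(1,2) by (simp add: card_gt_0_iff)
    then have "card P \<le> m div d" using d by (simp add: less_eq_div_iff_mult_less_eq)
    then show ?thesis using P(2) by simp
  qed
  then show ?thesis by (rule that[OF m \<rho>])
qed

context K_algebra
begin

text \<open>The elements of the ball have their supports in one finite set, so a single finite quotient serves all of them.\<close>

lemma residually_finite_imp_representation: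
  fixes f :: "('g::group_add \<Rightarrow>\<^sub>0 'k) \<Rightarrow> 'a"
  assumes f: "algebra_iso group_algebra_scale scale f"
    and rf: "residually_finite (type_group TYPE('g::group_add))"
    and am: "amenable_group (type_group TYPE('g::group_add))"
    and nzd: "\<And>x y :: 'a. x * y = 0 \<Longrightarrow> x = 0 \<or> y = 0"
    and S: "finite S" and d: "d \<ge> 1"
  shows "\<exists>n\<ge>1. \<exists>\<psi>. matrix_representation n \<psi> \<and> d_approximation S d n \<psi>"
proof -
  interpret ga: K_algebra "group_algebra_scale :: 'k \<Rightarrow> ('g \<Rightarrow>\<^sub>0 'k) \<Rightarrow> _" by (rule K_algebra_group_algebra)
  have bij: "bij f" and add: "\<And>x y. f (x + y) = f x + f y"
    and sc: "\<And>c x. f (group_algebra_scale c x) = scale c (f x)"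
    and mul: "\<And>x y. f (x * y) = f x * f y"
    using f by (simp_all add: algebra_iso_def)
  have f0: "f 0 = 0" using add[of 0 0] by simp
  have inj: "f x = f y \<longleftrightarrow> x = y" for x y using bij by (simp add: bij_is_inj inj_eq)
  define k where "k = inv_into UNIV f"
  have fk: "f (k x) = x" for x using bij by (simp add: k_def bij_is_surj surj_f_inv_f)
  have k_eq: "k x = y \<longleftrightarrow> x = f y" for x y using fk inj by metis
  have k_add: "k (x + y) = k x + k y" and k_sc: "k (scale c x) = group_algebra_scale c (k x)"
    and k_mul: "k (x * y) = k x * k y" for x y c
    by (simp_all add: k_eq add sc mul fk)
  have k0: "k x = 0 \<longleftrightarrow> x = 0" for x by (simp add: k_eq f0)
  have nzd': "x = 0 \<or> y = 0" if "x * y = 0" for x y :: "'g \<Rightarrow>\<^sub>0 'k"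
  proof -
    have "f x * f y = 0" using that mul[of x y] f0 by simp
    then have "f x = 0 \<or> f y = 0" by (rule nzd)
    then show ?thesis using inj[of _ 0] f0 by auto
  qed
  define F where "F = (\<Union>s\<in>monomials S d. Poly_Mapping.keys (k s))"
  have F: "finite F" unfolding F_def using finite_monomials[OF S] by simp
  have kF: "Poly_Mapping.keys (k a) \<subseteq> F" if "a \<in> A_le S d" for a
    using that unfolding A_le_def
  proof (induction rule: span_induct_alt)
    case base
    have "k 0 = 0" using k0[of 0] by simp
    then show ?case by simp
  next
    case (step c x y)
    have "Poly_Mapping.keys (k (scale c x)) \<subseteq> Poly_Mapping.keys (k x)"
      by (auto simp: k_sc in_keys_iff lookup_group_algebra_scale)
    also have "\<dots> \<subseteq> F" using step(1) by (auto simp: F_def)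
    finally show ?case using step(2) keys_add[of "k (scale c x)" "k y"] by (simp add: k_add) blast
  qed
  obtain m and \<rho> :: "('g \<Rightarrow>\<^sub>0 'k) \<Rightarrow> 'k mat" where m: "m \<ge> 1" and \<rho>: "ga.matrix_representation m \<rho>"
    and ker: "\<And>a. a \<noteq> 0 \<Longrightarrow> Poly_Mapping.keys a \<subseteq> F \<Longrightarrow> fs.dim (null_space m (\<rho> a)) \<le> m div d"
    using residually_finite_group_algebra_representation[OF rf am nzd' F d] by metis
  have \<psi>: "matrix_representation m (\<lambda>a. \<rho> (k a))"
    using \<rho> unfolding matrix_representation_def ga.matrix_representation_def linear_to_mat_def ga.linear_to_mat_def
    by (simp add: k_add k_sc k_mul)
  have "d_approximation S d m (\<lambda>a. \<rho> (k a))"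
    by (rule representation_is_approximation[OF \<psi> m d]) (simp add: ker k0 kF)
  then show ?thesis using m \<psi> by blast
qed

end

section \<open>Rings with enough finite prime quotients\<close>

definition field_subring :: "'k::field set \<Rightarrow> bool" where
  "field_subring R \<longleftrightarrow> 1 \<in> R \<and> (\<forall>x\<in>R. \<forall>y\<in>R. x - y \<in> R \<and> x * y \<in> R)"

text \<open>Rings, ideals and quotients are all kept inside one field: subrings and ideals are subsets, and a finite quotient
appears as a finite set of representatives.\<close>

definition ideal_of :: "'k::field set \<Rightarrow> 'k set \<Rightarrow> bool" where
  "ideal_of R I \<longleftrightarrow> I \<subseteq> R \<and> 0 \<in> I \<and> (\<forall>x\<in>I. \<forall>y\<in>I. x + y \<in> I) \<and> (\<forall>x\<in>R. \<forall>y\<in>I. x * y \<in> I)"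

definition prime_of :: "'k::field set \<Rightarrow> 'k set \<Rightarrow> bool" where
  "prime_of R P \<longleftrightarrow> ideal_of R P \<and> 1 \<notin> P \<and> (\<forall>x\<in>R. \<forall>y\<in>R. x * y \<in> P \<longrightarrow> x \<in> P \<or> y \<in> P)"

definition finite_index :: "'k::field set \<Rightarrow> 'k set \<Rightarrow> bool" where
  "finite_index R I \<longleftrightarrow> (\<exists>T. finite T \<and> T \<subseteq> R \<and> (\<forall>x\<in>R. \<exists>t\<in>T. x - t \<in> I))"

definition finite_prime_avoids :: "'k::field set \<Rightarrow> 'k \<Rightarrow> bool" where
  "finite_prime_avoids R r \<longleftrightarrow> (\<exists>P. prime_of R P \<and> finite_index R P \<and> r \<notin> P)"

text \<open>The prime ideals of finite index have intersection \<open>0\<close>. Primes are used rather than arbitrary ideals of finite index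
because a prime that avoids \<open>c\<close> survives the inversion of \<open>c\<close>.\<close>

definition finitely_separated :: "'k::field set \<Rightarrow> bool" where
  "finitely_separated R \<longleftrightarrow> (\<forall>r\<in>R. r \<noteq> 0 \<longrightarrow> finite_prime_avoids R r)"

lemma field_subringD:
  assumes "field_subring R"
  shows "1 \<in> R" "0 \<in> R" "x \<in> R \<Longrightarrow> y \<in> R \<Longrightarrow> x - y \<in> R" "x \<in> R \<Longrightarrow> y \<in> R \<Longrightarrow> x + y \<in> R"
    "x \<in> R \<Longrightarrow> y \<in> R \<Longrightarrow> x * y \<in> R" "x \<in> R \<Longrightarrow> - x \<in> R" "x \<in> R \<Longrightarrow> x ^ n \<in> R"
    "(\<And>i. i \<in> A \<Longrightarrow> F i \<in> R) \<Longrightarrow> sum F A \<in> R"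
proof -
  show 1: "1 \<in> R" and m: "x \<in> R \<Longrightarrow> y \<in> R \<Longrightarrow> x - y \<in> R" and t: "x \<in> R \<Longrightarrow> y \<in> R \<Longrightarrow> x * y \<in> R" for x y
    using assms by (auto simp: field_subring_def)
  show 0: "0 \<in> R" using m[OF 1 1] by simp
  show n: "x \<in> R \<Longrightarrow> - x \<in> R" for x using m[OF 0, of x] by simp
  show a: "x \<in> R \<Longrightarrow> y \<in> R \<Longrightarrow> x + y \<in> R" for x y using m[of x "- y"] n[of y] by simp
  show "x \<in> R \<Longrightarrow> x ^ n \<in> R" by (induction n) (auto intro: 1 t)
  show "(\<And>i. i \<in> A \<Longrightarrow> F i \<in> R) \<Longrightarrow> sum F A \<in> R"
    by (induction A rule: infinite_finite_induct) (auto intro: 0 a)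
qed

lemma ideal_ofD:
  assumes "ideal_of R I" "field_subring R"
  shows "I \<subseteq> R" "0 \<in> I" "x \<in> I \<Longrightarrow> y \<in> I \<Longrightarrow> x + y \<in> I" "x \<in> R \<Longrightarrow> y \<in> I \<Longrightarrow> x * y \<in> I"
    "x \<in> R \<Longrightarrow> y \<in> I \<Longrightarrow> y * x \<in> I" "x \<in> I \<Longrightarrow> - x \<in> I" "x \<in> I \<Longrightarrow> y \<in> I \<Longrightarrow> x - y \<in> I"
    "(\<And>i. i \<in> A \<Longrightarrow> F i \<in> I) \<Longrightarrow> sum F A \<in> I"
proof -
  show "I \<subseteq> R" and 0: "0 \<in> I" and a: "x \<in> I \<Longrightarrow> y \<in> I \<Longrightarrow> x + y \<in> I" and t: "x \<in> R \<Longrightarrow> y \<in> I \<Longrightarrow> x * y \<in> I" for x y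
    using assms(1) by (auto simp: ideal_of_def)
  show "x \<in> R \<Longrightarrow> y \<in> I \<Longrightarrow> y * x \<in> I" for x y using t[of x y] by (simp add: mult.commute)
  have "- 1 \<in> R" using field_subringD(1,6)[OF assms(2)] by blast
  then show n: "x \<in> I \<Longrightarrow> - x \<in> I" for x using t[of "- 1" x] by simp
  show "x \<in> I \<Longrightarrow> y \<in> I \<Longrightarrow> x - y \<in> I" for x y using a[of x "- y"] n[of y] by simp
  show "(\<And>i. i \<in> A \<Longrightarrow> F i \<in> I) \<Longrightarrow> sum F A \<in> I"
    by (induction A rule: infinite_finite_induct) (auto intro: 0 a)
qed

lemma prime_of_power:
  assumes "prime_of R P" "field_subring R" "x \<in> R" "x ^ n \<in> P"
  shows "x \<in> P"
  using assms(4)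
proof (induction n)
  case 0
  then show ?case using assms(1) by (simp add: prime_of_def)
next
  case (Suc n)
  have "x \<in> P \<or> x ^ n \<in> P"
    using Suc.prems assms(1,3) field_subringD(7)[OF assms(2,3)] unfolding prime_of_def by simp
  then show ?case using Suc.IH by blast
qed

text \<open>Only finitely many ideals lie between \<open>I\<close> and \<open>R\<close>, because each is determined by the representatives it
contains. An ideal that is maximal among those without powers of \<open>r\<close> is prime.\<close>

lemma prime_above:
  assumes R: "field_subring R" and I: "ideal_of R I" and fin: "finite_index R I"
    and r: "r \<in> R" "\<And>n. r ^ n \<notin> I"
  shows "finite_prime_avoids R r"
proof -
  obtain T where T: "finite T" "T \<subseteq> R" "\<And>x. x \<in> R \<Longrightarrow> \<exists>t\<in>T. x - t \<in> I"
    using fin unfolding finite_index_def by blast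
  define \<F> where "\<F> = {J. ideal_of R J \<and> I \<subseteq> J \<and> (\<forall>n. r ^ n \<notin> J)}"
  have sub: "J \<subseteq> J'" if J: "J \<in> \<F>" "J' \<in> \<F>" "J \<inter> T = J' \<inter> T" for J J'
  proof
    fix x assume x: "x \<in> J"
    have iJ: "ideal_of R J" "ideal_of R J'" "I \<subseteq> J" "I \<subseteq> J'" using J by (auto simp: \<F>_def)
    have "x \<in> R" using x ideal_ofD(1)[OF iJ(1) R] by blast
    then obtain t where t: "t \<in> T" "x - t \<in> I" using T(3) by blast
    have "x - (x - t) \<in> J" using ideal_ofD(7)[OF iJ(1) R x] t(2) iJ(3) by blast
    then have "t \<in> J'" using t(1) J(3) by auto
    then have "(x - t) + t \<in> J'" using ideal_ofD(3)[OF iJ(2) R] t(2) iJ(4) by blast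
    then show "x \<in> J'" by simp
  qed
  have "inj_on (\<lambda>J. J \<inter> T) \<F>" 
  proof (rule inj_onI)
    fix J J' assume J: "J \<in> \<F>" "J' \<in> \<F>" "J \<inter> T = J' \<inter> T"
    show "J = J'" by (rule subset_antisym[OF sub[OF J] sub[OF J(2,1) J(3)[symmetric]]])
  qed
  moreover have "finite ((\<lambda>J. J \<inter> T) ` \<F>)" by (rule finite_subset[of _ "Pow T"]) (use T(1) in auto)
  ultimately have "finite \<F>" by (rule finite_imageD[rotated])
  moreover have "I \<in> \<F>" using I r(2) by (simp add: \<F>_def)
  ultimately have "\<exists>J\<in>\<F>. I \<subseteq> J \<and> (\<forall>J'\<in>\<F>. J \<subseteq> J' \<longrightarrow> J = J')" by (rule finite_has_maximal2)
  then obtain J where J: "J \<in> \<F>" "\<forall>J'\<in>\<F>. J \<subseteq> J' \<longrightarrow> J = J'" by (elim bexE conjE)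
  have iJ: "ideal_of R J" "I \<subseteq> J" "\<And>n. r ^ n \<notin> J" using J(1) by (auto simp: \<F>_def)
  note D = ideal_ofD[OF iJ(1) R] and S = field_subringD[OF R]
  have grow: "\<exists>n. \<exists>j\<in>J. \<exists>s\<in>R. r ^ n = j + x * s" if x: "x \<in> R" "x \<notin> J" for x
  proof -
    define J' where "J' = {j + x * s | j s. j \<in> J \<and> s \<in> R}"
    have mem: "j + x * s \<in> J'" if "j \<in> J" "s \<in> R" for j s using that unfolding J'_def by blast
    have iJ': "ideal_of R J'"
      unfolding ideal_of_def
    proof (intro conjI ballI)
      show "J' \<subseteq> R" using D(1) x(1) by (auto simp: J'_def intro!: S(4,5))
      show "0 \<in> J'" using mem[OF D(2) S(2)] by simp
      fix u v assume "u \<in> J'" "v \<in> J'"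
      then obtain j s j' s' where *: "u = j + x * s" "v = j' + x * s'" "j \<in> J" "j' \<in> J" "s \<in> R" "s' \<in> R"
        unfolding J'_def by blast
      have "u + v = (j + j') + x * (s + s')" by (simp add: *(1,2) algebra_simps)
      then show "u + v \<in> J'" using mem[OF D(3)[OF *(3,4)] S(4)[OF *(5,6)]] by (simp only:)
    next
      fix w v assume w: "w \<in> R" and "v \<in> J'"
      then obtain j' s' where *: "v = j' + x * s'" "j' \<in> J" "s' \<in> R" unfolding J'_def by blast
      have "w * v = w * j' + x * (w * s')" by (simp add: *(1) algebra_simps)
      then show "w * v \<in> J'" using mem[OF D(4)[OF w *(2)] S(5)[OF w *(3)]] by (simp only:)
    qed
    have "J \<subseteq> J'"
    proof
      fix j assume "j \<in> J"
      then show "j \<in> J'" using mem[of j 0] S(2) by simp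
    qed
    moreover have "x \<in> J'" using mem[OF D(2) S(1)] by simp
    ultimately have "J' \<notin> \<F>" using J(2) x(2) by blast
    then obtain n where "r ^ n \<in> J'" using iJ' \<open>J \<subseteq> J'\<close> iJ(2) by (auto simp: \<F>_def)
    then show ?thesis unfolding J'_def by blast
  qed
  have "x \<in> J \<or> y \<in> J" if xy: "x \<in> R" "y \<in> R" "x * y \<in> J" for x y
  proof (rule ccontr)
    assume "\<not> (x \<in> J \<or> y \<in> J)"
    then obtain a j s b j' s' where e: "j \<in> J" "s \<in> R" "r ^ a = j + x * s" "j' \<in> J" "s' \<in> R" "r ^ b = j' + y * s'"
      using grow xy by meson
    have "r ^ (a + b) = j * (j' + y * s') + j' * (x * s) + (x * y) * (s * s')"
      unfolding power_add e(3,6) by (simp add: algebra_simps)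
    moreover have "j' \<in> R" using e(4) D(1) by blast
    then have "j * (j' + y * s') + j' * (x * s) + (x * y) * (s * s') \<in> J"
      using D(3)[OF D(3)[OF D(5)[OF S(4)[OF _ S(5)[OF xy(2) e(5)]] e(1)] D(5)[OF S(5)[OF xy(1) e(2)] e(4)]]
          D(5)[OF S(5)[OF e(2,5)] xy(3)]] by blast
    ultimately show False using iJ(3)[of "a + b"] by simp
  qed
  moreover have "1 \<notin> J" using iJ(3)[of 0] by simp
  ultimately have "prime_of R J" unfolding prime_of_def using iJ(1) by blast
  moreover have "finite_index R J" 
    unfolding finite_index_def
  proof (intro exI[of _ T] conjI ballI)
    fix x assume "x \<in> R"
    then obtain t where "t \<in> T" "x - t \<in> I" using T(3) by blast
    then show "\<exists>t\<in>T. x - t \<in> J" using iJ(2) by blast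
  qed (rule T(1), rule T(2))
  moreover have "r \<notin> J" using iJ(3)[of 1] by simp
  ultimately show ?thesis unfolding finite_prime_avoids_def by blast
qed

lemma finite_prime_avoids_subring:
  assumes R: "field_subring R" "field_subring R'" "R \<subseteq> R'" and r: "finite_prime_avoids R' r"
  shows "finite_prime_avoids R r"
proof -
  obtain P where P: "prime_of R' P" "finite_index R' P" "r \<notin> P" using r unfolding finite_prime_avoids_def by blast
  have iP: "ideal_of R' P" using P(1) by (simp add: prime_of_def)
  note D = ideal_ofD[OF iP R(2)]
  obtain T where T: "finite T" "\<And>x. x \<in> R' \<Longrightarrow> \<exists>t\<in>T. x - t \<in> P" using P(2) unfolding finite_index_def by blast
  define h where "h t = (if \<exists>x\<in>R. x - t \<in> P then SOME x. x \<in> R \<and> x - t \<in> P else 0)" for t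
  have h: "h t \<in> R \<and> h t - t \<in> P" if "\<exists>x\<in>R. x - t \<in> P" for t
  proof -
    have "\<exists>x. x \<in> R \<and> x - t \<in> P" using that by blast
    then have "(SOME x. x \<in> R \<and> x - t \<in> P) \<in> R \<and> (SOME x. x \<in> R \<and> x - t \<in> P) - t \<in> P" by (rule someI_ex)
    moreover have "h t = (SOME x. x \<in> R \<and> x - t \<in> P)" unfolding h_def using that by (rule if_P)
    ultimately show ?thesis by (simp only:)
  qed
  have hR: "h t \<in> R" for t using h field_subringD(2)[OF R(1)] by (cases "\<exists>x\<in>R. x - t \<in> P") (auto simp: h_def)
  have "finite_index R (P \<inter> R)"
    unfolding finite_index_def
  proof (intro exI[of _ "h ` T"] conjI ballI)
    fix x assume x: "x \<in> R"
    then obtain t where t: "t \<in> T" "x - t \<in> P" using T(2) R(3) by blast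
    then have "h t - t \<in> P" using h x by blast
    then have "(x - t) - (h t - t) \<in> P" using D(7) t(2) by blast
    then show "\<exists>t\<in>h ` T. x - t \<in> P \<inter> R" using t(1) field_subringD(3)[OF R(1) x hR] by auto
  qed (use T(1) hR in auto)
  moreover have "prime_of R (P \<inter> R)"
    unfolding prime_of_def ideal_of_def
  proof (intro conjI ballI impI)
    fix x y assume xy: "x \<in> R" "y \<in> R" "x * y \<in> P \<inter> R"
    then show "x \<in> P \<inter> R \<or> y \<in> P \<inter> R" using P(1) R(3) unfolding prime_of_def by blast
  qed (use P(1) R(3) D(2,3,4) field_subringD(2,4,5)[OF R(1)] in \<open>auto simp: prime_of_def\<close>)
  ultimately show ?thesis unfolding finite_prime_avoids_def using P(3) by blast
qed

text \<open>Two powers of \<open>c\<close> agree modulo \<open>P\<close> by the pigeonhole principle, so \<open>1 - c ^ n \<in> P\<close> for some \<open>n > 0\<close>.\<close>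

lemma inverse_mod_prime:
  assumes R: "field_subring R" and P: "prime_of R P" "finite_index R P" and c: "c \<in> R" "c \<notin> P"
  shows "\<exists>c'\<in>R. c * c' - 1 \<in> P"
proof -
  have iP: "ideal_of R P" using P(1) by (simp add: prime_of_def)
  note D = ideal_ofD[OF iP R] and S = field_subringD[OF R]
  obtain T where T: "finite T" "\<And>x. x \<in> R \<Longrightarrow> \<exists>t\<in>T. x - t \<in> P" using P(2) unfolding finite_index_def by blast
  have "\<forall>i. \<exists>t\<in>T. c ^ i - t \<in> P" using T(2) S(7)[OF c(1)] by blast
  then obtain t where t: "\<And>i. t i \<in> T" "\<And>i. c ^ i - t i \<in> P" by metis
  have "finite (range t)" by (rule finite_subset[OF _ T(1)]) (use t(1) in auto)
  then have "\<not> inj t" using finite_imageD[of t UNIV] by auto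
  then obtain i j where ij: "i < j" "t i = t j" unfolding inj_def by (metis linorder_neqE_nat)
  have "(c ^ i - t i) - (c ^ j - t j) \<in> P" using D(7) t(2) by blast
  moreover have "(c ^ i - t i) - (c ^ j - t j) = c ^ i * (1 - c ^ (j - i))"
    using ij by (simp add: algebra_simps flip: power_add)
  ultimately have "c ^ i * (1 - c ^ (j - i)) \<in> P" by simp
  moreover have "c ^ i \<notin> P" using prime_of_power[OF P(1) R c(1)] c(2) by blast
  moreover have "c ^ i \<in> R" "1 - c ^ (j - i) \<in> R" using S(1,3,7) c(1) by blast+
  ultimately have "1 - c ^ (j - i) \<in> P" using P(1) unfolding prime_of_def by blast
  then have "- (1 - c ^ (j - i)) \<in> P" by (rule D(6))
  moreover obtain k where "j - i = Suc k" using ij(1) by (metis Suc_diff_Suc)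
  ultimately show ?thesis using S(7)[OF c(1), of k] by (intro bexI[of _ "c ^ k"]) simp_all
qed

lemma field_subring_of_int: "field_subring (range of_int :: 'k::field set)"
  unfolding field_subring_def
proof (intro conjI ballI)
  show "(1 :: 'k) \<in> range of_int" by (rule range_eqI[of _ _ 1]) simp
  fix x y :: 'k assume "x \<in> range of_int" "y \<in> range of_int"
  then obtain a b where "x = of_int a" "y = of_int b" by auto
  then show "x - y \<in> range of_int" "x * y \<in> range of_int"
    using range_eqI[of "x - y" of_int "a - b"] range_eqI[of "x * y" of_int "a * b"] by simp_all
qed

text \<open>The prime field, or the integers. In characteristic zero a nonzero integer is not divisible by any larger prime.\<close>

lemma finitely_separated_of_int: "finitely_separated (range of_int :: 'k::field set)"
  unfolding finitely_separated_def
proof (intro ballI impI)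
  fix r :: 'k assume rR: "r \<in> range of_int" and r0: "r \<noteq> 0"
  then obtain z where z: "r = of_int z" by auto
  show "finite_prime_avoids (range of_int) r"
  proof (cases "\<exists>q>0. of_int q = (0 :: 'k)")
    case True
    then obtain q :: int where q: "q > 0" "of_int q = (0 :: 'k)" by (elim exE conjE)
    have "of_int x = (of_int (x mod q) :: 'k)" for x
    proof -
      have "(of_int x :: 'k) = of_int (q * (x div q) + x mod q)" by simp
      then show ?thesis using q(2) by (simp only: of_int_add of_int_mult)  simp
    qed
    then have "range of_int \<subseteq> (of_int ` {0..<q} :: 'k set)" using q(1) by fastforce
    then have "finite (range of_int :: 'k set)" using finite_subset by blast
    then have "finite_index (range of_int) {0 :: 'k}"
      unfolding finite_index_def by (intro exI[of _ "range of_int"]) auto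
    moreover have "ideal_of (range of_int) {0 :: 'k}"
      using field_subringD(2)[OF field_subring_of_int] by (simp add: ideal_of_def)
    ultimately show ?thesis using prime_above[OF field_subring_of_int _ _ rR] r0 by simp
  next
    case False
    have inj: "a = b" if "of_int a = (of_int b :: 'k)" for a b
    proof (rule ccontr)
      assume "a \<noteq> b"
      then have "of_int \<bar>a - b\<bar> = (0 :: 'k) \<and> \<bar>a - b\<bar> > 0" using that by (auto simp: abs_if)
      then have "\<exists>q>0. of_int q = (0 :: 'k)" by (intro exI[of _ "\<bar>a - b\<bar>"]) (simp only: conj_commute)
      with False show False by (rule notE)
    qed
    have z0: "z \<noteq> 0" using r0 z by auto
    obtain p :: nat where p: "prime p" "nat \<bar>z\<bar> < p" using bigger_prime by blast
    have pz: "\<not> int p dvd z ^ n" for n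
    proof
      assume "int p dvd z ^ n"
      then have "int p dvd z" using p(1) prime_dvd_power by (metis prime_nat_int_transfer)
      then have "int p \<le> \<bar>z\<bar>" using dvd_imp_le_int[OF z0, of "int p"] by simp
      then show False using p(2) by linarith
    qed
    define I :: "'k set" where "I = {of_int (int p * k) | k. True}"
    have I: "ideal_of (range of_int) (I :: 'k set)"
      unfolding ideal_of_def
    proof (intro conjI ballI)
      show "I \<subseteq> range of_int" by (auto simp: I_def simp del: of_int_mult)
      show "0 \<in> I" unfolding I_def by (intro CollectI exI[of _ 0]) simp
      fix x y :: 'k assume "x \<in> I" "y \<in> I"
      then obtain a b where "x = of_int (int p * a)" "y = of_int (int p * b)" unfolding I_def by blast
      then show "x + y \<in> I" unfolding I_def by (intro CollectI exI[of _ "a + b"]) (simp add: distrib_left)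
    next
      fix x y :: 'k assume "x \<in> range of_int" "y \<in> I"
      then obtain a b where "x = of_int a" "y = of_int (int p * b)" unfolding I_def by blast
      then show "x * y \<in> I" unfolding I_def by (intro CollectI exI[of _ "a * b"]) (simp add: mult.left_commute)
    qed
    have "finite_index (range of_int) (I :: 'k set)"
      unfolding finite_index_def
    proof (intro exI[of _ "of_int ` {0..<int p}"] conjI ballI)
      fix x :: 'k assume "x \<in> range of_int"
      then obtain a where a: "x = of_int a" by auto
      have "x - of_int (a mod int p) = of_int (int p * (a div int p))"
        unfolding a by (simp only: minus_mod_eq_mult_div flip: of_int_diff)
      then have "x - of_int (a mod int p) \<in> I" unfolding I_def by blast
      moreover have "a mod int p \<in> {0..<int p}" using p(2) by auto
      ultimately show "\<exists>t\<in>of_int ` {0..<int p}. x - t \<in> I" by blast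
    qed auto
    moreover have "r ^ n \<notin> I" for n
    proof
      assume "r ^ n \<in> I"
      then obtain k where "of_int (z ^ n) = (of_int (int p * k) :: 'k)" unfolding I_def z by (auto simp del: of_int_mult)
      then have "z ^ n = int p * k" by (rule inj)
      then show False using pz[of n] by simp
    qed
    ultimately show ?thesis using prime_above[OF field_subring_of_int I _ rR] by blast
  qed
qed

definition localization :: "'k::field set \<Rightarrow> 'k \<Rightarrow> 'k set" where
  "localization R c = {x / c ^ n | x n. x \<in> R}"

lemma localization_subring:
  assumes R: "field_subring R" and c: "c \<in> R" "c \<noteq> 0"
  shows "field_subring (localization R c)" "R \<subseteq> localization R c" "inverse c \<in> localization R c"
proof -
  note S = field_subringD[OF R]
  show "R \<subseteq> localization R c"
  proof
    fix x assume "x \<in> R"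
    then show "x \<in> localization R c" unfolding localization_def by (intro CollectI exI[of _ x] exI[of _ 0]) simp
  qed
  then have 1: "1 \<in> localization R c" using S(1) by blast
  show "inverse c \<in> localization R c" unfolding localization_def using S(1)
    by (intro CollectI exI[of _ 1] exI[of _ "1::nat"]) (simp add: inverse_eq_divide)
  have "x - y \<in> localization R c \<and> x * y \<in> localization R c" if xy: "x \<in> localization R c" "y \<in> localization R c" for x y
  proof -
    obtain a n b k where ab: "x = a / c ^ n" "y = b / c ^ k" "a \<in> R" "b \<in> R"
      using xy unfolding localization_def by blast
    have "x - y = (a * c ^ k - b * c ^ n) / c ^ (n + k)" using c(2) by (simp add: ab power_add diff_divide_distrib)
    moreover have "a * c ^ k - b * c ^ n \<in> R" using ab c(1) by (intro S(3) S(5) S(7))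
    moreover have "x * y = (a * b) / c ^ (n + k)" by (simp add: ab power_add)
    moreover have "a * b \<in> R" using ab by (intro S(5))
    ultimately show ?thesis unfolding localization_def by blast
  qed
  then show "field_subring (localization R c)" using 1 by (simp add: field_subring_def)
qed

text \<open>For \<open>r = x / c ^ n\<close> a prime that avoids \<open>x * c\<close> extends to the localization, where \<open>c\<close> is already invertible modulo
the prime, so that no new residue classes arise.\<close>

lemma finitely_separated_localization:
  assumes R: "field_subring R" "finitely_separated R" and c: "c \<in> R" "c \<noteq> 0"
  shows "finitely_separated (localization R c)"
  unfolding finitely_separated_def
proof (intro ballI impI)
  note S = field_subringD[OF R(1)] and L = localization_subring[OF R(1) c]
  fix r assume rL: "r \<in> localization R c" and r0: "r \<noteq> 0"
  then obtain x n where x: "r = x / c ^ n" "x \<in> R" unfolding localization_def by blast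
  have "x * c \<noteq> 0" using x(1) r0 c(2) by auto
  then obtain P where P: "prime_of R P" "finite_index R P" "x * c \<notin> P"
    using R(2) S(5)[OF x(2) c(1)] unfolding finitely_separated_def finite_prime_avoids_def by blast
  have iP: "ideal_of R P" using P(1) by (simp add: prime_of_def)
  note D = ideal_ofD[OF iP R(1)]
  have xP: "x \<notin> P" "c \<notin> P" using P(3) D(4,5) x(2) c(1) by blast+
  obtain c' where c': "c' \<in> R" "c * c' - 1 \<in> P" using inverse_mod_prime[OF R(1) P(1,2) c(1) xP(2)] by blast
  obtain T where T: "finite T" "T \<subseteq> R" "\<And>x. x \<in> R \<Longrightarrow> \<exists>t\<in>T. x - t \<in> P" using P(2) unfolding finite_index_def by blast
  define J where "J = localization P c"
  have J: "ideal_of (localization R c) J"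
    unfolding ideal_of_def
  proof (intro conjI ballI)
    show "J \<subseteq> localization R c" using D(1) by (auto simp: J_def localization_def)
    show "0 \<in> J" unfolding J_def localization_def using D(2) by force
    fix u v assume "u \<in> J" "v \<in> J"
    then obtain a n b k where ab: "u = a / c ^ n" "v = b / c ^ k" "a \<in> P" "b \<in> P"
      unfolding J_def localization_def by blast
    have "u + v = (a * c ^ k + b * c ^ n) / c ^ (n + k)" using c(2) by (simp add: ab power_add add_divide_distrib)
    moreover have "a * c ^ k + b * c ^ n \<in> P" using ab c(1) by (intro D(3) D(5) S(7))
    ultimately show "u + v \<in> J" unfolding J_def localization_def by blast
  next
    fix u v assume "u \<in> localization R c" "v \<in> J"
    then obtain a n b k where ab: "u = a / c ^ n" "v = b / c ^ k" "a \<in> R" "b \<in> P"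
      unfolding J_def localization_def by blast
    have "u * v = (a * b) / c ^ (n + k)" by (simp add: ab power_add)
    moreover have "a * b \<in> P" using ab by (intro D(4))
    ultimately show "u * v \<in> J" unfolding J_def localization_def by blast
  qed
  have cn: "(c * c') ^ n - 1 \<in> P" for n
  proof (induction n)
    case 0 then show ?case using D(2) by simp
  next
    case (Suc n)
    have "(c * c') ^ Suc n - 1 = (c * c') * ((c * c') ^ n - 1) + (c * c' - 1)" by (simp add: algebra_simps)
    then show ?case using D(3)[OF D(4)[OF S(5)[OF c(1) c'(1)] Suc] c'(2)] by (simp only:)
  qed
  have "finite_index (localization R c) J"
    unfolding finite_index_def
  proof (intro exI[of _ T] conjI ballI)
    show "T \<subseteq> localization R c" using T(2) L(2) by blast
    fix u assume "u \<in> localization R c"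
    then obtain a n where a: "u = a / c ^ n" "a \<in> R" unfolding localization_def by blast
    obtain t where t: "t \<in> T" "a * c' ^ n - t \<in> P" using T(3)[OF S(5)[OF a(2) S(7)[OF c'(1)]]] by blast
    have "u - t = (a - t * c ^ n) / c ^ n" using c(2) by (simp add: a diff_divide_distrib)
    moreover have "a - t * c ^ n = (a * c' ^ n - t) * c ^ n - a * ((c * c') ^ n - 1)"
      by (simp add: algebra_simps power_mult_distrib)
    moreover have "(a * c' ^ n - t) * c ^ n - a * ((c * c') ^ n - 1) \<in> P"
      using D(7)[OF D(5)[OF S(7)[OF c(1)] t(2)] D(4)[OF a(2) cn]] .
    ultimately have "u - t \<in> J" unfolding J_def localization_def by auto
    then show "\<exists>t\<in>T. u - t \<in> J" using t(1) by blast
  qed (rule T(1))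
  moreover have "r ^ k \<notin> J" for k
  proof
    assume "r ^ k \<in> J"
    then obtain y j where y: "(x / c ^ n) ^ k = y / c ^ j" "y \<in> P" unfolding J_def localization_def x(1) by blast
    then have "x ^ k * c ^ j = y * (c ^ n) ^ k" using c(2) by (simp add: power_divide field_simps)
    moreover have "y * (c ^ n) ^ k \<in> P" using y(2) c(1) by (intro D(5) S(7))
    ultimately have "x ^ k \<in> P \<or> c ^ j \<in> P"
      using P(1) S(7)[OF x(2), of k] S(7)[OF c(1), of j] unfolding prime_of_def by metis
    then show False using prime_of_power[OF P(1) R(1)] xP x(2) c(1) by blast
  qed
  ultimately show "finite_prime_avoids (localization R c) r"
    using prime_above[OF L(1) J _ rL] by blast
qed

section \<open>Adjoining an element to such a ring\<close>

definition polys_over :: "'k::field set \<Rightarrow> 'k poly set" where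
  "polys_over I = {f. \<forall>i. coeff f i \<in> I}"

text \<open>The ring \<open>R[a]\<close>.\<close>

definition adjoin :: "'k::field set \<Rightarrow> 'k \<Rightarrow> 'k set" where
  "adjoin R a = (\<lambda>f. poly f a) ` polys_over R"

lemma ideal_of_self: "field_subring R \<Longrightarrow> ideal_of R R"
  unfolding ideal_of_def by (intro conjI ballI order_refl) (simp_all add: field_subringD(2,4,5))

lemma polys_over_ideal:
  assumes I: "ideal_of R I" and R: "field_subring R"
  shows "0 \<in> polys_over I" "f \<in> polys_over I \<Longrightarrow> h \<in> polys_over I \<Longrightarrow> f + h \<in> polys_over I"
    "f \<in> polys_over I \<Longrightarrow> h \<in> polys_over I \<Longrightarrow> f - h \<in> polys_over I"
    "f \<in> polys_over R \<Longrightarrow> h \<in> polys_over I \<Longrightarrow> f * h \<in> polys_over I"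
    "f \<in> polys_over I \<Longrightarrow> h \<in> polys_over R \<Longrightarrow> f * h \<in> polys_over I"
    "c \<in> I \<Longrightarrow> monom c n \<in> polys_over I" "c \<in> I \<Longrightarrow> [:c:] \<in> polys_over I"
    "c \<in> R \<Longrightarrow> f \<in> polys_over I \<Longrightarrow> smult c f \<in> polys_over I"
    "f \<in> polys_over I \<Longrightarrow> pCons 0 f \<in> polys_over I"
proof -
  note D = ideal_ofD[OF I R]
  show "0 \<in> polys_over I" using D(2) by (simp add: polys_over_def)
  show "f \<in> polys_over I \<Longrightarrow> h \<in> polys_over I \<Longrightarrow> f + h \<in> polys_over I" for f h
    by (auto simp: polys_over_def intro: D(3))
  show "f \<in> polys_over I \<Longrightarrow> h \<in> polys_over I \<Longrightarrow> f - h \<in> polys_over I" for f h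
    by (auto simp: polys_over_def intro: D(7))
  show m: "f \<in> polys_over R \<Longrightarrow> h \<in> polys_over I \<Longrightarrow> f * h \<in> polys_over I" for f h
    unfolding polys_over_def by (auto simp: Polynomial.coeff_mult intro!: D(8) D(4))
  show "f \<in> polys_over I \<Longrightarrow> h \<in> polys_over R \<Longrightarrow> f * h \<in> polys_over I" for f h
    using m[of h f] by (simp add: mult.commute)
  show "c \<in> I \<Longrightarrow> monom c n \<in> polys_over I" using D(2) by (simp add: polys_over_def)
  show "c \<in> I \<Longrightarrow> [:c:] \<in> polys_over I" using D(2) by (simp add: polys_over_def coeff_pCons split: nat.split)
  show "c \<in> R \<Longrightarrow> f \<in> polys_over I \<Longrightarrow> smult c f \<in> polys_over I" by (auto simp: polys_over_def intro: D(4))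
  show "f \<in> polys_over I \<Longrightarrow> pCons 0 f \<in> polys_over I" using D(2) by (simp add: polys_over_def coeff_pCons split: nat.split)
qed

lemma poly_mod_root:
  fixes f g :: "'k::field poly"
  assumes "poly g a = 0" shows "poly (f mod g) a = poly f a"
proof -
  have "poly f a = poly (f div g * g + f mod g) a" by (simp only: div_mult_mod_eq)
  then show ?thesis unfolding poly_add poly_mult assms by simp
qed

lemma degree_cancel_lead:
  fixes f g :: "'k::field poly"
  assumes "degree g \<le> degree f" "0 < degree f" "b * lead_coeff f = c * lead_coeff g"
  shows "degree (smult b f - monom c (degree f - degree g) * g) < degree f"
proof (rule degree_lessI)
  show "\<forall>k\<ge>degree f. coeff (smult b f - monom c (degree f - degree g) * g) k = 0"
  proof (intro allI impI)
    fix k assume k: "degree f \<le> k"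
    have "coeff (monom c (degree f - degree g) * g) k = c * coeff g (k - (degree f - degree g))"
      using k by (simp add: coeff_monom_mult)
    moreover have "coeff f k = 0 \<and> coeff g (k - (degree f - degree g)) = 0" if "k > degree f"
      using that assms(1) by (simp add: coeff_eq_0)
    ultimately show "coeff (smult b f - monom c (degree f - degree g) * g) k = 0"
      using k assms(1,3) by (cases "k = degree f") auto
  qed
qed (use assms(2) in simp)

text \<open>Each step of the division subtracts a multiple of \<open>g\<close> whose coefficients are multiples of the leading coefficient
of \<open>f\<close>, since \<open>g\<close> is monic.\<close>

lemma mod_monic_in_ideal:
  assumes I: "ideal_of R I" and R: "field_subring R" and g: "g \<in> polys_over R" "lead_coeff g = 1"
    and f: "f \<in> polys_over I"
  shows "f mod g \<in> polys_over I"
  using f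
proof (induction "degree f" arbitrary: f rule: less_induct)
  case less
  note D = polys_over_ideal[OF I R]
  show ?case
  proof (cases "degree f < degree g")
    case True
    then show ?thesis using less.prems by (simp add: mod_poly_less)
  next
    case False
    show ?thesis
    proof (cases "degree g = 0")
      case True
      then obtain b where "g = [:b:]" by (rule degree_eq_zeroE)
      then have "g = 1" using g(2) by (simp add: one_pCons)
      then show ?thesis using D(1) by simp
    next
      case g0: False
      let ?f = "f - monom (lead_coeff f) (degree f - degree g) * g"
      have "lead_coeff f \<in> I" using less.prems by (simp add: polys_over_def)
      then have fI: "?f \<in> polys_over I" by (rule D(3)[OF less.prems D(5)[OF D(6) g(1)]])
      have "degree ?f < degree f"
        using degree_cancel_lead[of g f 1 "lead_coeff f"] False g0 g(2) by simp
      then have "?f mod g \<in> polys_over I" using less.hyps fI by blast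
      moreover have "?f mod g = f mod g" by (simp add: mod_diff_right_eq[symmetric] flip: mod_diff_left_eq)
      ultimately show ?thesis by (simp only:)
    qed
  qed
qed

text \<open>Division with remainder inside \<open>R[X]\<close>, at the cost of multiplying \<open>f\<close> by a nonzero constant.\<close>

lemma pseudo_division_over:
  assumes R: "field_subring R" and q: "q \<in> polys_over R" "q \<noteq> 0" and f: "f \<in> polys_over R"
  shows "\<exists>c\<in>R. c \<noteq> 0 \<and> (\<exists>u\<in>polys_over R. \<exists>v\<in>polys_over R.
    smult c f = q * u + v \<and> (v = 0 \<or> degree v < degree q))"
  using f
proof (induction "degree f" arbitrary: f rule: less_induct)
  case less
  note S = field_subringD[OF R] and D = polys_over_ideal[OF ideal_of_self[OF R] R]
  have lq: "lead_coeff q \<in> R" "lead_coeff q \<noteq> 0" and lf: "lead_coeff f \<in> R"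
    using q less.prems by (simp_all add: polys_over_def)
  consider "degree f < degree q" | "degree q = 0" | "degree q \<le> degree f" "degree q > 0" by linarith
  then show ?case
  proof cases
    case 1
    then have "smult 1 f = q * 0 + f \<and> (f = 0 \<or> degree f < degree q)" by simp
    with S(1) D(1) less.prems one_neq_zero show ?thesis by blast
  next
    case 2
    then obtain b where b: "q = [:b:]" by (rule degree_eq_zeroE)
    then have "b \<in> R" "b \<noteq> 0" using lq by simp_all
    moreover have "smult b f = q * f + 0 \<and> (0 = (0 :: 'a poly) \<or> degree (0 :: 'a poly) < degree q)" by (simp add: b)
    ultimately show ?thesis using D(1) less.prems by blast
  next
    case 3
    let ?m = "monom (lead_coeff f) (degree f - degree q)"
    let ?f = "smult (lead_coeff q) f - ?m * q"
    have mR: "?m \<in> polys_over R" using D(6)[OF lf] .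
    have fR: "?f \<in> polys_over R" by (rule D(3)[OF D(8)[OF lq(1) less.prems] D(4)[OF mR q(1)]])
    have "degree ?f < degree f" using degree_cancel_lead[of q f "lead_coeff q" "lead_coeff f"] 3 by simp
    then obtain c u v where c: "c \<in> R" "c \<noteq> 0" "u \<in> polys_over R" "v \<in> polys_over R"
      "smult c ?f = q * u + v" "v = 0 \<or> degree v < degree q"
      using less.hyps[OF _ fR] by blast
    have "smult (c * lead_coeff q) f = smult c ?f + smult c (?m * q)"
      by (simp add: smult_diff_right)
    also have "\<dots> = q * (u + smult c ?m) + v" unfolding c(5) by (simp add: algebra_simps)
    finally have e: "smult (c * lead_coeff q) f = q * (u + smult c ?m) + v" .
    have "c * lead_coeff q \<in> R" "c * lead_coeff q \<noteq> 0" using S(5) c(1,2) lq by simp_all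
    moreover have "u + smult c ?m \<in> polys_over R" by (rule D(2)[OF c(3) D(8)[OF c(1) mR]])
    ultimately show ?thesis using e c(4,6) by blast
  qed
qed

text \<open>Relations over the localization come from relations over \<open>R\<close>.\<close>

lemma clear_denominators:
  assumes R: "field_subring R" and c: "c \<in> R" "c \<noteq> 0" and f: "f \<in> polys_over (localization R c)"
  shows "\<exists>k. smult (c ^ k) f \<in> polys_over R"
  using f
proof (induction f)
  case 0
  then show ?case using polys_over_ideal(1)[OF ideal_of_self[OF R] R] by simp
next
  case (pCons b f)
  note S = field_subringD[OF R]
  have "coeff (pCons b f) i \<in> localization R c" for i using pCons.prems by (simp add: polys_over_def)
  from this[of 0] this[of "Suc _"] have b: "b \<in> localization R c" and f: "f \<in> polys_over (localization R c)"
    by (simp_all add: polys_over_def)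
  obtain k where k: "smult (c ^ k) f \<in> polys_over R" using pCons.IH[OF f] by blast
  obtain x n where x: "b = x / c ^ n" "x \<in> R" using b unfolding localization_def by blast
  have "c ^ (k + n) * b = x * c ^ k" using c(2) by (simp add: x(1) power_add)
  then have "c ^ (k + n) * b \<in> R" using S(5)[OF x(2) S(7)[OF c(1)]] by simp
  moreover have "c ^ (k + n) * coeff f i \<in> R" for i
  proof -
    have "c ^ k * coeff f i \<in> R" using k by (simp add: polys_over_def)
    then have "c ^ n * (c ^ k * coeff f i) \<in> R" by (rule S(5)[OF S(7)[OF c(1)]])
    then show ?thesis by (simp add: power_add algebra_simps)
  qed
  ultimately have "smult (c ^ (k + n)) (pCons b f) \<in> polys_over R"
    by (simp add: polys_over_def coeff_pCons split: nat.split)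
  then show ?case by (rule exI)
qed

lemma adjoin_subring:
  assumes R: "field_subring R"
  shows "field_subring (adjoin R a)" "R \<subseteq> adjoin R a" "a \<in> adjoin R a"
proof -
  note S = field_subringD[OF R] and D = polys_over_ideal[OF ideal_of_self[OF R] R]
  show sub: "R \<subseteq> adjoin R a"
  proof
    fix x assume "x \<in> R"
    then show "x \<in> adjoin R a" unfolding adjoin_def by (intro image_eqI[of _ _ "[:x:]"] D(7)) simp_all
  qed
  show "a \<in> adjoin R a" unfolding adjoin_def
    by (intro image_eqI[of _ _ "pCons 0 [:1:]"] D(9) D(7) S(1)) simp
  show "field_subring (adjoin R a)"
    unfolding field_subring_def
  proof (intro conjI ballI)
    show "1 \<in> adjoin R a" using sub S(1) by blast
    fix x y assume "x \<in> adjoin R a" "y \<in> adjoin R a"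
    then obtain f h where f: "x = poly f a" "y = poly h a" "f \<in> polys_over R" "h \<in> polys_over R"
      unfolding adjoin_def by blast
    show "x - y \<in> adjoin R a" unfolding adjoin_def using f(1,2)
      by (intro image_eqI[of _ _ "f - h"] D(3)[OF f(3,4)]) simp
    show "x * y \<in> adjoin R a" unfolding adjoin_def using f(1,2)
      by (intro image_eqI[of _ _ "f * h"] D(4)[OF f(3,4)]) simp
  qed
qed

lemma adjoin_mono: "R \<subseteq> R' \<Longrightarrow> adjoin R a \<subseteq> adjoin R' a"
  unfolding adjoin_def polys_over_def by blast

text \<open>The ideal consists of all \<open>f(a)\<close> whose remainder modulo \<open>g\<close> has coefficients in \<open>P\<close>. It is well
defined since polynomials that vanish at \<open>a\<close> are multiples of \<open>g\<close>. Its quotient is \<open>(R/P)[X]/(g)\<close>, which is finite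
since \<open>g\<close> is monic. In the algebraic case \<open>g\<close> is the minimal polynomial of \<open>a\<close>, in the transcendental case it can be
chosen to make a given element of \<open>R[a]\<close> invertible in the quotient.\<close>

lemma ideal_over_prime:
  assumes R: "field_subring R" and P: "prime_of R P" "finite_index R P"
    and g: "g \<in> polys_over R" "lead_coeff g = 1" "degree g \<ge> 1"
    and H: "\<And>f. f \<in> polys_over R \<Longrightarrow> poly f a = 0 \<Longrightarrow> f mod g = 0"
  obtains J where "ideal_of (adjoin R a) J" "finite_index (adjoin R a) J"
    "\<forall>f\<in>polys_over R. poly f a \<in> J \<longrightarrow> f mod g \<in> polys_over P"
proof -
  have iP: "ideal_of R P" using P(1) by (simp add: prime_of_def)
  note DR = polys_over_ideal[OF ideal_of_self[OF R] R] and DP = polys_over_ideal[OF iP R]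
  define J where "J = (\<lambda>f. poly f a) ` {f \<in> polys_over R. f mod g \<in> polys_over P}"
  have J: "f mod g \<in> polys_over P" if f: "f \<in> polys_over R" "poly f a \<in> J" for f
  proof -
    obtain h where h: "h \<in> polys_over R" "h mod g \<in> polys_over P" "poly f a = poly h a"
      using f(2) unfolding J_def by blast
    have "(f - h) mod g = 0" using H[OF DR(3)[OF f(1) h(1)]] h(3) by simp
    then have "f mod g = h mod g" by (simp add: poly_mod_diff_left)
    then show ?thesis using h(2) by simp
  qed
  have "ideal_of (adjoin R a) J"
    unfolding ideal_of_def
  proof (intro conjI ballI)
    show "J \<subseteq> adjoin R a" by (auto simp: J_def adjoin_def)
    show "0 \<in> J" unfolding J_def using DR(1) DP(1) by (intro image_eqI[of _ _ 0]) simp_all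
    fix x y assume "x \<in> J" "y \<in> J"
    then obtain f h where f: "x = poly f a" "y = poly h a" "f \<in> polys_over R" "h \<in> polys_over R"
      "f mod g \<in> polys_over P" "h mod g \<in> polys_over P" unfolding J_def by blast
    have "(f + h) mod g \<in> polys_over P" unfolding poly_mod_add_left by (rule DP(2)[OF f(5,6)])
    then show "x + y \<in> J" unfolding J_def using f(1,2) DR(2)[OF f(3,4)] by (intro image_eqI[of _ _ "f + h"]) simp_all
  next
    fix x y assume "x \<in> adjoin R a" "y \<in> J"
    then obtain f h where f: "x = poly f a" "y = poly h a" "f \<in> polys_over R" "h \<in> polys_over R"
      "h mod g \<in> polys_over P" unfolding J_def adjoin_def by blast
    have "(f * (h mod g)) mod g \<in> polys_over P"
      by (rule mod_monic_in_ideal[OF iP R g(1,2) DP(4)[OF f(3,5)]])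
    then have "(f * h) mod g \<in> polys_over P" by (simp add: mod_mult_right_eq)
    then show "x * y \<in> J" unfolding J_def using f(1,2) DR(4)[OF f(3,4)] by (intro image_eqI[of _ _ "f * h"]) simp_all
  qed
  moreover have "finite_index (adjoin R a) J"
  proof -
    obtain T where T: "finite T" "T \<subseteq> R" "\<And>x. x \<in> R \<Longrightarrow> \<exists>t\<in>T. x - t \<in> P" using P(2) unfolding finite_index_def by blast
    let ?I = "{..<degree g}"
    define \<tau> where "\<tau> t = (\<Sum>i\<in>?I. monom (t i) i)" for t :: "nat \<Rightarrow> 'a"
    have c\<tau>: "coeff (\<tau> t) i = (if i < degree g then t i else 0)" for t i
      by (simp add: \<tau>_def coeff_sum)
    have \<tau>R: "\<tau> t \<in> polys_over R" if "t \<in> ?I \<rightarrow>\<^sub>E T" for t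
      using that T(2) field_subringD(2)[OF R] by (auto simp: polys_over_def c\<tau>)
    show ?thesis
      unfolding finite_index_def
    proof (intro exI[of _ "(\<lambda>t. poly (\<tau> t) a) ` (?I \<rightarrow>\<^sub>E T)"] conjI ballI)
      show "finite ((\<lambda>t. poly (\<tau> t) a) ` (?I \<rightarrow>\<^sub>E T))" using T(1) by (intro finite_imageI finite_PiE) simp_all
      show "(\<lambda>t. poly (\<tau> t) a) ` (?I \<rightarrow>\<^sub>E T) \<subseteq> adjoin R a" using \<tau>R by (auto simp: adjoin_def)
      fix x assume "x \<in> adjoin R a"
      then obtain f where f: "x = poly f a" "f \<in> polys_over R" unfolding adjoin_def by blast
      let ?r = "f mod g"
      have rR: "?r \<in> polys_over R" by (rule mod_monic_in_ideal[OF ideal_of_self[OF R] R g(1,2) f(2)])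
      have "\<forall>i. \<exists>t\<in>T. coeff ?r i - t \<in> P" using T(3) rR by (simp add: polys_over_def)
      then obtain t where t: "\<And>i. t i \<in> T" "\<And>i. coeff ?r i - t i \<in> P" by metis
      define s where "s = restrict t ?I"
      have s: "s \<in> ?I \<rightarrow>\<^sub>E T" using t(1) by (auto simp: s_def)
      have g0: "g \<noteq> 0" using g(3) by auto
      have "degree (\<tau> s) < degree g" by (rule degree_lessI) (use g(3) in \<open>auto simp: c\<tau>\<close>)
      then have "(f - \<tau> s) mod g = ?r - \<tau> s" by (simp add: poly_mod_diff_left mod_poly_less)
      moreover have "?r - \<tau> s \<in> polys_over P"
      proof -
        have "coeff (?r - \<tau> s) i \<in> P" for i
        proof (cases "i < degree g")
          case True
          then show ?thesis using t(2)[of i] by (simp add: c\<tau> s_def)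
        next
          case False
          then have "coeff ?r i = 0" using degree_mod_less[OF g0, of f] by (auto intro: coeff_eq_0)
          then show ?thesis using False ideal_ofD(2)[OF iP R] by (simp add: c\<tau>)
        qed
        then show ?thesis by (simp add: polys_over_def)
      qed
      ultimately have "poly (f - \<tau> s) a \<in> J"
        unfolding J_def using DR(3)[OF f(2) \<tau>R[OF s]] by (intro imageI) simp
      then show "\<exists>t\<in>(\<lambda>t. poly (\<tau> t) a) ` (?I \<rightarrow>\<^sub>E T). x - t \<in> J" using s f(1) by auto
    qed
  qed
  moreover have "\<forall>f\<in>polys_over R. poly f a \<in> J \<longrightarrow> f mod g \<in> polys_over P" using J by blast
  ultimately show ?thesis by (rule that)
qed

text \<open>Some multiple of \<open>r\<close> is congruent modulo \<open>g\<close> to a constant outside \<open>P\<close>, hence no power of \<open>r\<close> lies in the ideal of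
\<open>ideal_over_prime\<close>.\<close>

lemma finite_prime_avoids_over_prime:
  assumes R: "field_subring R" and P: "prime_of R P" "finite_index R P"
    and g: "g \<in> polys_over R" "lead_coeff g = 1" "degree g \<ge> 1"
    and H: "\<And>f. f \<in> polys_over R \<Longrightarrow> poly f a = 0 \<Longrightarrow> f mod g = 0"
    and r: "r \<in> adjoin R a" and s: "s \<in> polys_over R"
    and b: "b \<in> polys_over R" "poly b a = r * poly s a" "b mod g = [:c:] mod g" "c \<in> R" "c \<notin> P"
  shows "finite_prime_avoids (adjoin R a) r"
proof -
  note A = adjoin_subring[OF R, of a]
  note DR = polys_over_ideal[OF ideal_of_self[OF R] R]
  obtain J where J: "ideal_of (adjoin R a) J" "finite_index (adjoin R a) J"
    "\<forall>f\<in>polys_over R. poly f a \<in> J \<longrightarrow> f mod g \<in> polys_over P"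
    by (rule ideal_over_prime[OF R P g H])
  have pR: "p ^ n \<in> polys_over R" if "p \<in> polys_over R" for p n
  proof (induction n)
    case 0
    have "[:1:] \<in> polys_over R" by (rule DR(7)[OF field_subringD(1)[OF R]])
    then show ?case by (simp add: one_pCons)
  next
    case (Suc n)
    then show ?case using DR(4)[OF that Suc] by simp
  qed
  have "r ^ n \<notin> J" for n
  proof
    assume rJ: "r ^ n \<in> J"
    have "poly (s ^ n) a \<in> adjoin R a" unfolding adjoin_def using pR[OF s] by (rule imageI)
    then have "poly (s ^ n) a * r ^ n \<in> J" using rJ by (rule ideal_ofD(4)[OF J(1) A(1)])
    then have "poly (b ^ n) a \<in> J" by (simp add: b(2) power_mult_distrib mult.commute)
    then have 1: "b ^ n mod g \<in> polys_over P" using J(3) pR[OF b(1)] by blast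
    have "b ^ n mod g = [:c:] ^ n mod g" using b(3) by (metis power_mod)
    also have "[:c:] ^ n = [:c ^ n:]" by (simp add: poly_const_pow)
    also have "[:c ^ n:] mod g = [:c ^ n:]" using g(3) by (intro mod_poly_less) simp
    finally have "[:c ^ n:] \<in> polys_over P" using 1 by simp
    then have "coeff [:c ^ n:] 0 \<in> P" unfolding polys_over_def by blast
    then have "c ^ n \<in> P" by simp
    then show False using prime_of_power[OF P(1) R b(4)] b(5) by blast
  qed
  then show ?thesis by (rule prime_above[OF A(1) J(1,2) r])
qed

text \<open>Among the polynomials \<open>q\<close> with \<open>q(a)\<close> a nonzero multiple of \<open>h(a)\<close>, one of least degree is constant: otherwise pseudo-dividing
\<open>g\<close> by \<open>q\<close> leaves the remainder \<open>0\<close> by minimality, and then the quotient is a polynomial of smaller degree than \<open>g\<close> that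
vanishes at \<open>a\<close>.\<close>

lemma nonzero_constant_multiple:
  assumes R: "field_subring R" and g: "g \<in> polys_over R" "lead_coeff g = 1" "poly g a = 0"
    and H: "\<And>f. f \<in> polys_over R \<Longrightarrow> poly f a = 0 \<Longrightarrow> f mod g = 0"
    and h: "h \<in> polys_over R" "poly h a \<noteq> 0"
  obtains b s where "b \<in> R" "b \<noteq> 0" "s \<in> polys_over R" "b = poly h a * poly s a"
proof -
  note S = field_subringD[OF R] and D = polys_over_ideal[OF ideal_of_self[OF R] R]
  define L where "L q \<longleftrightarrow> q \<in> polys_over R \<and> poly q a \<noteq> 0 \<and> (\<exists>s\<in>polys_over R. poly q a = poly h a * poly s a)" for q
  have "[:1:] \<in> polys_over R" by (rule D(7)[OF S(1)])
  then have "L h" unfolding L_def using h by (intro conjI bexI[of _ "[:1:]"]) simp_all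
  then obtain q where q: "L q" "\<And>q'. L q' \<Longrightarrow> degree q \<le> degree q'"
    using ex_has_least_nat[of L h degree] by blast
  have qR: "q \<in> polys_over R" and qa: "poly q a \<noteq> 0" using q(1) by (simp_all add: L_def)
  obtain s where s: "s \<in> polys_over R" "poly q a = poly h a * poly s a" using q(1) unfolding L_def by blast
  have small: "f = 0" if "f \<in> polys_over R" "poly f a = 0" "degree f < degree g" for f
    using H[OF that(1,2)] mod_poly_less[OF that(3)] by simp
  have "degree q = 0"
  proof (rule ccontr)
    assume q0: "degree q \<noteq> 0"
    have "q \<noteq> 0" using q0 by auto
    obtain c u v where c: "c \<in> R" "c \<noteq> 0" "u \<in> polys_over R" "v \<in> polys_over R"
      "smult c g = q * u + v" "v = 0 \<or> degree v < degree q"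
      using pseudo_division_over[OF R qR \<open>q \<noteq> 0\<close> g(1)] by blast
    have "degree q < degree g"
    proof -
      have g0: "g \<noteq> 0" using g(2) by auto
      have "poly (q mod g) a = poly q a" using g(3) by (rule poly_mod_root)
      moreover have "q mod g \<in> polys_over R" by (rule mod_monic_in_ideal[OF ideal_of_self[OF R] R g(1,2) qR])
      ultimately have "L (q mod g)" using q(1) unfolding L_def by simp
      then have 1: "degree q \<le> degree (q mod g)" "q mod g \<noteq> 0" using q(2) by (auto simp: L_def)
      then show ?thesis using degree_mod_less[OF g0, of q] by simp
    qed
    have "poly q a * poly u a + poly v a = 0" using arg_cong[OF c(5), of "\<lambda>p. poly p a"] g(3) by simp
    then have va: "poly v a = poly h a * poly (- (s * u)) a" using s(2) by (simp add: algebra_simps add_eq_0_iff)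
    have v0: "v = 0"
    proof (cases "poly v a = 0")
      case True
      then show ?thesis using small[OF c(4)] c(6) \<open>degree q < degree g\<close> by auto
    next
      case False
      have "- (s * u) \<in> polys_over R" using D(3)[OF D(1) D(4)[OF s(1) c(3)]] by simp
      then have "L v" unfolding L_def using c(4) False va by blast
      then show ?thesis using q(2)[of v] c(6) by auto
    qed
    then have "poly q a * poly u a = 0" using \<open>poly q a * poly u a + poly v a = 0\<close> by simp
    then have ua: "poly u a = 0" using qa by simp
    have e: "smult c g = q * u" using c(5) v0 by simp
    have "smult c g \<noteq> 0" using c(2) g(2) by auto
    then have u0: "u \<noteq> 0" using e by auto
    have "degree (smult c g) = degree q + degree u" unfolding e using \<open>q \<noteq> 0\<close> u0 by (rule degree_mult_eq)
    then have "degree u < degree g" using q0 c(2) by simp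
    then show False using small[OF c(3) ua] u0 by simp
  qed
  then obtain b where b: "q = [:b:]" by (rule degree_eq_zeroE)
  have "coeff q 0 \<in> R" using qR by (simp add: polys_over_def)
  then have "b \<in> R" by (simp add: b)
  moreover have "b \<noteq> 0" "b = poly h a * poly s a" using qa s(2) by (simp_all add: b)
  ultimately show ?thesis using s(1) that by blast
qed

text \<open>After inverting the leading coefficient, a polynomial of least degree that vanishes at \<open>a\<close> becomes monic and generates
all relations. A nonzero element of \<open>R[a]\<close> then has a nonzero multiple in \<open>R\<close>, and a prime of \<open>R\<close> that avoids this
multiple extends.\<close>

lemma finitely_separated_adjoin_algebraic:
  assumes R: "field_subring R" "finitely_separated R"
    and alg: "f0 \<in> polys_over R" "f0 \<noteq> 0" "poly f0 a = 0"
  shows "finitely_separated (adjoin R a)"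
proof -
  define M where "M f \<longleftrightarrow> f \<in> polys_over R \<and> f \<noteq> 0 \<and> poly f a = 0" for f
  have "M f0" using alg by (simp add: M_def)
  then obtain f where f: "M f" "\<And>h. M h \<Longrightarrow> degree f \<le> degree h"
    using ex_has_least_nat[of M f0 degree] by blast
  define c where "c = lead_coeff f"
  have c: "c \<in> R" "c \<noteq> 0" using f(1) by (simp_all add: c_def M_def polys_over_def)
  let ?R = "localization R c"
  note L = localization_subring[OF R(1) c]
  have sL: "finitely_separated ?R" by (rule finitely_separated_localization[OF R c])
  note D = polys_over_ideal[OF ideal_of_self[OF L(1)] L(1)]
  define g where "g = smult (inverse c) f"
  have fL: "f \<in> polys_over ?R" using f(1) L(2) by (auto simp: M_def polys_over_def)
  have g: "g \<in> polys_over ?R" "lead_coeff g = 1" "poly g a = 0"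
    using D(8)[OF L(3) fL] c(2) f(1) by (simp_all add: g_def c_def M_def)
  have dg: "degree g = degree f" using c(2) by (simp add: g_def)
  have "degree f \<noteq> 0"
  proof
    assume "degree f = 0"
    then obtain b where "f = [:b:]" by (rule degree_eq_zeroE)
    then show False using f(1) by (simp add: M_def)
  qed
  then have g1: "degree g \<ge> 1" using dg by simp
  have H: "h mod g = 0" if h: "h \<in> polys_over ?R" "poly h a = 0" for h
  proof (rule ccontr)
    assume n: "h mod g \<noteq> 0"
    have "h mod g \<in> polys_over ?R" by (rule mod_monic_in_ideal[OF ideal_of_self[OF L(1)] L(1) g(1,2) h(1)])
    then obtain k where k: "smult (c ^ k) (h mod g) \<in> polys_over R" using clear_denominators[OF R(1) c] by blast
    have "poly (h mod g) a = poly h a" using g(3) by (rule poly_mod_root)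
    then have "M (smult (c ^ k) (h mod g))" using k n c(2) h(2) by (simp add: M_def)
    then have "degree f \<le> degree (h mod g)" using f(2) c(2) by fastforce
    moreover have "degree (h mod g) < degree g" 
    proof -
      have "g \<noteq> 0" using g(2) by auto
      then show ?thesis using degree_mod_less[of g h] n by simp
    qed
    ultimately show False using dg by simp
  qed
  show ?thesis
    unfolding finitely_separated_def
  proof (intro ballI impI)
    fix r assume r: "r \<in> adjoin R a" "r \<noteq> 0"
    have sub: "adjoin R a \<subseteq> adjoin ?R a" by (rule adjoin_mono[OF L(2)])
    then have rL: "r \<in> adjoin ?R a" using r(1) by blast
    then obtain h where h: "r = poly h a" "h \<in> polys_over ?R" unfolding adjoin_def by blast
    obtain b s where b: "b \<in> ?R" "b \<noteq> 0" "s \<in> polys_over ?R" "b = poly h a * poly s a"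
      using nonzero_constant_multiple[OF L(1) g H h(2)] r(2) h(1) by metis
    obtain P where P: "prime_of ?R P" "finite_index ?R P" "b \<notin> P"
      using sL b(1,2) unfolding finitely_separated_def finite_prime_avoids_def by blast
    have "finite_prime_avoids (adjoin ?R a) r"
      by (rule finite_prime_avoids_over_prime[OF L(1) P(1,2) g(1,2) g1 H rL b(3) D(7)[OF b(1)] _ _ b(1) P(3)])
        (simp_all add: b(4) h(1))
    then show "finite_prime_avoids (adjoin R a) r"
      by (rule finite_prime_avoids_subring[OF adjoin_subring(1)[OF R(1)] adjoin_subring(1)[OF L(1)] sub])
  qed
qed

text \<open>For \<open>r = h(a)\<close> take \<open>g\<close> proportional to \<open>X * h + 1\<close>. Modulo \<open>g\<close> the product of \<open>X\<close> and \<open>h\<close> is the constant \<open>- 1\<close>, so \<open>r\<close>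
becomes a unit. Inverting the leading coefficient of \<open>h\<close> makes \<open>g\<close> monic.\<close>

lemma finitely_separated_adjoin_transcendental:
  assumes R: "field_subring R" "finitely_separated R"
    and tr: "\<And>f. f \<in> polys_over R \<Longrightarrow> poly f a = 0 \<Longrightarrow> f = 0"
  shows "finitely_separated (adjoin R a)"
  unfolding finitely_separated_def
proof (intro ballI impI)
  fix r assume r: "r \<in> adjoin R a" "r \<noteq> 0"
  then obtain h where h: "r = poly h a" "h \<in> polys_over R" unfolding adjoin_def by blast
  have h0: "h \<noteq> 0" using r(2) h(1) by auto
  define c where "c = lead_coeff h"
  have c: "c \<in> R" "c \<noteq> 0" using h(2) h0 by (simp_all add: c_def polys_over_def)
  let ?R = "localization R c"
  note L = localization_subring[OF R(1) c]
  note D = polys_over_ideal[OF ideal_of_self[OF L(1)] L(1)]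
  have sL: "finitely_separated ?R" by (rule finitely_separated_localization[OF R c])
  then obtain P where P: "prime_of ?R P" "finite_index ?R P"
    using field_subringD(1)[OF L(1)] unfolding finitely_separated_def finite_prime_avoids_def by (metis zero_neq_one)
  have hL: "h \<in> polys_over ?R" using h(2) L(2) by (auto simp: polys_over_def)
  define g where "g = smult (inverse c) (pCons 0 h + [:1:])"
  have g: "g \<in> polys_over ?R" unfolding g_def
    by (rule D(8)[OF L(3) D(2)[OF D(9)[OF hL] D(7)[OF field_subringD(1)[OF L(1)]]]])
  have g1: "lead_coeff g = 1" "degree g \<ge> 1" using h0 c(2) by (simp_all add: g_def c_def)
  have H: "f mod g = 0" if f: "f \<in> polys_over ?R" "poly f a = 0" for f
  proof -
    obtain k where k: "smult (c ^ k) f \<in> polys_over R" using clear_denominators[OF R(1) c f(1)] by blast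
    have "smult (c ^ k) f = 0" using f(2) by (intro tr[OF k]) simp
    then show ?thesis using c(2) by simp
  qed
  have sub: "adjoin R a \<subseteq> adjoin ?R a" by (rule adjoin_mono[OF L(2)])
  have one: "[:1:] \<in> polys_over ?R" by (rule D(7)[OF field_subringD(1)[OF L(1)]])
  have xR: "[:0, 1:] \<in> polys_over ?R" by (rule D(9)[OF one])
  have "pCons 0 h - [:- 1:] = smult c g" using c(2) by (simp add: g_def)
  then have "g dvd pCons 0 h - [:- 1:]" by (simp add: dvd_smult)
  then have cg: "pCons 0 h mod g = [:- 1:] mod g" by (simp add: mod_eq_dvd_iff)
  have m1: "- 1 \<in> ?R" by (rule field_subringD(6)[OF L(1) field_subringD(1)[OF L(1)]])
  have iP: "ideal_of ?R P" using P(1) by (simp add: prime_of_def)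
  have m1P: "- 1 \<notin> P"
  proof
    assume "- 1 \<in> P"
    then have "- (- 1) \<in> P" by (rule ideal_ofD(6)[OF iP L(1)])
    then show False using P(1) by (simp add: prime_of_def)
  qed
  have "finite_prime_avoids (adjoin ?R a) r"
    by (rule finite_prime_avoids_over_prime[OF L(1) P g g1 H _ xR D(9)[OF hL] _ cg m1 m1P])
      (use r(1) sub h(1) in auto)
  then show "finite_prime_avoids (adjoin R a) r"
    by (rule finite_prime_avoids_subring[OF adjoin_subring(1)[OF R(1)] adjoin_subring(1)[OF L(1)] sub])
qed

lemma finite_subset_of_finitely_separated:
  assumes "finite X"
  shows "\<exists>R. field_subring R \<and> X \<subseteq> R \<and> finitely_separated R"
  using assms
proof (induction X rule: finite_induct)
  case empty
  then show ?case using field_subring_of_int finitely_separated_of_int by blast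
next
  case (insert a X)
  then obtain R where R: "field_subring R" "X \<subseteq> R" "finitely_separated R" by blast
  have "finitely_separated (adjoin R a)"
  proof (cases "\<exists>f\<in>polys_over R. f \<noteq> 0 \<and> poly f a = 0")
    case True
    then show ?thesis using finitely_separated_adjoin_algebraic[OF R(1,3)] by blast
  next
    case False
    then show ?thesis using finitely_separated_adjoin_transcendental[OF R(1,3)] by blast
  qed
  then show ?case using adjoin_subring[OF R(1), of a] R(2) by (intro exI[of _ "adjoin R a"]) auto
qed

section \<open>Residual finiteness from representations\<close>

context K_algebra
begin

text \<open>Malcev's argument: a representation in which \<open>g - 1\<close> does not act as zero is reduced modulo a prime of finite
index that avoids some nonzero entry of \<open>\<rho> g - \<rho> 0\<close>. The matrix \<open>\<rho> 0\<close> may be a proper idempotent, so matrices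
are compared with \<open>\<rho> 0\<close> instead of the identity matrix.\<close>

lemma representation_imp_residually_finite:
  fixes f :: "('g::group_add \<Rightarrow>\<^sub>0 'k) \<Rightarrow> 'a"
  assumes f: "algebra_iso group_algebra_scale scale f" and S: "finite S" "generates S"
    and reps: "\<And>d. d \<ge> 1 \<Longrightarrow> \<exists>n\<ge>1. \<exists>\<psi>. matrix_representation n \<psi> \<and> d_approximation S d n \<psi>"
  shows "residually_finite (type_group TYPE('g::group_add))"
  unfolding residually_finite_def
proof (intro ballI impI)
  let ?G = "type_group TYPE('g::group_add)"
  interpret G: group ?G by (rule group_type_group)
  have car: "carrier ?G = UNIV" and mult: "x \<otimes>\<^bsub>?G\<^esub> y = x + y" and one: "\<one>\<^bsub>?G\<^esub> = 0" for x y
    by (simp_all add: type_group_def)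
  have inv: "inv\<^bsub>?G\<^esub> x = - x" for x
    by (rule G.inv_equality) (simp_all add: car mult one)
  interpret ga: K_algebra "group_algebra_scale :: 'k \<Rightarrow> ('g \<Rightarrow>\<^sub>0 'k) \<Rightarrow> _" by (rule K_algebra_group_algebra)
  have bij: "bij f" and add: "\<And>x y. f (x + y) = f x + f y"
    and sc: "\<And>c x. f (group_algebra_scale c x) = scale c (f x)"
    and mul: "\<And>x y. f (x * y) = f x * f y" and f1: "f 1 = 1"
    using f by (simp_all add: algebra_iso_def)
  have f0: "f 0 = 0" using add[of 0 0] by simp
  have inj: "f x = f y \<longleftrightarrow> x = y" for x y using bij by (simp add: bij_is_inj inj_eq)
  fix g :: 'g assume g: "g \<in> carrier ?G" "g \<noteq> \<one>\<^bsub>?G\<^esub>"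
  then have g0: "g \<noteq> 0" by (simp add: one)
  define e where "e h = f (Poly_Mapping.single h 1)" for h :: 'g
  have emul: "e (h + h') = e h * e h'" for h h' unfolding e_def by (simp add: mult_single flip: mul)
  have "Poly_Mapping.single g (1::'k) \<noteq> Poly_Mapping.single 0 1"
    using g0 by (metis lookup_single_eq lookup_single_not_eq zero_neq_one)
  then have ne: "e g - e 0 \<noteq> 0" using inj by (simp add: e_def)
  obtain r where r: "e g - e 0 \<in> A_le S r" using A_le_exhausts[OF S(2)] by (rule exE)
  define d where "d = max 2 r"
  have d: "d \<ge> 2" "d \<ge> 1" "e g - e 0 \<in> A_le S d" using r A_le_mono[of r d S] by (auto simp: d_def)
  obtain n \<psi> where n: "n \<ge> 1" and \<psi>: "matrix_representation n \<psi>" "d_approximation S d n \<psi>"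
    using reps[OF d(2)] by blast
  note l = matrix_representationD(1)[OF \<psi>(1)]
  note c = linear_to_matD(1)[OF l]
  have "fs.dim (null_space n (\<psi> (e g - e 0))) \<le> n div d"
    using \<psi>(2) d(3) ne unfolding d_approximation_iff[OF n d(2)] by blast
  also have "\<dots> < n" using n d(1) by (intro div_less_dividend) simp_all
  finally have kl: "fs.dim (null_space n (\<psi> (e g - e 0))) < n" .
  define \<rho> where "\<rho> h = \<psi> (e h)" for h
  have \<rho>c: "\<rho> h \<in> carrier_mat n n" for h by (simp add: \<rho>_def c)
  have \<rho>mul: "\<rho> (h + h') = \<rho> h * \<rho> h'" for h h' unfolding \<rho>_def emul by (rule matrix_representationD(2)[OF \<psi>(1)])
  have "\<rho> g \<noteq> \<rho> 0"
  proof
    assume eq: "\<rho> g = \<rho> 0"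
    have "mat_act (\<psi> (e g - e 0)) x = 0" for x
      unfolding af.linear_diff[OF linear_act[OF l]] using eq by (simp add: \<rho>_def)
    then have "null_space n (\<psi> (e g - e 0)) = coord_space n" by (auto simp: null_space_def)
    then show False using kl by (simp add: dim_coord_space)
  qed
  then obtain i0 j0 where ij: "i0 < n" "j0 < n" "\<rho> g $$ (i0, j0) \<noteq> \<rho> 0 $$ (i0, j0)"
    using \<rho>c[of g] \<rho>c[of 0] by (metis carrier_matD eq_matI)
  \<comment> \<open>The supports of the generators of the algebra generate the group, so a subring that contains the
    matrix entries over these supports and their inverses contains the entries of every \<open>\<rho> h\<close>.\<close>
  define k where "k = inv_into UNIV f"
  have fk: "f (k x) = x" for x using bij by (simp add: k_def bij_is_surj surj_f_inv_f)
  define Y where "Y = insert 0 (\<Union>s\<in>S. Poly_Mapping.keys (k s))"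
  have fY: "finite Y" using S(1) by (simp add: Y_def)
  define X where "X = (\<lambda>(y, i, j). \<rho> y $$ (i, j)) ` ((Y \<union> uminus ` Y) \<times> {..<n} \<times> {..<n})"
  have "finite X" using fY by (simp add: X_def)
  then obtain R where R: "field_subring R" "X \<subseteq> R" "finitely_separated R"
    using finite_subset_of_finitely_separated by blast
  note SR = field_subringD[OF R(1)]
  define ent where "ent M \<longleftrightarrow> (\<forall>i<n. \<forall>j<n. M $$ (i, j) \<in> R)" for M
  have ent_mul: "ent (M * M')" if "ent M" "ent M'" "M \<in> carrier_mat n n" "M' \<in> carrier_mat n n" for M M'
    unfolding ent_def
  proof (intro allI impI)
    fix i j assume "i < n" "j < n"
    then have "(M * M') $$ (i, j) = (\<Sum>t<n. M $$ (i, t) * M' $$ (t, j))"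
      using that(3,4) by (simp add: scalar_prod_def atLeast0LessThan)
    also have "\<dots> \<in> R" using that(1,2) \<open>i < n\<close> \<open>j < n\<close> by (intro SR(8) SR(5)) (simp_all add: ent_def)
    finally show "(M * M') $$ (i, j) \<in> R" .
  qed
  define H where "H = {h. ent (\<rho> h) \<and> ent (\<rho> (- h))}"
  have YH: "y \<in> H" if "y \<in> Y" for y
  proof -
    have "\<rho> h $$ (i, j) \<in> R" if "h \<in> Y \<union> uminus ` Y" "i < n" "j < n" for h i j
      using R(2) that unfolding X_def by (force simp: image_iff)
    then show ?thesis using that unfolding H_def ent_def by blast
  qed
  have H0: "0 \<in> H" using YH by (simp add: Y_def)
  have Hadd: "h + h' \<in> H" if "h \<in> H" "h' \<in> H" for h h'
    using that ent_mul[OF _ _ \<rho>c \<rho>c] unfolding H_def by (simp add: \<rho>mul minus_add del: add_uminus_conv_diff)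
  define B where "B = {p :: 'g \<Rightarrow>\<^sub>0 'k. Poly_Mapping.keys p \<subseteq> H}"
  have "is_subalgebra (f ` B)"
    unfolding is_subalgebra_def
  proof (intro conjI ballI)
    show "subspace (f ` B)"
    proof (rule subspaceI)
      show "0 \<in> f ` B" by (rule image_eqI[of _ _ 0]) (simp_all add: B_def f0)
      fix x y assume "x \<in> f ` B" "y \<in> f ` B"
      then obtain p q where "x = f p" "y = f q" "p \<in> B" "q \<in> B" by blast
      then show "x + y \<in> f ` B" using keys_add[of p q] by (intro image_eqI[of _ _ "p + q"]) (auto simp: add B_def)
    next
      fix a x assume "x \<in> f ` B"
      then obtain p where "x = f p" "p \<in> B" by blast
      then show "scale a x \<in> f ` B"
        by (intro image_eqI[of _ _ "group_algebra_scale a p"])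
          (auto simp: sc B_def in_keys_iff lookup_group_algebra_scale subset_iff)
    qed
    show "1 \<in> f ` B"
      by (rule image_eqI[of _ _ 1]) (use H0 f1 in \<open>auto simp: B_def simp flip: single_one\<close>)
    fix x y assume "x \<in> f ` B" "y \<in> f ` B"
    then obtain p q where pq: "x = f p" "y = f q" "p \<in> B" "q \<in> B" by blast
    have "Poly_Mapping.keys (p * q) \<subseteq> H" using keys_mult[of p q] pq(3,4) Hadd by (fastforce simp: B_def)
    then show "x * y \<in> f ` B" using pq(1,2) by (intro image_eqI[of _ _ "p * q"]) (simp_all add: mul B_def)
  qed
  moreover have "S \<subseteq> f ` B"
  proof
    fix s assume "s \<in> S"
    then have "k s \<in> B" using YH by (auto simp: B_def Y_def)
    then show "s \<in> f ` B" using fk[of s] by (metis imageI)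
  qed
  ultimately have "is_subalgebra hull S \<subseteq> f ` B" by (intro hull_minimal)
  then have all: "f ` B = UNIV" using S(2) unfolding generates_def by blast
  have HU: "h \<in> H" for h
  proof -
    have "f (Poly_Mapping.single h 1) \<in> f ` B" using all by simp
    then have "Poly_Mapping.single h 1 \<in> B" using inj by auto
    then show ?thesis by (simp add: B_def)
  qed
  have ent: "\<rho> h $$ (i, j) \<in> R" if "i < n" "j < n" for h i j using HU[of h] that by (simp add: H_def ent_def)
  let ?r = "\<rho> g $$ (i0, j0) - \<rho> 0 $$ (i0, j0)"
  have "?r \<in> R" "?r \<noteq> 0" using SR(3)[OF ent ent] ij by simp_all
  then obtain P where P: "prime_of R P" "finite_index R P" "?r \<notin> P"
    using R(3) unfolding finitely_separated_def finite_prime_avoids_def by blast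
  have iP: "ideal_of R P" using P(1) by (simp add: prime_of_def)
  note DP = ideal_ofD[OF iP R(1)]
  define eqv where "eqv h h' \<longleftrightarrow> (\<forall>i<n. \<forall>j<n. \<rho> h $$ (i, j) - \<rho> h' $$ (i, j) \<in> P)" for h h'
  have ref: "eqv h h" for h by (simp add: eqv_def DP(2))
  have sym: "eqv h' h" if "eqv h h'" for h h'
    unfolding eqv_def
  proof (intro allI impI)
    fix i j assume "i < n" "j < n"
    then have "- (\<rho> h $$ (i, j) - \<rho> h' $$ (i, j)) \<in> P" using that by (intro DP(6)) (simp add: eqv_def)
    then show "\<rho> h' $$ (i, j) - \<rho> h $$ (i, j) \<in> P" by simp
  qed
  have trans: "eqv h h''" if "eqv h h'" "eqv h' h''" for h h' h''
    unfolding eqv_def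
  proof (intro allI impI)
    fix i j assume "i < n" "j < n"
    then have "(\<rho> h $$ (i, j) - \<rho> h' $$ (i, j)) + (\<rho> h' $$ (i, j) - \<rho> h'' $$ (i, j)) \<in> P"
      using that by (intro DP(3)) (simp_all add: eqv_def)
    then show "\<rho> h $$ (i, j) - \<rho> h'' $$ (i, j) \<in> P" by simp
  qed
  have entry: "\<rho> (h + h') $$ (i, j) = (\<Sum>t<n. \<rho> h $$ (i, t) * \<rho> h' $$ (t, j))" if "i < n" "j < n" for h h' i j
    using that \<rho>c[of h] \<rho>c[of h'] by (simp add: \<rho>mul scalar_prod_def atLeast0LessThan)
  have left: "eqv (x + h) (x + h')" if "eqv h h'" for x h h'
    unfolding eqv_def
  proof (intro allI impI)
    fix i j assume ij: "i < n" "j < n"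
    have "(\<Sum>t<n. \<rho> x $$ (i, t) * (\<rho> h $$ (t, j) - \<rho> h' $$ (t, j))) \<in> P"
      using that ij ent by (intro DP(8) DP(4)) (simp_all add: eqv_def)
    then show "\<rho> (x + h) $$ (i, j) - \<rho> (x + h') $$ (i, j) \<in> P"
      by (simp add: entry[OF ij] right_diff_distrib sum_subtractf)
  qed
  have right: "eqv (h + x) (h' + x)" if "eqv h h'" for x h h'
    unfolding eqv_def
  proof (intro allI impI)
    fix i j assume ij: "i < n" "j < n"
    have "(\<Sum>t<n. (\<rho> h $$ (i, t) - \<rho> h' $$ (i, t)) * \<rho> x $$ (t, j)) \<in> P"
      using that ij ent by (intro DP(8) DP(5)) (simp_all add: eqv_def)
    then show "\<rho> (h + x) $$ (i, j) - \<rho> (h' + x) $$ (i, j) \<in> P"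
      by (simp add: entry[OF ij] left_diff_distrib sum_subtractf)
  qed
  define N where "N = {h. eqv h 0}"
  have N_diff: "h + - h' \<in> N" if "eqv h h'" for h h' using right[OF that, of "- h'"] by (simp add: N_def)
  have sub: "subgroup N ?G"
  proof (rule G.subgroupI)
    show "N \<noteq> {}" using ref[of 0] by (auto simp: N_def)
    show "inv\<^bsub>?G\<^esub> h \<in> N" if "h \<in> N" for h
      using sym[OF left[of h 0 "- h"]] that by (simp add: N_def inv)
    show "h \<otimes>\<^bsub>?G\<^esub> h' \<in> N" if "h \<in> N" "h' \<in> N" for h h'
      using trans[OF right[of h 0 h'], of 0] that by (simp add: N_def mult)
  qed (simp add: car)
  have nor: "N \<lhd> ?G"
  proof (rule G.normal_invI[OF sub])
    fix x h assume "x \<in> carrier ?G" "h \<in> N"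
    then have "eqv (x + h) (x + 0)" by (intro left) (simp add: N_def)
    then have "eqv (x + h + - x) (x + 0 + - x)" by (rule right)
    then show "x \<otimes>\<^bsub>?G\<^esub> h \<otimes>\<^bsub>?G\<^esub> inv\<^bsub>?G\<^esub> x \<in> N" by (simp add: N_def mult inv)
  qed
  have "finite (rcosets\<^bsub>?G\<^esub> N)"
  proof -
    obtain T where T: "finite T" "\<And>x. x \<in> R \<Longrightarrow> \<exists>t\<in>T. x - t \<in> P" using P(2) unfolding finite_index_def by blast
    define \<tau> where "\<tau> x = (SOME t. t \<in> T \<and> x - t \<in> P)" for x
    have \<tau>: "\<tau> x \<in> T \<and> x - \<tau> x \<in> P" if "x \<in> R" for x
    proof -
      have "\<exists>t. t \<in> T \<and> x - t \<in> P" using T(2)[OF that] by blast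
      then show ?thesis unfolding \<tau>_def by (rule someI_ex)
    qed
    define \<kappa> where "\<kappa> h = restrict (\<lambda>(i, j). \<tau> (\<rho> h $$ (i, j))) ({..<n} \<times> {..<n})" for h
    have "\<kappa> h \<in> ({..<n} \<times> {..<n}) \<rightarrow>\<^sub>E T" for h
    proof -
      have "(\<lambda>(i, j). \<tau> (\<rho> h $$ (i, j))) \<in> ({..<n} \<times> {..<n}) \<rightarrow> T" using \<tau>[OF ent] by auto
      then show ?thesis unfolding \<kappa>_def by (simp only: restrict_PiE_iff) auto
    qed
    then have "range \<kappa> \<subseteq> ({..<n} \<times> {..<n}) \<rightarrow>\<^sub>E T" by blast
    moreover have "finite (({..<n} \<times> {..<n}) \<rightarrow>\<^sub>E T)" using T(1) by (intro finite_PiE) simp_all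
    ultimately have fin: "finite (range \<kappa>)" by (rule finite_subset)
    have same: "N #>\<^bsub>?G\<^esub> h = N #>\<^bsub>?G\<^esub> h'" if "\<kappa> h = \<kappa> h'" for h h'
    proof -
      have "eqv h h'"
        unfolding eqv_def
      proof (intro allI impI)
        fix i j assume ij: "i < n" "j < n"
        have "\<tau> (\<rho> h $$ (i, j)) = \<tau> (\<rho> h' $$ (i, j))" using fun_cong[OF that, of "(i, j)"] ij by (simp add: \<kappa>_def)
        then have "\<rho> h' $$ (i, j) - \<tau> (\<rho> h $$ (i, j)) \<in> P" using \<tau>[OF ent[OF ij, of h']] by simp
        with conjunct2[OF \<tau>[OF ent[OF ij, of h]]]
        have "(\<rho> h $$ (i, j) - \<tau> (\<rho> h $$ (i, j))) - (\<rho> h' $$ (i, j) - \<tau> (\<rho> h $$ (i, j))) \<in> P" by (rule DP(7))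
        then show "\<rho> h $$ (i, j) - \<rho> h' $$ (i, j) \<in> P" by simp
      qed
      then have "h + - h' \<in> N" by (rule N_diff)
      then have "h \<in> N #>\<^bsub>?G\<^esub> h'"
        unfolding r_coset_def by (intro UN_I[of "h + - h'"]) (simp_all add: mult add.assoc)
      then show ?thesis using G.repr_independence[OF _ _ sub, of h h'] by (simp add: car)
    qed
    have "rcosets\<^bsub>?G\<^esub> N = (\<lambda>u. N #>\<^bsub>?G\<^esub> (SOME h. \<kappa> h = u)) ` range \<kappa>"
    proof -
      have "N #>\<^bsub>?G\<^esub> h = N #>\<^bsub>?G\<^esub> (SOME h'. \<kappa> h' = \<kappa> h)" for h
        by (rule same) (rule someI[of "\<lambda>h'. \<kappa> h' = \<kappa> h" h, OF refl, symmetric])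
      then show ?thesis unfolding RCOSETS_def car by auto
    qed
    then show ?thesis using fin by simp
  qed
  moreover have "g \<notin> N" using P(3) ij(1,2) by (auto simp: N_def eqv_def)
  ultimately show "\<exists>N. N \<lhd> ?G \<and> finite (rcosets\<^bsub>?G\<^esub> N) \<and> g \<notin> N" using nor by blast
qed

end

section \<open>The theorem\<close>

theorem theorem6p4:
  fixes scale :: "'k::field \<Rightarrow> 'a::ring_1_no_zero_divisors \<Rightarrow> 'a"
    and S :: "'a set"
  assumes "K_algebra scale"
    and "finite S" and "1 \<in> S" and "K_algebra.generates scale S"
    and "K_algebra.amenable scale"
  shows
    "(K_algebra.weakly_stable scale S \<longleftrightarrow>
        (\<exists>(n :: nat \<Rightarrow> nat) (\<psi> :: nat \<Rightarrow> 'a \<Rightarrow> 'k mat).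
           (\<forall>k. K_algebra.matrix_representation scale (n k) (\<psi> k)) \<and>
           K_algebra.linear_sofic_representation scale S n \<psi>))
     \<and>
     ((\<exists>f :: ('g::group_add \<Rightarrow>\<^sub>0 'k) \<Rightarrow> 'a. algebra_iso group_algebra_scale scale f) \<and>
      amenable_group (type_group TYPE('g)) \<longrightarrow>
        (K_algebra.weakly_stable scale S \<longleftrightarrow> residually_finite (type_group TYPE('g))))"
proof -
  interpret K_algebra scale by (rule assms(1))
  have nzd: "x = 0 \<or> y = 0" if "x * y = 0" for x y :: 'a using that by simp
  have key: "weakly_stable S \<longleftrightarrow> (\<forall>d\<ge>1. \<exists>n\<ge>1. \<exists>\<psi>. matrix_representation n \<psi> \<and> d_approximation S d n \<psi>)"
    using weakly_stable_imp_representation[OF _ assms(5,3,2) _ nzd]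
      representations_imp_weakly_stable[OF assms(5,3,2,4)] by blast
  show ?thesis
  proof (intro conjI impI)
    show "weakly_stable S \<longleftrightarrow> (\<exists>(n :: nat \<Rightarrow> nat) (\<psi> :: nat \<Rightarrow> 'a \<Rightarrow> 'k mat).
        (\<forall>k. matrix_representation (n k) (\<psi> k)) \<and> linear_sofic_representation S n \<psi>)"
      unfolding sofic_representation_iff by (rule key)
    assume "(\<exists>f :: ('g \<Rightarrow>\<^sub>0 'k) \<Rightarrow> 'a. algebra_iso group_algebra_scale scale f) \<and>
      amenable_group (type_group TYPE('g))"
    then obtain f :: "('g \<Rightarrow>\<^sub>0 'k) \<Rightarrow> 'a" where f: "algebra_iso group_algebra_scale scale f"
      and am: "amenable_group (type_group TYPE('g))" by blast
    show "weakly_stable S \<longleftrightarrow> residually_finite (type_group TYPE('g))"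
      unfolding key
      using representation_imp_residually_finite[OF f assms(2,4)]
        residually_finite_imp_representation[OF f _ am nzd assms(2)] by blast
  qed
qed

end
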